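(* Let $n\ge2$, let $\Omega=\{y'\in\mathbb{R}^{n-1}:|y'|<1\}$, let $q(y')=\sqrt{1-y_1^2-\cdots-y_{n-1}^2}$, and let $\tilde S=\{(y',q(y')):y'\in\Omega\}$ be the open top half of the unit sphere in $\mathbb{R}^n$. Let $A$ be a diagonal $n\times n$ matrix with exactly one diagonal entry equal to $1$ (in any position) and the other $n-1$ diagonal entries equal to $-1$. Let $\mathcal{R}:\mathcal{E}'(\mathbb{R}^n\setminus\tilde S)\to\mathcal{D}'(\Omega\times(0,\infty))$ be the Radon transform $$\mathcal{R}f(y',t)=\int_{\mathbb{R}}\int_{\mathbb{R}^n}|\nabla_x\psi|\,f(x)\,e^{i\psi(y',t,x,\omega)}\,dx\,d\omega,\qquad \psi(y',t,x,\omega)=\omega\big(t-x_T^TAx_T\big),\quad x_T=x-(y',q(y')).$$ Then $\mathcal{R}$ is a Fourier integral operator associated to a two-sided fold canonical relation; that is, both projections $\pi_L$ and $\pi_R$ from its canonical relation $C$ have only fold singularities.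
   Context: Points of $\mathbb{R}^n$ are regarded as column vectors. The functions/distributions $f$ have support disjoint from $\tilde S$, and $t>0$ throughout. The integral defining $\mathcal{R}$ is understood as an oscillatory integral. A Fourier integral operator (FIO) with nondegenerate phase function $\varphi(u,v;\theta)$ and symbol amplitude $a$ is an operator $\mathcal{E}'(V)\to\mathcal{D}'(U)$ with kernel $\int e^{i\varphi}a\,d\theta$ (as usual, modulo smooth kernels); its canonical relation is $\{(u,d_u\varphi;v,-d_v\varphi): d_\theta\varphi=0\}$. Canonical relation of $\mathcal{R}$: $C=\{(y',t,d_{y'}\psi,\omega;\,x,-d_x\psi):\ \partial_\omega\psi=0\}$, a smooth $2n$-dimensional manifold globally parametrized by $(y',x,\omega)$ with $y'\in\Omega$, $x\in\mathbb{R}^n\setminus\tilde S$, $\omega\in\mathbb{R}\setminus\{0\}$, and $t=x_T^TAx_T>0$. With $B$ the $(n-1)\times n$ matrix $B=(I_{n-1}\,|\,\nabla q(y'))$, the projections are $$\pi_L(y',x,\omega)=(y',\,x_T^TAx_T,\,2\omega BAx_T,\,\omega)\in T^*(\Omega\times(0,\infty)),\qquad \pi_R(y',x,\omega)=(x,\,2\omega Ax_T)\in T^*\mathbb{R}^n .$$ For a smooth map $f$ between manifolds of equal dimension (in local coordinates), let $S_1(f)=\{p:\det(df_p)=0,\ d(\det(df))_p\ne0\}$, a smooth hypersurface on which $df$ has corank $1$. $f$ has a fold singularity along $S_1(f)$ if $\ker(df_p)$ is transversal to $T_pS_1(f)$ for all $p\in S_1(f)$. "Only fold singularities" means that every point where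 $\det(df)=0$ lies in $S_1(f)$ and the transversality condition holds there. A canonical relation is a two-sided fold if both $\pi_L$ and $\pi_R$ have (only) fold singularities. *)

theory Defs
  imports "HOL-Analysis.Analysis"
begin

section \<open>Smooth functions\<close>

fun Ck_on :: "nat \<Rightarrow> 'a::real_normed_vector set \<Rightarrow> ('a \<Rightarrow> 'b::real_normed_vector) \<Rightarrow> bool" where
  "Ck_on 0 S f \<longleftrightarrow> continuous_on S f"
| "Ck_on (Suc k) S f \<longleftrightarrow>
     (\<forall>x\<in>S. f differentiable (at x)) \<and> (\<forall>v. Ck_on k S (\<lambda>x. frechet_derivative f (at x) v))"

text \<open>On a set that is not open, smooth means smooth on some open neighbourhood.  This is needed
  because the complement of the open half sphere is not open: it contains the equator.\<close>

definition smooth_on :: "'a::real_normed_vector set \<Rightarrow> ('a \<Rightarrow> 'b::real_normed_vector) \<Rightarrow> bool" where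
  "smooth_on S f \<longleftrightarrow> (\<exists>W. open W \<and> S \<subseteq> W \<and> (\<forall>k. Ck_on k W f))"

definition gradient :: "('a::real_inner \<Rightarrow> real) \<Rightarrow> 'a \<Rightarrow> 'a" where
  "gradient f x = (THE D. GDERIV f x :> D)"

fun iter_deriv :: "'a::real_normed_vector list \<Rightarrow> ('a \<Rightarrow> 'b::real_normed_vector) \<Rightarrow> 'a \<Rightarrow> 'b" where
  "iter_deriv [] f = f"
| "iter_deriv (v # vs) f = (\<lambda>x. frechet_derivative (iter_deriv vs f) (at x) v)"


section \<open>Distributions\<close>

text \<open>Maximum over K of all partial derivatives of order at most N (0 if K is empty).\<close>

definition Ck_seminorm :: "nat \<Rightarrow> 'a::euclidean_space set \<Rightarrow> ('a \<Rightarrow> complex) \<Rightarrow> real" where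
  "Ck_seminorm N K \<phi> =
     Sup (insert 0 {norm (iter_deriv vs \<phi> x) |vs x. x \<in> K \<and> set vs \<subseteq> Basis \<and> length vs \<le> N})"

definition test_funs :: "'a::euclidean_space set \<Rightarrow> ('a \<Rightarrow> complex) set" where
  "test_funs U = {\<phi>. smooth_on UNIV \<phi> \<and> (\<exists>K. compact K \<and> K \<subseteq> U \<and> (\<forall>x. x \<notin> K \<longrightarrow> \<phi> x = 0))}"

text \<open>A distribution is represented by a functional on all functions; only its values on the
  functions of the relevant space (test functions, respectively smooth functions) matter.\<close>

type_synonym 'a functional = "('a \<Rightarrow> complex) \<Rightarrow> complex"

definition linear_functional_on :: "('a \<Rightarrow> complex) set \<Rightarrow> 'a functional \<Rightarrow> bool" where
  "linear_functional_on X u \<longleftrightarrow>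
     (\<forall>\<phi>\<in>X. \<forall>\<rho>\<in>X. u (\<lambda>x. \<phi> x + \<rho> x) = u \<phi> + u \<rho>) \<and>
     (\<forall>c. \<forall>\<phi>\<in>X. u (\<lambda>x. c * \<phi> x) = c * u \<phi>)"

definition distributions :: "'a::euclidean_space set \<Rightarrow> 'a functional set" where
  "distributions U = {u. linear_functional_on (test_funs U) u \<and>
     (\<forall>K. compact K \<and> K \<subseteq> U \<longrightarrow>
        (\<exists>C N. \<forall>\<phi>\<in>test_funs U. (\<forall>x. x \<notin> K \<longrightarrow> \<phi> x = 0) \<longrightarrow>
           norm (u \<phi>) \<le> C * Ck_seminorm N K \<phi>))}"

text \<open>Distributions with support in the compact set K: continuous functionals on the smooth
  functions on W, for every open neighbourhood W of K.\<close>

definition dists_supported_in :: "'a::euclidean_space set \<Rightarrow> 'a functional set" where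
  "dists_supported_in K = {f. \<forall>W. open W \<and> K \<subseteq> W \<longrightarrow>
     linear_functional_on {\<phi>. smooth_on W \<phi>} f \<and>
     (\<exists>L C N. compact L \<and> L \<subseteq> W \<and>
        (\<forall>\<phi>. smooth_on W \<phi> \<longrightarrow> norm (f \<phi>) \<le> C * Ck_seminorm N L \<phi>))}"

definition compact_dists :: "'a::euclidean_space set \<Rightarrow> 'a functional set" where
  "compact_dists V = (\<Union>K\<in>{K. compact K \<and> K \<subseteq> V}. dists_supported_in K)"

text \<open>Weak convergence of a sequence in the space of compactly supported distributions on V; the
  supports are to lie in a common compact subset of V.\<close>

definition compact_dists_tendsto ::
    "'a::euclidean_space set \<Rightarrow> (nat \<Rightarrow> 'a functional) \<Rightarrow> 'a functional \<Rightarrow> bool" where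
  "compact_dists_tendsto V F f \<longleftrightarrow>
     (\<exists>K. compact K \<and> K \<subseteq> V \<and> (\<forall>j. F j \<in> dists_supported_in K) \<and> f \<in> dists_supported_in K \<and>
        (\<forall>W \<phi>. open W \<and> K \<subseteq> W \<and> smooth_on W \<phi> \<longrightarrow> (\<lambda>j. F j \<phi>) \<longlonglongrightarrow> f \<phi>))"

definition dist_of_fun :: "('a::euclidean_space \<Rightarrow> complex) \<Rightarrow> 'a functional" where
  "dist_of_fun h = (\<lambda>\<phi>. LINT x|lborel. h x * \<phi> x)"

definition dist_operator ::
    "'u::euclidean_space set \<Rightarrow> 'v::euclidean_space set \<Rightarrow> ('v functional \<Rightarrow> 'u functional) \<Rightarrow> bool" where
  "dist_operator U V T \<longleftrightarrow>
     (\<forall>f\<in>compact_dists V. T f \<in> distributions U) \<and>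
     (\<forall>g\<in>test_funs U.
        (\<forall>f1\<in>compact_dists V. \<forall>f2\<in>compact_dists V. T (\<lambda>\<phi>. f1 \<phi> + f2 \<phi>) g = T f1 g + T f2 g) \<and>
        (\<forall>c. \<forall>f\<in>compact_dists V. T (\<lambda>\<phi>. c * f \<phi>) g = c * T f g) \<and>
        (\<forall>F f. compact_dists_tendsto V F f \<longrightarrow> (\<lambda>j. T (F j) g) \<longlonglongrightarrow> T f g))"


section \<open>Oscillatory integrals and Fourier integral operators\<close>

text \<open>Phases and amplitudes are functions of (x, theta).  The oscillatory integral
  of exp (i phi) a w over x and theta is regularized by arbitrary cutoffs in theta.\<close>

definition has_osc_integral ::
    "('x::euclidean_space \<times> 't::euclidean_space \<Rightarrow> real) \<Rightarrow> ('x \<times> 't \<Rightarrow> complex) \<Rightarrow> ('x \<Rightarrow> complex)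
      \<Rightarrow> complex \<Rightarrow> bool" where
  "has_osc_integral \<phi> a w I \<longleftrightarrow>
     (\<forall>\<rho>\<in>test_funs UNIV. \<rho> (0::'t) = 1 \<longrightarrow>
        (\<forall>\<epsilon>>0. integrable lborel
            (\<lambda>(x, \<theta>). \<rho> (\<epsilon> *\<^sub>R \<theta>) * exp (\<i> * complex_of_real (\<phi> (x, \<theta>))) * a (x, \<theta>) * w x)) \<and>
        ((\<lambda>\<epsilon>. LINT p|lborel. (case p of (x, \<theta>) \<Rightarrow>
             \<rho> (\<epsilon> *\<^sub>R \<theta>) * exp (\<i> * complex_of_real (\<phi> (x, \<theta>))) * a (x, \<theta>) * w x))
           \<longlongrightarrow> I) (at_right 0))"

definition osc_integral ::
    "('x::euclidean_space \<times> 't::euclidean_space \<Rightarrow> real) \<Rightarrow> ('x \<times> 't \<Rightarrow> complex) \<Rightarrow> ('x \<Rightarrow> complex)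
      \<Rightarrow> complex" where
  "osc_integral \<phi> a w = (THE I. has_osc_integral \<phi> a w I)"

text \<open>The operator f \<open>\<mapsto>\<close> (u \<open>\<mapsto>\<close> integral of exp (i phi(u,v,theta)) a(u,v,theta) f(v) over v and
  theta) on compactly supported distributions f, defined by duality: paired with a test function g,
  it is f applied to the function of v obtained by integrating over u and theta.\<close>

definition osc_operator ::
    "(('u::euclidean_space \<times> 'v::euclidean_space) \<times> 't::euclidean_space \<Rightarrow> real)
      \<Rightarrow> (('u \<times> 'v) \<times> 't \<Rightarrow> complex) \<Rightarrow> 'v functional \<Rightarrow> 'u functional" where
  "osc_operator \<phi> a f g =
     f (\<lambda>v. osc_integral (\<lambda>(u, \<theta>). \<phi> ((u, v), \<theta>)) (\<lambda>(u, \<theta>). a ((u, v), \<theta>)) g)"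

text \<open>Nondegenerate (operator) phase functions in the sense of Hoermander.\<close>

definition nondegenerate_phase ::
    "'u::euclidean_space set \<Rightarrow> 'v::euclidean_space set
      \<Rightarrow> (('u \<times> 'v) \<times> 't::euclidean_space \<Rightarrow> real) \<Rightarrow> bool" where
  "nondegenerate_phase U V \<phi> \<longleftrightarrow>
     smooth_on ((U \<times> V) \<times> (UNIV - {0})) \<phi> \<and>
     (\<forall>u\<in>U. \<forall>v\<in>V. \<forall>\<theta>. \<theta> \<noteq> 0 \<longrightarrow>
        (\<forall>s>0. \<phi> ((u, v), s *\<^sub>R \<theta>) = s * \<phi> ((u, v), \<theta>)) \<and>
        gradient (\<lambda>(u, \<theta>). \<phi> ((u, v), \<theta>)) (u, \<theta>) \<noteq> 0 \<and>
        gradient (\<lambda>(v, \<theta>). \<phi> ((u, v), \<theta>)) (v, \<theta>) \<noteq> 0 \<and>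
        (gradient (\<lambda>\<theta>. \<phi> ((u, v), \<theta>)) \<theta> = 0 \<longrightarrow>
           (\<forall>c. (\<Sum>b\<in>Basis. c b *\<^sub>R
                    gradient (\<lambda>p. frechet_derivative \<phi> (at p) (0, b)) ((u, v), \<theta>)) = 0
                \<longrightarrow> (\<forall>b\<in>Basis. c b = 0))))"

definition symbol_amplitude ::
    "real \<Rightarrow> 'u::euclidean_space set \<Rightarrow> 'v::euclidean_space set
      \<Rightarrow> (('u \<times> 'v) \<times> 't::euclidean_space \<Rightarrow> complex) \<Rightarrow> bool" where
  "symbol_amplitude m U V a \<longleftrightarrow>
     smooth_on ((U \<times> V) \<times> UNIV) a \<and>
     (\<forall>K xs ts. compact K \<and> K \<subseteq> U \<times> V \<and> set xs \<subseteq> Basis \<and> set ts \<subseteq> Basis \<longrightarrow>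
        (\<exists>C. \<forall>x\<in>K. \<forall>\<theta>.
           norm (iter_deriv (map (\<lambda>b. (b, 0)) xs @ map (\<lambda>b. (0, b)) ts) a (x, \<theta>))
             \<le> C * (1 + norm \<theta>) powr (m - real (length ts))))"

text \<open>Covectors are identified with vectors via the inner product, so the cotangent bundle of an
  open subset of a Euclidean space \<open>'u\<close> is contained in \<open>'u \<times> 'u\<close>.\<close>

definition canonical_relation ::
    "'u::euclidean_space set \<Rightarrow> 'v::euclidean_space set
      \<Rightarrow> (('u \<times> 'v) \<times> 't::euclidean_space \<Rightarrow> real) \<Rightarrow> (('u \<times> 'u) \<times> ('v \<times> 'v)) set" where
  "canonical_relation U V \<phi> =
     {((u, gradient (\<lambda>u. \<phi> ((u, v), \<theta>)) u), (v, - gradient (\<lambda>v. \<phi> ((u, v), \<theta>)) v)) |u v \<theta>.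
        u \<in> U \<and> v \<in> V \<and> \<theta> \<noteq> 0 \<and> gradient (\<lambda>\<theta>. \<phi> ((u, v), \<theta>)) \<theta> = 0}"

text \<open>The function k is the smooth error allowed in the kernel.  The sets need not be open, but V
  has to be contained in the closure of its interior, so that derivatives at its points make
  sense.\<close>

definition fourier_integral_operator ::
    "'u::euclidean_space set \<Rightarrow> 'v::euclidean_space set
      \<Rightarrow> (('u \<times> 'v) \<times> 't::euclidean_space \<Rightarrow> real) \<Rightarrow> ('v functional \<Rightarrow> 'u functional) \<Rightarrow> bool" where
  "fourier_integral_operator U V \<phi> T \<longleftrightarrow>
     open U \<and> V \<subseteq> closure (interior V) \<and>
     dist_operator U V T \<and>
     nondegenerate_phase U V \<phi> \<and>
     (\<exists>m a k. symbol_amplitude m U V a \<and> smooth_on (U \<times> V) k \<and>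
        (\<forall>g\<in>test_funs U. \<forall>h\<in>test_funs V.
           \<exists>I. has_osc_integral \<phi> a (\<lambda>(u, v). g u * h v) I \<and>
               T (dist_of_fun h) g = I + (LINT p|lborel. (case p of (u, v) \<Rightarrow> k (u, v) * g u * h v))))"


section \<open>Fold singularities\<close>

text \<open>Determinant of the matrix of a linear map between Euclidean spaces of equal dimension with
  respect to the standard bases.  It depends on the matching of the two bases only
  through its sign.\<close>

definition lin_det :: "('a::euclidean_space \<Rightarrow> 'b::euclidean_space) \<Rightarrow> real" where
  "lin_det L = (let \<beta> = (SOME \<beta>. bij_betw \<beta> (Basis :: 'a set) (Basis :: 'b set)) in
     \<Sum>p | p permutes Basis. of_int (sign p) * (\<Prod>i\<in>Basis. L i \<bullet> \<beta> (p i)))"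

definition jac_det :: "('a::euclidean_space \<Rightarrow> 'b::euclidean_space) \<Rightarrow> 'a \<Rightarrow> real" where
  "jac_det f p = lin_det (frechet_derivative f (at p))"

definition S1 :: "'a::euclidean_space set \<Rightarrow> ('a \<Rightarrow> 'b::euclidean_space) \<Rightarrow> 'a set" where
  "S1 W f = {p\<in>W. jac_det f p = 0 \<and> frechet_derivative (jac_det f) (at p) \<noteq> (\<lambda>_. 0)}"

text \<open>The tangent space of \<open>S1 W f\<close> at p is the kernel of the derivative of \<open>jac_det f\<close>.\<close>

definition fold_at :: "('a::euclidean_space \<Rightarrow> 'b::euclidean_space) \<Rightarrow> 'a \<Rightarrow> bool" where
  "fold_at f p \<longleftrightarrow>
     {x + y |x y. frechet_derivative f (at p) x = 0 \<and> frechet_derivative (jac_det f) (at p) y = 0}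
       = UNIV"

definition only_folds :: "'a::euclidean_space set \<Rightarrow> ('a \<Rightarrow> 'b::euclidean_space) \<Rightarrow> bool" where
  "only_folds W f \<longleftrightarrow>
     DIM('a) = DIM('b) \<and> smooth_on W f \<and>
     (\<forall>p\<in>W. jac_det f p = 0 \<longrightarrow> p \<in> S1 W f \<and> fold_at f p)"

text \<open>M is a smooth manifold with global parametrization \<open>\<kappa>\<close> on W.  As above,
  W need not be open.\<close>

definition global_parametrization ::
    "'p::euclidean_space set \<Rightarrow> ('p \<Rightarrow> 'e::euclidean_space) \<Rightarrow> 'e set \<Rightarrow> bool" where
  "global_parametrization W \<kappa> M \<longleftrightarrow>
     W \<subseteq> closure (interior W) \<and> smooth_on W \<kappa> \<and>
     (\<forall>p\<in>W. inj (frechet_derivative \<kappa> (at p))) \<and>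
     homeomorphism W M \<kappa> (inv_into W \<kappa>)"

text \<open>Fold singularities do not depend on the choice of coordinates on the relation C; they are
  expressed in the global coordinates provided by \<open>\<kappa>\<close>.\<close>

definition two_sided_fold ::
    "'p::euclidean_space set \<Rightarrow> ('p \<Rightarrow> ('u::euclidean_space \<times> 'u) \<times> ('v::euclidean_space \<times> 'v))
      \<Rightarrow> (('u \<times> 'u) \<times> ('v \<times> 'v)) set \<Rightarrow> bool" where
  "two_sided_fold W \<kappa> C \<longleftrightarrow>
     global_parametrization W \<kappa> C \<and> only_folds W (fst \<circ> \<kappa>) \<and> only_folds W (snd \<circ> \<kappa>)"


section \<open>The Radon transform\<close>

text \<open>With n - 1 = \<open>CARD('m)\<close>, points of n-space are vectors with index type \<open>'m option\<close>; the index
  \<open>None\<close> stands for the last coordinate.\<close>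

definition Omega :: "(real ^ 'm::finite) set" where
  "Omega = {y. norm y < 1}"

definition q :: "real ^ 'm::finite \<Rightarrow> real" where
  "q y = sqrt (1 - (\<Sum>i\<in>UNIV. (y $ i)\<^sup>2))"

definition sphere_pt :: "real ^ 'm::finite \<Rightarrow> real ^ 'm option" where
  "sphere_pt y = (\<chi> i. case i of None \<Rightarrow> q y | Some j \<Rightarrow> y $ j)"

definition top_half :: "(real ^ 'm::finite option) set" where
  "top_half = sphere_pt ` Omega"

definition quad :: "real ^ 'n ^ 'n::finite \<Rightarrow> real ^ 'n \<Rightarrow> real" where
  "quad A x = x \<bullet> (A *v x)"

definition psi ::
    "real ^ ('m option) ^ ('m::finite option)
      \<Rightarrow> (((real ^ 'm) \<times> real) \<times> (real ^ 'm option)) \<times> real \<Rightarrow> real" where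
  "psi A = (\<lambda>(((y, t), x), \<omega>). \<omega> * (t - quad A (x - sphere_pt y)))"

definition radon ::
    "real ^ ('m option) ^ ('m::finite option)
      \<Rightarrow> (real ^ 'm option) functional \<Rightarrow> ((real ^ 'm) \<times> real) functional" where
  "radon A = osc_operator (psi A)
     (\<lambda>((u, x), \<omega>). complex_of_real (norm (gradient (\<lambda>x. psi A ((u, x), \<omega>)) x)))"

definition Omega_times_pos :: "((real ^ 'm::finite) \<times> real) set" where
  "Omega_times_pos = Omega \<times> {0<..}"

definition Bmat :: "real ^ 'm::finite \<Rightarrow> real ^ ('m option) ^ 'm" where
  "Bmat y = (\<chi> i j. case j of None \<Rightarrow> gradient q y $ i | Some k \<Rightarrow> if i = k then 1 else 0)"

definition pi_L ::
    "real ^ ('m option) ^ ('m::finite option) \<Rightarrow> (real ^ 'm) \<times> (real ^ 'm option) \<times> real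
      \<Rightarrow> ((real ^ 'm) \<times> real) \<times> ((real ^ 'm) \<times> real)" where
  "pi_L A = (\<lambda>(y, x, \<omega>).
     ((y, quad A (x - sphere_pt y)), ((2 * \<omega>) *\<^sub>R (Bmat y *v (A *v (x - sphere_pt y))), \<omega>)))"

definition pi_R ::
    "real ^ ('m option) ^ ('m::finite option) \<Rightarrow> (real ^ 'm) \<times> (real ^ 'm option) \<times> real
      \<Rightarrow> (real ^ 'm option) \<times> (real ^ 'm option)" where
  "pi_R A = (\<lambda>(y, x, \<omega>). (x, (2 * \<omega>) *\<^sub>R (A *v (x - sphere_pt y))))"

definition param_domain ::
    "real ^ ('m option) ^ ('m::finite option) \<Rightarrow> ((real ^ 'm) \<times> (real ^ 'm option) \<times> real) set" where
  "param_domain A =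
     {(y, x, \<omega>). y \<in> Omega \<and> x \<notin> top_half \<and> \<omega> \<noteq> 0 \<and> quad A (x - sphere_pt y) > 0}"

end

theory Submission
  imports Defs "HOL-Probability.Sinc_Integral"
begin

text \<open>Write \<open>s(y)\<close> for \<open>sphere_pt y\<close>, \<open>Q\<close> for \<open>quad A\<close> and \<open>x\<^sub>T = x - s(y)\<close>.

  The operator.  The phase \<open>\<omega> (t - Q x\<^sub>T)\<close> is linear in the frequency and the amplitude is
  \<open>2 |\<omega>| |x\<^sub>T|\<close>, because \<open>A\<close> is orthogonal.  Paired with a test function \<open>g\<close>, the operator therefore
  evaluates the distribution at
  \<open>\<Phi> x = \<integral> 2 |\<omega>| g^(y, \<omega>) |x\<^sub>T| exp (- \<i> \<omega> Q x\<^sub>T) d(y, \<omega>)\<close>, where \<open>g^\<close> is the Fourier transform of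
  \<open>g\<close> in \<open>t\<close>.  Integration by parts shows that \<open>g^\<close> decays faster than every power of \<open>\<omega>\<close>
  (\<open>time_fourier_decay\<close>), so the integral converges, the cutoffs in the oscillatory integral drop out
  (\<open>has_osc_integral_linear_phase\<close>), and one may differentiate under the integral sign wherever
  \<open>|x\<^sub>T|\<close> is smooth (\<open>Ck_on_param_osc\<close>, \<open>param_osc_bound\<close>).  As \<open>y\<close> ranges over a compact part of the open ball,
  that is a neighbourhood of the whole complement of the open half sphere, the equator included.
  Estimates of \<open>\<Phi>\<close> by seminorms of \<open>g\<close> give continuity.  The function \<open>2 |\<omega>|\<close> is not smooth
  at \<open>0\<close>; it is the sum of a symbol \<open>high_abs\<close> and a function \<open>low_abs\<close> of compact support, and the
  second part contributes the smooth kernel allowed in the definition (\<open>pairing_split\<close>).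

  The folds.  Both Jacobian determinants are nonvanishing multiples of \<open>s(y) \<bullet> x\<^sub>T\<close>
  (\<open>tangency\<close>), which vanishes when \<open>x\<close> lies in the tangent plane at \<open>s(y)\<close>.  There the kernel of
  \<open>d\<pi>\<^sub>R\<close> contains a direction that moves \<open>s(y)\<close> along \<open>x\<^sub>T\<close> while rescaling \<open>\<omega>\<close>, and \<open>s(y) \<bullet> x\<^sub>T\<close> changes at the rate
  \<open>|x\<^sub>T|\<^sup>2 \<noteq> 0\<close>.  The kernel of \<open>d\<pi>\<^sub>L\<close> contains the direction that moves \<open>x\<close> along \<open>A s(y)\<close>, and the rate is
  \<open>Q s(y)\<close>.  This is nonzero because \<open>Q\<close> has signature \<open>(1, n-1)\<close>, \<open>Q x\<^sub>T > 0\<close>, and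
  \<open>A s(y)\<close> is orthogonal to \<open>x\<^sub>T\<close> for the form \<open>Q\<close> (\<open>quad_nonzero_of_orthogonal\<close>).  To read off the
  determinants without expanding them, the differentials are factored through the scaling of one
  coordinate by \<open>s(y) \<bullet> x\<^sub>T\<close> (\<open>fold_criterion\<close>).\<close>

section \<open>Calculus of \<open>C\<^sup>k\<close> functions\<close>

lemma Ck_on_cong:
  assumes "open S" "\<And>x. x \<in> S \<Longrightarrow> f x = g x"
  shows "Ck_on k S f \<longleftrightarrow> Ck_on k S g"
  using assms(2)
proof (induction k arbitrary: f g)
  case 0
  then show ?case by (simp cong: continuous_on_cong)
next
  case (Suc k)
  have diff: "f differentiable at x \<longleftrightarrow> g differentiable at x" if "x \<in> S" for x
    unfolding differentiable_def
    using has_derivative_transform_within_open[OF _ assms(1) that, of f _ UNIV g]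
      has_derivative_transform_within_open[OF _ assms(1) that, of g _ UNIV f] Suc.prems by metis
  have "Ck_on k S (\<lambda>x. frechet_derivative f (at x) v) \<longleftrightarrow>
      Ck_on k S (\<lambda>x. frechet_derivative g (at x) v)"
    if "\<forall>x\<in>S. f differentiable at x" for v
    by (rule Suc.IH) (use Suc.prems assms(1) that frechet_derivative_transform_within_open in metis)
  then show ?case using diff by auto
qed

lemma Ck_on_SucD: "Ck_on (Suc k) S f \<Longrightarrow> Ck_on k S f"
proof (induction k arbitrary: f)
  case 0
  then show ?case
    by (auto intro!: continuous_at_imp_continuous_on differentiable_imp_continuous_within)
next
  case (Suc k)
  then show ?case by simp
qed

lemma Ck_on_imp_continuous_on: "Ck_on k S f \<Longrightarrow> continuous_on S f"
  by (induction k) (simp, blast dest: Ck_on_SucD)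

text \<open>The definition of \<open>Ck_on\<close> speaks of \<open>frechet_derivative\<close>; in proofs by induction on the order it is
  enough to know some formula for the derivative.\<close>

lemma Ck_on_SucI:
  assumes "open S" "\<And>x. x \<in> S \<Longrightarrow> (f has_derivative f' x) (at x)"
    and "\<And>v. Ck_on k S (\<lambda>x. f' x v)"
  shows "Ck_on (Suc k) S f"
proof -
  have "frechet_derivative f (at x) = f' x" if "x \<in> S" for x
    using assms(2)[OF that] frechet_derivative_at by metis
  then have "Ck_on k S (\<lambda>x. frechet_derivative f (at x) v)" for v
    using Ck_on_cong[OF assms(1), of "\<lambda>x. frechet_derivative f (at x) v" "\<lambda>x. f' x v"] assms(3)
    by auto
  then show ?thesis
    using assms(2) by (auto intro: differentiableI)
qed

lemma Ck_on_has_derivative: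
  "Ck_on (Suc k) S f \<Longrightarrow> x \<in> S \<Longrightarrow> (f has_derivative frechet_derivative f (at x)) (at x)"
  by (simp add: frechet_derivative_works)

lemma Ck_on_subset: "Ck_on k S f \<Longrightarrow> T \<subseteq> S \<Longrightarrow> Ck_on k T f"
proof (induction k arbitrary: f)
  case 0
  then show ?case by (auto intro: continuous_on_subset)
qed auto

text \<open>Needed for functions that are smooth for different reasons on two pieces, such as a cutoff absolute
  value.\<close>

lemma Ck_on_Un:
  "open S \<Longrightarrow> open T \<Longrightarrow> Ck_on k S f \<Longrightarrow> Ck_on k T f \<Longrightarrow> Ck_on k (S \<union> T) f"
proof (induction k arbitrary: f)
  case 0
  then show ?case by (simp add: continuous_on_open_Un)
qed auto

lemma Ck_on_const [simp]: "Ck_on k S (\<lambda>x. c)"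
  by (induction k arbitrary: c) auto

lemma Ck_on_bounded_linear:
  assumes "open S" "Ck_on k S f" "bounded_linear L"
  shows "Ck_on k S (\<lambda>x. L (f x))"
  using assms(2)
proof (induction k arbitrary: f)
  case 0
  then show ?case
    using assms(3) by (auto intro: bounded_linear.continuous_on)
next
  case (Suc k)
  show ?case
  proof (rule Ck_on_SucI[OF assms(1)])
    show "((\<lambda>x. L (f x)) has_derivative (\<lambda>v. L (frechet_derivative f (at x) v))) (at x)"
      if "x \<in> S" for x
      by (rule bounded_linear.has_derivative[OF assms(3) Ck_on_has_derivative[OF Suc.prems that]])
  qed (use Suc in auto)
qed

lemma Ck_on_ident [simp]: "Ck_on k S (\<lambda>x. x)"
  by (cases k) auto

lemma Ck_on_linear: "open S \<Longrightarrow> bounded_linear L \<Longrightarrow> Ck_on k S L"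
  using Ck_on_bounded_linear[of S k "\<lambda>x. x" L] by simp

lemma Ck_on_add:
  assumes "open S" "Ck_on k S f" "Ck_on k S g"
  shows "Ck_on k S (\<lambda>x. f x + g x)"
  using assms(2,3)
proof (induction k arbitrary: f g)
  case 0
  then show ?case by (auto intro: continuous_on_add)
next
  case (Suc k)
  show ?case
  proof (rule Ck_on_SucI[OF assms(1)])
    show "((\<lambda>x. f x + g x) has_derivative
        (\<lambda>v. frechet_derivative f (at x) v + frechet_derivative g (at x) v)) (at x)"
      if "x \<in> S" for x
      by (rule has_derivative_add[OF Ck_on_has_derivative[OF Suc.prems(1) that]
            Ck_on_has_derivative[OF Suc.prems(2) that]])
  qed (use Suc in auto)
qed

lemma (in bounded_bilinear) Ck_on_prod:
  assumes "open S" "Ck_on k S f" "Ck_on k S g"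
  shows "Ck_on k S (\<lambda>x. prod (f x) (g x))"
  using assms(2,3)
proof (induction k arbitrary: f g)
  case 0
  then show ?case by (auto intro: continuous_on)
next
  case (Suc k)
  show ?case
  proof (rule Ck_on_SucI[OF assms(1)])
    show "((\<lambda>x. prod (f x) (g x)) has_derivative
        (\<lambda>v. prod (f x) (frechet_derivative g (at x) v) + prod (frechet_derivative f (at x) v) (g x)))
        (at x)" if "x \<in> S" for x
      by (rule FDERIV[OF Ck_on_has_derivative[OF Suc.prems(1) that]
            Ck_on_has_derivative[OF Suc.prems(2) that]])
  next
    show "Ck_on k S (\<lambda>x. prod (f x) (frechet_derivative g (at x) v) +
        prod (frechet_derivative f (at x) v) (g x))" for v
      by (intro Ck_on_add[OF assms(1)] Suc.IH Ck_on_SucD[OF Suc.prems(1)] Ck_on_SucD[OF Suc.prems(2)])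
        (use Suc.prems in auto)
  qed
qed

lemmas Ck_on_mult = bounded_bilinear.Ck_on_prod[OF bounded_bilinear_mult]
lemmas Ck_on_scaleR = bounded_bilinear.Ck_on_prod[OF bounded_bilinear_scaleR]
lemmas Ck_on_inner = bounded_bilinear.Ck_on_prod[OF bounded_bilinear_inner]
lemmas Ck_on_of_real = Ck_on_bounded_linear[OF _ _ bounded_linear_of_real]
lemma Ck_on_uminus: "open S \<Longrightarrow> Ck_on k S f \<Longrightarrow> Ck_on k S (\<lambda>x. - f x)"
  by (rule Ck_on_bounded_linear[OF _ _ bounded_linear_minus[OF bounded_linear_ident]])

lemma Ck_on_diff: "open S \<Longrightarrow> Ck_on k S f \<Longrightarrow> Ck_on k S g \<Longrightarrow> Ck_on k S (\<lambda>x. f x - g x)"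
  using Ck_on_add[of S k f "\<lambda>x. - g x"] Ck_on_uminus by fastforce

lemma Ck_on_sum:
  "open S \<Longrightarrow> (\<And>i. i \<in> I \<Longrightarrow> Ck_on k S (f i)) \<Longrightarrow> Ck_on k S (\<lambda>x. \<Sum>i\<in>I. f i x)"
  by (induction I rule: infinite_finite_induct) (auto intro: Ck_on_add)

lemma Ck_on_Pair:
  assumes "open S" "Ck_on k S f" "Ck_on k S g"
  shows "Ck_on k S (\<lambda>x. (f x, g x))"
proof -
  have "Ck_on k S (\<lambda>x. (f x, 0) + (0, g x))"
    using Ck_on_bounded_linear[OF assms(1,2) bounded_linear_Pair[OF bounded_linear_ident bounded_linear_zero]]
      Ck_on_bounded_linear[OF assms(1,3) bounded_linear_Pair[OF bounded_linear_zero bounded_linear_ident]]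
    by (rule Ck_on_add[OF assms(1)])
  then show ?thesis by simp
qed

lemma Ck_on_componentwise:
  fixes f :: "_ \<Rightarrow> 'b::euclidean_space"
  assumes "open S" "\<And>b. b \<in> Basis \<Longrightarrow> Ck_on k S (\<lambda>x. f x \<bullet> b)"
  shows "Ck_on k S f"
proof -
  have "Ck_on k S (\<lambda>x. \<Sum>b\<in>Basis. (f x \<bullet> b) *\<^sub>R b)"
    by (intro Ck_on_sum[OF assms(1)] Ck_on_scaleR[OF assms(1)] assms(2)) auto
  then show ?thesis by (simp add: euclidean_representation)
qed

lemma Ck_on_vec:
  fixes f :: "_ \<Rightarrow> real ^ 'n"
  assumes "open S" "\<And>i. Ck_on k S (\<lambda>x. f x $ i)"
  shows "Ck_on k S f"
  by (rule Ck_on_componentwise[OF assms(1)]) (use assms(2) in \<open>auto simp: Basis_vec_def inner_axis\<close>)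

lemma Ck_on_vec_nth: "open S \<Longrightarrow> Ck_on k S f \<Longrightarrow> Ck_on k S (\<lambda>x. f x $ i)"
  by (rule Ck_on_bounded_linear[OF _ _ bounded_linear_vec_nth])

text \<open>The chain rule expresses the derivative of \<open>g \<circ> f\<close> in the direction \<open>v\<close> through the
  partial derivatives of \<open>g\<close> at \<open>f x\<close>; this is why the middle space has a basis here.\<close>

lemma Ck_on_compose:
  fixes f :: "'a::real_normed_vector \<Rightarrow> 'b::euclidean_space" and g :: "'b \<Rightarrow> 'c::real_normed_vector"
  assumes "open S" "open T" "Ck_on k S f" "Ck_on k T g" "\<And>x. x \<in> S \<Longrightarrow> f x \<in> T"
  shows "Ck_on k S (\<lambda>x. g (f x))"
  using assms(3,4)
proof (induction k arbitrary: g)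
  case 0
  then show ?case
    using assms(5) by (auto intro: continuous_on_compose2)
next
  case (Suc k)
  let ?D = "\<lambda>x v. \<Sum>b\<in>Basis. (frechet_derivative f (at x) v \<bullet> b) *\<^sub>R frechet_derivative g (at (f x)) b"
  show ?case
  proof (rule Ck_on_SucI[OF assms(1)])
    fix x assume x: "x \<in> S"
    have lin: "linear (frechet_derivative g (at (f x)))"
      using Suc.prems(2) assms(5)[OF x] by (auto intro: linear_frechet_derivative)
    have "frechet_derivative g (at (f x)) w = (\<Sum>b\<in>Basis. (w \<bullet> b) *\<^sub>R frechet_derivative g (at (f x)) b)" for w
      by (subst (1) euclidean_representation[of w, symmetric])
        (simp add: linear_sum[OF lin] linear_scale[OF lin])
    then have "?D x v = frechet_derivative g (at (f x)) (frechet_derivative f (at x) v)" for v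
      by metis
    moreover have "((\<lambda>x. g (f x)) has_derivative
        (\<lambda>v. frechet_derivative g (at (f x)) (frechet_derivative f (at x) v))) (at x)"
      by (rule has_derivative_compose[OF Ck_on_has_derivative[OF Suc.prems(1) x]
            Ck_on_has_derivative[OF Suc.prems(2) assms(5)[OF x]]])
    ultimately show "((\<lambda>x. g (f x)) has_derivative ?D x) (at x)" by simp
  next
    fix v
    show "Ck_on k S (\<lambda>x. ?D x v)"
    proof (intro Ck_on_sum[OF assms(1)] Ck_on_scaleR[OF assms(1)] Ck_on_inner[OF assms(1)])
      show "Ck_on k S (\<lambda>x. frechet_derivative g (at (f x)) b)" for b
        by (rule Suc.IH[of "\<lambda>y. frechet_derivative g (at y) b"])
          (use Suc.prems(2) Ck_on_SucD[OF Suc.prems(1)] in auto)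
    qed (use Suc.prems(1) in auto)
  qed
qed

lemma Ck_on_inverse_real: "Ck_on k (- {0}) (inverse :: real \<Rightarrow> real)"
proof (induction k)
  case 0
  then show ?case by (auto intro: continuous_intros)
next
  case (Suc k)
  show ?case
  proof (rule Ck_on_SucI)
    show "((inverse :: real \<Rightarrow> real) has_derivative (\<lambda>h. - (inverse x * h * inverse x))) (at x)"
      if "x \<in> - {0}" for x
      using that by (auto intro!: has_derivative_inverse' simp: )
    show "Ck_on k (- {0}) (\<lambda>x::real. - (inverse x * v * inverse x))" for v
      by (intro Ck_on_uminus Ck_on_mult Suc.IH) auto
  qed auto
qed

lemma Ck_on_inverse:
  fixes f :: "_ \<Rightarrow> real"
  shows "open S \<Longrightarrow> Ck_on k S f \<Longrightarrow> (\<And>x. x \<in> S \<Longrightarrow> f x \<noteq> 0) \<Longrightarrow> Ck_on k S (\<lambda>x. inverse (f x))"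
  by (rule Ck_on_compose[of S "- {0}"]) (auto intro: Ck_on_inverse_real)

lemma Ck_on_divide:
  fixes f :: "_ \<Rightarrow> real"
  shows "open S \<Longrightarrow> Ck_on k S f \<Longrightarrow> Ck_on k S g \<Longrightarrow> (\<And>x. x \<in> S \<Longrightarrow> g x \<noteq> 0) \<Longrightarrow>
    Ck_on k S (\<lambda>x. f x / g x)"
  unfolding divide_inverse by (intro Ck_on_mult Ck_on_inverse) auto

lemma Ck_on_sqrt_real: "Ck_on k {0<..} sqrt"
proof (induction k)
  case 0
  then show ?case by (auto intro: continuous_intros)
next
  case (Suc k)
  show ?case
  proof (rule Ck_on_SucI)
    show "(sqrt has_derivative (\<lambda>h. (inverse (sqrt x) / 2) * h)) (at x)" if "x \<in> {0<..}" for x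
      using DERIV_real_sqrt[of x] that unfolding has_field_derivative_def by (simp del: times_divide_eq_left)
    show "Ck_on k {0<..} (\<lambda>x. (inverse (sqrt x) / 2) * v)" for v
      by (intro Ck_on_mult Ck_on_divide Ck_on_inverse Suc.IH) auto
  qed auto
qed

lemma Ck_on_sqrt:
  "open S \<Longrightarrow> Ck_on k S f \<Longrightarrow> (\<And>x. x \<in> S \<Longrightarrow> f x > 0) \<Longrightarrow> Ck_on k S (\<lambda>x. sqrt (f x))"
  by (rule Ck_on_compose[of S "{0<..}"]) (auto intro: Ck_on_sqrt_real)

lemma Ck_on_norm:
  fixes f :: "_ \<Rightarrow> 'b::real_inner"
  shows "open S \<Longrightarrow> Ck_on k S f \<Longrightarrow> (\<And>x. x \<in> S \<Longrightarrow> f x \<noteq> 0) \<Longrightarrow> Ck_on k S (\<lambda>x. norm (f x))"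
  unfolding norm_eq_sqrt_inner by (intro Ck_on_sqrt Ck_on_inner) auto

section \<open>Iterated derivatives\<close>

lemma Ck_on_iter_deriv: "Ck_on (length vs + k) S f \<Longrightarrow> Ck_on k S (iter_deriv vs f)"
proof (induction vs arbitrary: k)
  case (Cons v vs)
  have "length (v # vs) + k = length vs + Suc k" by simp
  with Cons have "Ck_on (Suc k) S (iter_deriv vs f)" by metis
  then show ?case by simp
qed simp

lemma iter_deriv_cong:
  assumes "open S" "\<And>x. x \<in> S \<Longrightarrow> f x = g x" "\<And>k. Ck_on k S f" "x \<in> S"
  shows "iter_deriv vs f x = iter_deriv vs g x"
  using assms(4)
proof (induction vs arbitrary: x)
  case (Cons v vs)
  have "Ck_on 1 S (iter_deriv vs f)"
    by (rule Ck_on_iter_deriv[OF assms(3)])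
  then have "iter_deriv vs f differentiable at x"
    using Cons.prems by simp
  then show ?case
    using frechet_derivative_transform_within_open[OF _ assms(1) Cons.prems Cons.IH] by simp
qed (use assms in auto)

lemma iter_deriv_append: "iter_deriv (vs @ ws) f = iter_deriv vs (iter_deriv ws f)"
  by (induction vs) auto

lemma iter_deriv_add:
  assumes "open S" "\<And>k. Ck_on k S f" "\<And>k. Ck_on k S g" "x \<in> S"
  shows "iter_deriv vs (\<lambda>x. f x + g x) x = iter_deriv vs f x + iter_deriv vs g x"
  using assms(4)
proof (induction vs arbitrary: x)
  case (Cons v vs)
  have D: "(iter_deriv vs h has_derivative frechet_derivative (iter_deriv vs h) (at x)) (at x)"
    if "\<And>k. Ck_on k S h" for h
    using Ck_on_has_derivative[OF Ck_on_iter_deriv[OF that] Cons.prems] by blast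
  have "((\<lambda>x. iter_deriv vs f x + iter_deriv vs g x) has_derivative
      (\<lambda>v. iter_deriv (v # vs) f x + iter_deriv (v # vs) g x)) (at x)"
    using has_derivative_add[OF D[OF assms(2)] D[OF assms(3)]] by simp
  then have "(iter_deriv vs (\<lambda>x. f x + g x) has_derivative
      (\<lambda>v. iter_deriv (v # vs) f x + iter_deriv (v # vs) g x)) (at x)"
    by (rule has_derivative_transform_within_open[OF _ assms(1) Cons.prems]) (simp add: Cons.IH)
  then show ?case
    using frechet_derivative_at by (metis (no_types, lifting) iter_deriv.simps(2))
qed simp

lemma iter_deriv_eq_0:
  assumes "closed K" "\<And>x. x \<notin> K \<Longrightarrow> f x = 0" "x \<notin> K"
  shows "iter_deriv vs f x = 0"
proof -
  have "iter_deriv vs (\<lambda>x. 0::'b) = (\<lambda>x. 0)"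
    by (induction vs) auto
  moreover have "iter_deriv vs (\<lambda>x. 0::'b) x = iter_deriv vs f x"
    by (rule iter_deriv_cong[of "- K"]) (use assms in auto)
  ultimately show ?thesis by simp
qed

lemma smooth_on_mono: "smooth_on S f \<Longrightarrow> T \<subseteq> S \<Longrightarrow> smooth_on T f"
  unfolding smooth_on_def by blast

lemma smooth_on_open: "open S \<Longrightarrow> smooth_on S f \<longleftrightarrow> (\<forall>k. Ck_on k S f)"
  unfolding smooth_on_def by (metis Ck_on_subset order_refl)

text \<open>Without this bound the supremum in the seminorm would carry no information.  There are finitely
  many lists of basis vectors of bounded length, and each derivative is continuous on \<open>K\<close>.\<close>

lemma bdd_above_Ck_seminorm:
  assumes "compact K" "smooth_on K \<phi>"
  shows "bdd_above (insert 0 {norm (iter_deriv vs \<phi> x) |vs x. x \<in> K \<and> set vs \<subseteq> Basis \<and> length vs \<le> N})"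
proof -
  let ?V = "{vs::'a list. set vs \<subseteq> Basis \<and> length vs \<le> N}"
  have "bdd_above ((\<lambda>x. norm (iter_deriv vs \<phi> x)) ` K)" for vs
  proof -
    obtain W where "open W" "K \<subseteq> W" and W: "\<And>k. Ck_on k W \<phi>"
      using assms(2) by (auto simp: smooth_on_def)
    have "continuous_on W (iter_deriv vs \<phi>)"
      by (rule Ck_on_imp_continuous_on[OF Ck_on_iter_deriv[OF W]])
    then have "continuous_on K (\<lambda>x. norm (iter_deriv vs \<phi> x))"
      using \<open>K \<subseteq> W\<close> by (intro continuous_on_norm) (rule continuous_on_subset)
    then show ?thesis
      using assms(1) by (intro bounded_imp_bdd_above compact_imp_bounded compact_continuous_image)
  qed
  moreover have "finite ?V"
    by (rule finite_lists_length_le) simp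
  ultimately have "bdd_above (\<Union>vs\<in>?V. (\<lambda>x. norm (iter_deriv vs \<phi> x)) ` K)"
    by simp
  moreover have "{norm (iter_deriv vs \<phi> x) |vs x. x \<in> K \<and> set vs \<subseteq> Basis \<and> length vs \<le> N} =
      (\<Union>vs\<in>?V. (\<lambda>x. norm (iter_deriv vs \<phi> x)) ` K)"
    by (simp only: set_eq_iff UN_iff image_iff mem_Collect_eq) blast
  ultimately show ?thesis by simp
qed

lemma iter_deriv_le_Ck_seminorm:
  assumes "compact K" "smooth_on K \<phi>" "x \<in> K" "set vs \<subseteq> Basis" "length vs \<le> N"
  shows "norm (iter_deriv vs \<phi> x) \<le> Ck_seminorm N K \<phi>"
proof -
  have "norm (iter_deriv vs \<phi> x) \<in>
      insert 0 {norm (iter_deriv vs \<phi> x) |vs x. x \<in> K \<and> set vs \<subseteq> Basis \<and> length vs \<le> N}"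
    using assms(3-5) by blast
  then show ?thesis
    unfolding Ck_seminorm_def by (rule cSup_upper[OF _ bdd_above_Ck_seminorm[OF assms(1,2)]])
qed

lemma Ck_seminorm_nonneg:
  assumes "compact K" "smooth_on K \<phi>"
  shows "0 \<le> Ck_seminorm N K \<phi>"
  unfolding Ck_seminorm_def
  by (rule cSup_upper[OF insertI1 bdd_above_Ck_seminorm[OF assms]])

lemma Ck_seminorm_least:
  assumes "0 \<le> C"
    and "\<And>vs x. x \<in> K \<Longrightarrow> set vs \<subseteq> Basis \<Longrightarrow> length vs \<le> N \<Longrightarrow> norm (iter_deriv vs \<phi> x) \<le> C"
  shows "Ck_seminorm N K \<phi> \<le> C"
  unfolding Ck_seminorm_def by (rule cSup_least) (use assms in auto)


section \<open>Cutoffs and homogeneous symbols\<close>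

text \<open>The powers of \<open>1 / x\<close> make the family closed under differentiation, so that smoothness of all its
  members can be proved by a single induction.\<close>

definition flat :: "nat \<Rightarrow> real \<Rightarrow> real" where
  "flat n x = (if x > 0 then exp (- inverse x) * inverse x ^ n else 0)"

lemma power_le_fact_exp: "0 \<le> t \<Longrightarrow> t ^ m \<le> fact m * exp (t::real)"
proof -
  assume t: "0 \<le> t"
  have "(\<Sum>i\<in>{m}. t ^ i /\<^sub>R fact i) \<le> exp t"
    unfolding exp_def by (rule sum_le_suminf[OF summable_exp_generic]) (use t in auto)
  then show ?thesis by (simp add: field_simps)
qed

text \<open>The quadratic bound makes \<open>flat n\<close> differentiable at \<open>0\<close> with derivative \<open>0\<close>.\<close>

lemma flat_le: "\<bar>flat n x\<bar> \<le> fact (n + 2) * x\<^sup>2"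
proof (cases "x > 0")
  case True
  have "inverse x ^ (n + 2) \<le> fact (n + 2) * exp (inverse x)"
    by (rule power_le_fact_exp) (use True in simp)
  then have "inverse x ^ n \<le> fact (n + 2) * exp (inverse x) * x\<^sup>2"
    using True by (simp add: power_add power2_eq_square field_simps)
  then show ?thesis
    using True by (simp add: flat_def exp_minus field_simps)
qed (simp add: flat_def)

lemma DERIV_flat:
  "(flat n has_real_derivative (flat (n + 2) x - real n * flat (n + 1) x)) (at x)"
proof -
  consider "x > 0" | "x < 0" | "x = 0" by linarith
  then show ?thesis
  proof cases
    case 1
    have *: "real n * inverse x ^ (n - 1) * inverse x = real n * inverse x ^ n"
      by (cases n) auto
    have "((\<lambda>x. exp (- inverse x) * inverse x ^ n) has_real_derivative
        (exp (- inverse x) * inverse x ^ (n + 2) - exp (- inverse x) * (real n * inverse x ^ (n - 1) * inverse x) * inverse x)) (at x)"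
      using 1 by (auto intro!: derivative_eq_intros simp: power2_eq_square algebra_simps)
    then have "((\<lambda>x. exp (- inverse x) * inverse x ^ n) has_real_derivative
        (flat (n + 2) x - real n * flat (n + 1) x)) (at x)"
      unfolding * using 1 by (simp add: flat_def algebra_simps)
    then show ?thesis
      by (rule has_field_derivative_transform_within_open[of _ _ _ "{0<..}"])
        (use 1 in \<open>auto simp: flat_def\<close>)
  next
    case 2
    have "((\<lambda>x. 0) has_real_derivative 0) (at x)" by simp
    then show ?thesis
      by (rule has_field_derivative_transform_within_open[of _ _ _ "{..<0}", THEN DERIV_cong])
        (use 2 in \<open>auto simp: flat_def\<close>)
  next
    case 3
    have "(\<lambda>h. (flat n (0 + h) - flat n 0) / h) \<midarrow>0\<rightarrow> 0"
    proof (rule Lim_null_comparison)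
      show "eventually (\<lambda>h. norm ((flat n (0 + h) - flat n 0) / h) \<le> fact (n + 2) * \<bar>h\<bar>) (at 0)"
      proof (rule eventually_at_filter[THEN iffD2, OF always_eventually], safe)
        fix h :: real assume "h \<noteq> 0"
        have "\<bar>flat n h\<bar> \<le> (fact (n + 2) * \<bar>h\<bar>) * \<bar>h\<bar>"
          using flat_le[of n h] by (simp add: power2_eq_square mult.assoc)
        then have "\<bar>flat n h\<bar> / \<bar>h\<bar> \<le> fact (n + 2) * \<bar>h\<bar>"
          using \<open>h \<noteq> 0\<close> by (simp add: pos_divide_le_eq)
        then show "norm ((flat n (0 + h) - flat n 0) / h) \<le> fact (n + 2) * \<bar>h\<bar>"
          by (simp add: flat_def[of n 0])
      qed
      show "(\<lambda>h::real. fact (n + 2) * \<bar>h\<bar>) \<midarrow>0\<rightarrow> 0"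
        by (auto intro!: tendsto_eq_intros)
    qed
    then show ?thesis
      using 3 by (simp add: DERIV_def flat_def)
  qed
qed

lemma Ck_on_flat: "Ck_on k UNIV (flat n)"
proof (induction k arbitrary: n)
  case 0
  show ?case
    using DERIV_flat by (auto intro!: continuous_at_imp_continuous_on DERIV_isCont)
next
  case (Suc k)
  show ?case
  proof (rule Ck_on_SucI)
    show "(flat n has_derivative (\<lambda>h. (flat (n + 2) x - real n * flat (n + 1) x) * h)) (at x)" for x
      using DERIV_flat[of n x] by (simp add: has_field_derivative_def)
    show "Ck_on k UNIV (\<lambda>x. (flat (n + 2) x - real n * flat (n + 1) x) * v)" for v
      by (intro Ck_on_mult Ck_on_diff Suc.IH Ck_on_const open_UNIV)
  qed simp
qed

text \<open>The usual smooth step.  The denominator is positive since \<open>2 - w\<^sup>2\<close> and \<open>w\<^sup>2 - 1\<close> are never both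
  nonpositive.\<close>

definition cutoff :: "real \<Rightarrow> real" where
  "cutoff w = flat 0 (2 - w\<^sup>2) / (flat 0 (2 - w\<^sup>2) + flat 0 (w\<^sup>2 - 1))"

lemma flat_nonneg: "0 \<le> flat n x"
  by (simp add: flat_def)

lemma flat_pos: "0 < x \<Longrightarrow> 0 < flat n x"
  by (simp add: flat_def)

lemma cutoff_denominator: "flat 0 (2 - w\<^sup>2) + flat 0 (w\<^sup>2 - 1) > 0"
proof (cases "w\<^sup>2 < 2")
  case True
  then show ?thesis using flat_pos[of "2 - w\<^sup>2"] flat_nonneg by (simp add: add_pos_nonneg)
next
  case False
  then show ?thesis using flat_pos[of "w\<^sup>2 - 1"] flat_nonneg by (simp add: add_nonneg_pos)
qed

lemma Ck_on_cutoff: "Ck_on k UNIV cutoff"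
proof -
  have "Ck_on k UNIV (\<lambda>w. flat 0 (2 - w\<^sup>2))" "Ck_on k UNIV (\<lambda>w. flat 0 (w\<^sup>2 - 1))"
    unfolding power2_eq_square
    by (rule Ck_on_compose[of UNIV UNIV k _ "flat 0"];
        (intro Ck_on_diff Ck_on_mult Ck_on_const Ck_on_ident Ck_on_flat open_UNIV UNIV_I))+
  then show ?thesis
    unfolding cutoff_def[abs_def] using cutoff_denominator
    by (intro Ck_on_divide Ck_on_add) (auto simp: less_imp_neq[symmetric])
qed

lemma cutoff_eq_1: "\<bar>w\<bar> \<le> 1 \<Longrightarrow> cutoff w = 1"
  using cutoff_denominator[of w] abs_square_le_1[of w] by (auto simp: cutoff_def flat_def)

lemma cutoff_eq_0: "2 \<le> \<bar>w\<bar> \<Longrightarrow> cutoff w = 0"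
proof -
  assume "2 \<le> \<bar>w\<bar>"
  then have "2 * 2 \<le> \<bar>w\<bar> * \<bar>w\<bar>" by (intro mult_mono) auto
  then show ?thesis by (simp add: cutoff_def flat_def power2_eq_square)
qed

lemma cutoff_nonneg: "0 \<le> cutoff w" and cutoff_le_1: "cutoff w \<le> 1"
  using cutoff_denominator[of w] flat_nonneg[of 0] by (auto simp: cutoff_def divide_simps)

text \<open>Besides cutting off low frequencies, this function shows that regularizing cutoffs exist, which
  makes the value of an oscillatory integral unique.\<close>

lemma cutoff_in_test_funs: "(\<lambda>w. complex_of_real (cutoff w)) \<in> test_funs UNIV"
  unfolding test_funs_def
proof (safe intro!: exI[of _ "{-2..2}"])
  show "smooth_on UNIV (\<lambda>w. complex_of_real (cutoff w))"
    using Ck_on_of_real[OF open_UNIV Ck_on_cutoff] by (auto simp: smooth_on_open)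
qed (auto simp: cutoff_eq_0 not_le)

definition high_abs :: "real \<Rightarrow> complex" where
  "high_abs w = of_real ((1 - cutoff w) * (2 * \<bar>w\<bar>))"

lemma Ck_on_high_abs: "Ck_on k UNIV high_abs"
proof -
  have "Ck_on k (- {0}) high_abs"
    unfolding high_abs_def[abs_def] real_norm_def[symmetric]
    by (intro Ck_on_of_real Ck_on_mult Ck_on_diff Ck_on_norm Ck_on_const Ck_on_ident
        Ck_on_subset[OF Ck_on_cutoff]) auto
  moreover have "Ck_on k {-1<..<1} high_abs"
    by (subst Ck_on_cong[of _ _ "\<lambda>_. 0"]) (auto simp: high_abs_def cutoff_eq_1)
  ultimately have "Ck_on k (- {0} \<union> {-1<..<1}) high_abs"
    by (intro Ck_on_Un) auto
  moreover have "- {0} \<union> {-1<..<1} = (UNIV :: real set)" by auto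
  ultimately show ?thesis by simp
qed

lemma iter_deriv_linear_real:
  "iter_deriv (replicate j 1) (\<lambda>x::real. of_real (a * x) :: complex) =
    (if j = 0 then (\<lambda>x. of_real (a * x)) else if j = 1 then (\<lambda>x. of_real a) else (\<lambda>x. 0))"
proof -
  have 1: "frechet_derivative (\<lambda>x::real. of_real (a * x) :: complex) (at x) 1 = of_real a" for x
  proof -
    have "((\<lambda>x::real. of_real (a * x) :: complex) has_derivative (\<lambda>h. of_real (a * h))) (at x)"
      by (intro bounded_linear.has_derivative[OF bounded_linear_of_real]
          bounded_linear.has_derivative[OF bounded_linear_mult_right] has_derivative_ident)
    from frechet_derivative_at[OF this, symmetric] show ?thesis by simp
  qed
  show ?thesis
    by (induction j) (auto simp: 1 simp del: of_real_mult)
qed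

text \<open>Beyond the cutoff the symbol is linear on each half line, so it is of order one: its
  second and higher derivatives have compact support.\<close>

lemma high_abs_symbol:
  "\<exists>C. \<forall>w. norm (iter_deriv (replicate j 1) high_abs w) \<le> C * (1 + \<bar>w\<bar>) powr (1 - real j)"
proof -
  let ?D = "iter_deriv (replicate j 1)"
  have pos: "0 < (1 + \<bar>w\<bar>) powr (1 - real j)" for w by simp
  have "continuous_on UNIV (?D high_abs)"
    by (rule Ck_on_imp_continuous_on[OF Ck_on_iter_deriv[OF Ck_on_high_abs]])
  then have "continuous_on {-3..3} (\<lambda>w. norm (?D high_abs w) / (1 + \<bar>w\<bar>) powr (1 - real j))"
    by (auto intro!: continuous_intros intro: continuous_on_subset)
  then have "bounded ((\<lambda>w. norm (?D high_abs w) / (1 + \<bar>w\<bar>) powr (1 - real j)) ` {-3..3})"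
    by (intro compact_imp_bounded compact_continuous_image) auto
  then obtain B where "\<forall>x\<in>(\<lambda>w. norm (?D high_abs w) / (1 + \<bar>w\<bar>) powr (1 - real j)) ` {-3..3}.
      norm x \<le> B"
    unfolding bounded_iff by blast
  then have B: "norm (norm (?D high_abs w) / (1 + \<bar>w\<bar>) powr (1 - real j)) \<le> B"
    if "w \<in> {-3..3}" for w
    using that by blast
  have near: "norm (?D high_abs w) \<le> B * (1 + \<bar>w\<bar>) powr (1 - real j)" if "\<bar>w\<bar> \<le> 3" for w
    using B[of w] that pos[of w] by (simp add: pos_divide_le_eq abs_le_iff)
  have far: "norm (?D high_abs w) \<le> 2 * (1 + \<bar>w\<bar>) powr (1 - real j)" if w: "3 < \<bar>w\<bar>" for w
  proof -
    have "?D high_abs w = ?D (\<lambda>x. of_real (2 * sgn w * x)) w"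
    proof (rule iter_deriv_cong[of "{x. 2 < sgn w * x}"])
      show "open {x. 2 < sgn w * x}" by (intro open_Collect_less continuous_intros)
      show "high_abs x = of_real (2 * sgn w * x)" if "x \<in> {x. 2 < sgn w * x}" for x
        using that w by (auto simp: high_abs_def cutoff_eq_0 sgn_if split: if_splits)
      show "Ck_on k {x. 2 < sgn w * x} high_abs" for k
        by (rule Ck_on_subset[OF Ck_on_high_abs]) auto
    qed (use w in \<open>auto simp: sgn_if split: if_splits\<close>)
    then have "norm (?D high_abs w) = (if j = 0 then 2 * \<bar>w\<bar> else if j = 1 then 2 else 0)"
      unfolding iter_deriv_linear_real using w by (auto simp: norm_mult sgn_if)
    then show ?thesis
      using w by (auto simp: )
  qed
  have "norm (?D high_abs w) \<le> max B 2 * (1 + \<bar>w\<bar>) powr (1 - real j)" for w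
  proof (cases "\<bar>w\<bar> \<le> 3")
    case True
    show ?thesis
      by (rule order_trans[OF near[OF True]]) (intro mult_right_mono; simp)
  next
    case False
    then show ?thesis
      by (intro order_trans[OF far]) (auto intro!: mult_right_mono)
  qed
  then show ?thesis by blast
qed

lemma frechet_derivative_tensor:
  fixes r :: "'a::euclidean_space \<Rightarrow> complex" and c :: "'b::euclidean_space \<Rightarrow> complex"
  assumes "r differentiable at x" "c differentiable at \<theta>"
  shows "((\<lambda>(x, \<theta>). r x * c \<theta>) has_derivative
    (\<lambda>(v, w). r x * frechet_derivative c (at \<theta>) w + frechet_derivative r (at x) v * c \<theta>)) (at (x, \<theta>))"
proof -
  have "((\<lambda>p. r (fst p)) has_derivative (\<lambda>p. frechet_derivative r (at x) (fst p))) (at (x, \<theta>))"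
    by (rule has_derivative_compose[of fst fst "(x, \<theta>)" UNIV r])
      (use assms frechet_derivative_works in \<open>auto intro: bounded_linear_imp_has_derivative bounded_linear_fst\<close>)
  moreover have "((\<lambda>p. c (snd p)) has_derivative (\<lambda>p. frechet_derivative c (at \<theta>) (snd p))) (at (x, \<theta>))"
    by (rule has_derivative_compose[of snd snd "(x, \<theta>)" UNIV c])
      (use assms frechet_derivative_works in \<open>auto intro: bounded_linear_imp_has_derivative bounded_linear_snd\<close>)
  ultimately show ?thesis
    using has_derivative_mult by (fastforce simp: case_prod_unfold)
qed

text \<open>For a product of a function of position and a function of frequency the symbol estimates reduce
  to those of the second factor.\<close>

lemma iter_deriv_tensor:
  fixes r :: "'a::euclidean_space \<Rightarrow> complex" and c :: "'b::euclidean_space \<Rightarrow> complex"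
  assumes S: "open S" and r: "\<And>k. Ck_on k S r" and c: "\<And>k. Ck_on k UNIV c" and x: "x \<in> S"
  shows "iter_deriv (map (\<lambda>b. (b, 0)) xs @ map (\<lambda>b. (0, b)) ts) (\<lambda>(x, \<theta>). r x * c \<theta>) (x, \<theta>) =
    iter_deriv xs r x * iter_deriv ts c \<theta>"
proof -
  have step: "frechet_derivative F (at (x, \<theta>)) (v, w) =
      iter_deriv xs r x * frechet_derivative (iter_deriv ts c) (at \<theta>) w
        + frechet_derivative (iter_deriv xs r) (at x) v * iter_deriv ts c \<theta>"
    if F: "\<And>x \<theta>. x \<in> S \<Longrightarrow> F (x, \<theta>) = iter_deriv xs r x * iter_deriv ts c \<theta>" and x: "x \<in> S"
    for F x \<theta> v w xs ts
  proof -
    have "Ck_on (Suc 0) S (iter_deriv xs r)" "Ck_on (Suc 0) UNIV (iter_deriv ts c)"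
      by (rule Ck_on_iter_deriv[OF r] Ck_on_iter_deriv[OF c])+
    then have "((\<lambda>(x, \<theta>). iter_deriv xs r x * iter_deriv ts c \<theta>) has_derivative
        (\<lambda>(v, w). iter_deriv xs r x * frechet_derivative (iter_deriv ts c) (at \<theta>) w
          + frechet_derivative (iter_deriv xs r) (at x) v * iter_deriv ts c \<theta>)) (at (x, \<theta>))"
      using x by (intro frechet_derivative_tensor) auto
    then have "(F has_derivative
        (\<lambda>(v, w). iter_deriv xs r x * frechet_derivative (iter_deriv ts c) (at \<theta>) w
          + frechet_derivative (iter_deriv xs r) (at x) v * iter_deriv ts c \<theta>)) (at (x, \<theta>))"
      by (rule has_derivative_transform_within_open[of _ _ _ _ "S \<times> UNIV"])
        (use S x F in \<open>auto intro: open_Times\<close>)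
    from frechet_derivative_at[OF this, symmetric] show ?thesis by simp
  qed
  have lin: "frechet_derivative (iter_deriv xs r) (at x) 0 = 0"
    "frechet_derivative (iter_deriv ts c) (at \<theta>) 0 = 0" if "x \<in> S" for x \<theta> xs ts
  proof -
    have "Ck_on (Suc 0) S (iter_deriv xs r)" "Ck_on (Suc 0) UNIV (iter_deriv ts c)"
      by (rule Ck_on_iter_deriv[OF r] Ck_on_iter_deriv[OF c])+
    then show "frechet_derivative (iter_deriv xs r) (at x) 0 = 0"
      "frechet_derivative (iter_deriv ts c) (at \<theta>) 0 = 0"
      using that by (auto intro!: linear_0 linear_frechet_derivative)
  qed
  have ts: "iter_deriv (map (\<lambda>b. (0, b)) ts) (\<lambda>(x, \<theta>). r x * c \<theta>) (x, \<theta>) =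
    iter_deriv [] r x * iter_deriv ts c \<theta>" if "x \<in> S" for x \<theta>
    using that
  proof (induction ts arbitrary: x \<theta>)
    case (Cons b ts)
    show ?case
      using step[OF Cons.IH Cons.prems] lin(1)[OF Cons.prems, of "[]"] by simp
  qed simp
  show ?thesis
    using x
  proof (induction xs arbitrary: x \<theta>)
    case Nil
    then show ?case using ts by simp
  next
    case (Cons b xs)
    show ?case
      using step[OF Cons.IH Cons.prems] lin(2)[OF Cons.prems] by simp
  qed
qed


section \<open>Differentiation of parameter integrals\<close>

text \<open>Dominated convergence along sequences: the mean value inequality bounds the difference quotients
  by the integrable majorant \<open>B\<close> of the derivative.\<close>

lemma has_derivative_integral:
  fixes F :: "'x::euclidean_space \<Rightarrow> 'p \<Rightarrow> 'b::{banach, second_countable_topology}"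
  assumes W: "open W" "x0 \<in> W"
    and int: "\<And>x. x \<in> W \<Longrightarrow> integrable M (F x)"
    and der: "\<And>x p. x \<in> W \<Longrightarrow> ((\<lambda>x. F x p) has_derivative F' x p) (at x)"
    and bound: "\<And>x p v. x \<in> W \<Longrightarrow> norm (F' x p v) \<le> B p * norm v"
    and B: "integrable M B"
    and meas: "\<And>v. (\<lambda>p. F' x0 p v) \<in> borel_measurable M"
  shows "((\<lambda>x. \<integral>p. F x p \<partial>M) has_derivative (\<lambda>v. \<integral>p. F' x0 p v \<partial>M)) (at x0)"
proof -
  let ?D = "\<lambda>v. \<integral>p. F' x0 p v \<partial>M"
  have lin: "linear (F' x0 p)" for p
    using der[OF W(2)] has_derivative_linear by blast
  have intF': "integrable M (\<lambda>p. F' x0 p v)" for v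
    by (rule Bochner_Integration.integrable_bound[OF integrable_mult_left[OF B, of "norm v"] meas])
      (use order_trans[OF bound[OF W(2)] abs_ge_self] in auto)
  have "bounded_linear ?D"
  proof (rule bounded_linear_intro)
    show "?D (v + w) = ?D v + ?D w" for v w
      by (simp add: linear_add[OF lin] intF')
    show "?D (c *\<^sub>R v) = c *\<^sub>R ?D v" for c v
      by (simp add: linear_scale[OF lin] intF')
    show "norm (?D v) \<le> norm v * (\<integral>p. B p \<partial>M)" for v
    proof -
      have "norm (?D v) \<le> (\<integral>p. B p * norm v \<partial>M)"
        by (rule order_trans[OF integral_norm_bound integral_mono])
          (use intF' B bound[OF W(2)] in auto)
      then show ?thesis by (simp add: mult.commute)
    qed
  qed
  moreover have "(\<lambda>h. norm ((\<integral>p. F (x0 + h) p \<partial>M) - (\<integral>p. F x0 p \<partial>M) - ?D h) / norm h) \<midarrow>0\<rightarrow> 0"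
    unfolding tendsto_at_iff_sequentially comp_def
  proof (intro allI impI)
    fix X :: "nat \<Rightarrow> 'x" assume X: "\<forall>i. X i \<in> UNIV - {0}" "X \<longlonglongrightarrow> 0"
    obtain d where d: "d > 0" "ball x0 d \<subseteq> W"
      using W openE by blast
    have "eventually (\<lambda>i. dist (X i) 0 < d) sequentially"
      using X(2) d(1) by (rule tendstoD)
    then obtain N where N: "\<And>i. i \<ge> N \<Longrightarrow> norm (X i) < d"
      by (auto simp: eventually_sequentially)
    let ?G = "\<lambda>i p. (F (x0 + X (i + N)) p - F x0 p - F' x0 p (X (i + N))) /\<^sub>R norm (X (i + N))"
    have in_ball: "x0 + X (i + N) \<in> ball x0 d" for i
      using N[of "i + N"] by (simp add: dist_norm)
    have inW: "x0 + X (i + N) \<in> W" for i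
      using in_ball d(2) by blast
    have "(\<lambda>i. \<integral>p. ?G i p \<partial>M) \<longlonglongrightarrow> (\<integral>p. 0 \<partial>M)"
    proof (rule integral_dominated_convergence)
      show "integrable M (\<lambda>p. 2 * B p)" using B by simp
      show "?G i \<in> borel_measurable M" for i
        using int[OF inW] int[OF W(2)] meas by (intro borel_measurable_scaleR borel_measurable_diff) auto
      show "AE p in M. (\<lambda>i. ?G i p) \<longlonglongrightarrow> 0"
      proof (rule AE_I2)
        fix p
        have "(\<lambda>h. norm (F (x0 + h) p - F x0 p - F' x0 p h) / norm h) \<midarrow>0\<rightarrow> 0"
          using der[OF W(2), of p] unfolding has_derivative_at by blast
        then have "(\<lambda>i. norm (F (x0 + X i) p - F x0 p - F' x0 p (X i)) / norm (X i)) \<longlonglongrightarrow> 0"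
          using X unfolding tendsto_at_iff_sequentially comp_def by blast
        then have "(\<lambda>i. norm (?G i p)) \<longlonglongrightarrow> 0"
          using LIMSEQ_ignore_initial_segment[of _ 0 N] by (fastforce simp: divide_inverse_commute)
        then show "(\<lambda>i. ?G i p) \<longlonglongrightarrow> 0"
          by (rule tendsto_norm_zero_cancel)
      qed
      show "AE p in M. norm (?G i p) \<le> 2 * B p" for i
      proof (rule AE_I2)
        fix p
        let ?h = "X (i + N)"
        have h: "norm ?h > 0" using X(1) by simp
        have "norm (F (x0 + ?h) p - F x0 p) \<le> B p * norm (x0 + ?h - x0)"
        proof (rule differentiable_bound[OF convex_ball])
          show "((\<lambda>x. F x p) has_derivative F' x p) (at x within ball x0 d)" if "x \<in> ball x0 d" for x
            using der d(2) that has_derivative_at_withinI by blast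
          show "onorm (F' x p) \<le> B p" if "x \<in> ball x0 d" for x
            by (rule onorm_le) (use bound d(2) that in auto)
        qed (use in_ball d in auto)
        moreover have "norm (F' x0 p ?h) \<le> B p * norm ?h"
          by (rule bound[OF W(2)])
        ultimately have "norm (F (x0 + ?h) p - F x0 p - F' x0 p ?h) \<le> 2 * B p * norm ?h"
          using norm_triangle_ineq4[of "F (x0 + ?h) p - F x0 p" "F' x0 p ?h"] by (simp add: algebra_simps)
        then show "norm (?G i p) \<le> 2 * B p"
          using h by (simp add: divide_inverse_commute[symmetric] pos_divide_le_eq)
      qed
    qed simp
    moreover have "norm (\<integral>p. ?G i p \<partial>M) =
        norm ((\<integral>p. F (x0 + X (i + N)) p \<partial>M) - (\<integral>p. F x0 p \<partial>M) - ?D (X (i + N))) / norm (X (i + N))" for i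
      using int[OF inW] int[OF W(2)] intF' by (simp add: divide_inverse_commute)
    ultimately have "(\<lambda>i. norm ((\<integral>p. F (x0 + X (i + N)) p \<partial>M) - (\<integral>p. F x0 p \<partial>M) - ?D (X (i + N)))
        / norm (X (i + N))) \<longlonglongrightarrow> 0"
      using tendsto_norm_zero by fastforce
    then show "(\<lambda>i. norm ((\<integral>p. F (x0 + X i) p \<partial>M) - (\<integral>p. F x0 p \<partial>M) - ?D (X i)) / norm (X i))
        \<longlonglongrightarrow> 0"
      by (rule LIMSEQ_offset)
  qed
  ultimately show ?thesis
    unfolding has_derivative_at by blast
qed

lemma frechet_derivative_bounded_on_compact:
  fixes f :: "'a::euclidean_space \<Rightarrow> 'b::real_normed_vector"
  assumes "open S" "Ck_on (Suc 0) S f" "compact K" "K \<subseteq> S"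
  obtains R where "R \<ge> 0" "\<And>p v. p \<in> K \<Longrightarrow> norm (frechet_derivative f (at p) v) \<le> R * norm v"
proof -
  have "\<exists>C. \<forall>p\<in>K. norm (frechet_derivative f (at p) b) \<le> C" for b
  proof -
    have "continuous_on S (\<lambda>p. frechet_derivative f (at p) b)"
      using assms(2) by simp
    from compact_continuous_image[OF continuous_on_subset[OF this assms(4)] assms(3)]
    have "compact ((\<lambda>p. frechet_derivative f (at p) b) ` K)" .
    from compact_imp_bounded[OF this] show ?thesis
      unfolding bounded_iff by blast
  qed
  then obtain C where C: "\<And>b p. p \<in> K \<Longrightarrow> norm (frechet_derivative f (at p) b) \<le> C b"
    by metis
  show ?thesis
  proof
    fix p v assume p: "p \<in> K"
    then have lin: "linear (frechet_derivative f (at p))"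
      using assms by (intro linear_frechet_derivative) auto
    have "frechet_derivative f (at p) v = frechet_derivative f (at p) (\<Sum>b\<in>Basis. (v \<bullet> b) *\<^sub>R b)"
      by (simp add: euclidean_representation)
    also have "\<dots> = (\<Sum>b\<in>Basis. (v \<bullet> b) *\<^sub>R frechet_derivative f (at p) b)"
      by (simp add: linear_sum[OF lin] linear_scale[OF lin])
    also have "norm \<dots> \<le> (\<Sum>b\<in>Basis. norm v * \<bar>C b\<bar>)"
    proof (rule sum_norm_le)
      fix b :: 'a assume b: "b \<in> Basis"
      have "\<bar>v \<bullet> b\<bar> * norm (frechet_derivative f (at p) b) \<le> norm v * \<bar>C b\<bar>"
        by (intro mult_mono Basis_le_norm[OF b] order_trans[OF C[OF p] abs_ge_self]) auto
      then show "norm ((v \<bullet> b) *\<^sub>R frechet_derivative f (at p) b) \<le> norm v * \<bar>C b\<bar>" by simp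
    qed
    finally show "norm (frechet_derivative f (at p) v) \<le> (\<Sum>b\<in>Basis. \<bar>C b\<bar>) * norm v"
      by (simp add: sum_distrib_left mult.commute)
  qed (auto intro: sum_nonneg)
qed

section \<open>Integrals with a linear phase parameter\<close>

abbreviation osc :: "real \<Rightarrow> complex" where
  "osc t \<equiv> exp (\<i> * complex_of_real t)"

text \<open>Integration is over a space variable and a frequency.  Derivatives in \<open>x\<close> are again of this form,
  with a derivative of \<open>r\<close>, or with \<open>H\<close> multiplied by the frequency and \<open>r\<close> by a derivative of \<open>\<tau>\<close>.\<close>

definition param_osc :: "('y::euclidean_space \<times> real \<Rightarrow> complex) \<Rightarrow> ('x::euclidean_space \<times> 'y \<Rightarrow> complex)
    \<Rightarrow> ('x \<times> 'y \<Rightarrow> real) \<Rightarrow> 'x \<Rightarrow> complex" where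
  "param_osc H r \<tau> x = (LINT p|lborel. H p * r (x, fst p) * osc (snd p * \<tau> (x, fst p)))"

definition rapidly_decreasing :: "'y::euclidean_space set \<Rightarrow> ('y \<times> real \<Rightarrow> complex) \<Rightarrow> bool" where
  "rapidly_decreasing Y H \<longleftrightarrow> H \<in> borel_measurable borel \<and> (\<forall>p. fst p \<notin> Y \<longrightarrow> H p = 0) \<and>
     (\<forall>N. \<exists>C. \<forall>p. \<bar>snd p\<bar> ^ N * norm (H p) \<le> C)"

lemma rapidly_decreasing_outside: "rapidly_decreasing Y H \<Longrightarrow> fst p \<notin> Y \<Longrightarrow> H p = 0"
  unfolding rapidly_decreasing_def by blast

text \<open>Each differentiation of the exponential produces a factor \<open>\<i> s\<close> with \<open>s\<close> the frequency; the class of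
  admissible \<open>H\<close> absorbs it.\<close>

lemma rapidly_decreasing_mult_freq:
  assumes "rapidly_decreasing Y H"
  shows "rapidly_decreasing Y (\<lambda>p. \<i> * of_real (snd p) * H p)"
proof -
  have "(\<lambda>p :: 'a \<times> real. \<i> * complex_of_real (snd p)) \<in> borel_measurable borel"
    by (intro borel_measurable_continuous_onI continuous_intros)
  moreover have "H \<in> borel_measurable borel"
    using assms unfolding rapidly_decreasing_def by blast
  ultimately have "(\<lambda>p. \<i> * of_real (snd p) * H p) \<in> borel_measurable borel"
    by (rule borel_measurable_times)
  moreover have "\<exists>C. \<forall>p. \<bar>snd p\<bar> ^ N * norm (\<i> * of_real (snd p) * H p) \<le> C" for N
  proof -
    obtain C where "\<And>p. \<bar>snd p\<bar> ^ Suc N * norm (H p) \<le> C"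
      using assms unfolding rapidly_decreasing_def by blast
    then show ?thesis by (auto simp: norm_mult mult_ac intro!: exI[of _ C])
  qed
  ultimately show ?thesis
    using rapidly_decreasing_outside[OF assms] unfolding rapidly_decreasing_def by simp
qed

text \<open>The integral of the majorant that dominates every rapidly decreasing function supported in \<open>Y\<close>, up to
  a constant depending only on its moments of order at most two.\<close>

definition freq_mass :: "'y::euclidean_space set \<Rightarrow> real" where
  "freq_mass Y = (LINT p|lborel. indicator Y (fst p) * inverse (1 + (snd p)\<^sup>2))"

lemma integrable_lborel_prod:
  fixes f :: "'a::euclidean_space \<Rightarrow> 'c::{banach,second_countable_topology,real_normed_field}" and g :: "'b::euclidean_space \<Rightarrow> 'c"
  assumes "integrable lborel f" "integrable lborel g"
  shows "integrable lborel (\<lambda>p. f (fst p) * g (snd p))"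
proof -
  have "integrable (lborel \<Otimes>\<^sub>M lborel) (\<lambda>p. f (fst p) * g (snd p))"
  proof (rule lborel_pair.Fubini_integrable)
    show "(\<lambda>p. f (fst p) * g (snd p)) \<in> borel_measurable (lborel \<Otimes>\<^sub>M lborel)"
      using assms by measurable
    show "integrable lborel (\<lambda>x. LINT y|lborel. norm (f (fst (x, y)) * g (snd (x, y))))"
      using assms by (simp add: norm_mult)
    show "AE x in lborel. integrable lborel (\<lambda>y. f (fst (x, y)) * g (snd (x, y)))"
      using assms by simp
  qed
  then show ?thesis by (simp add: lborel_prod)
qed

lemma integrable_inverse_1_plus_square_lborel: "integrable lborel (\<lambda>w::real. inverse (1 + w\<^sup>2))"
  using integrable_inverse_1_plus_square by (simp add: set_integrable_def einterval_def)

lemma integrable_freq_mass: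
  fixes Y :: "'y::euclidean_space set"
  assumes "compact Y"
  shows "integrable lborel (\<lambda>p::'y \<times> real. indicator Y (fst p) * inverse (1 + (snd p)\<^sup>2) :: real)"
proof (rule integrable_lborel_prod[OF _ integrable_inverse_1_plus_square_lborel])
  show "integrable lborel (indicator Y :: 'y \<Rightarrow> real)"
    using assms emeasure_compact_finite[of Y]
    by (intro integrable_real_indicator) (auto intro: borel_compact)
qed

lemma rapidly_decreasing_integrable:
  assumes Y: "compact Y" and H: "rapidly_decreasing Y H"
  shows "integrable lborel H"
    and "\<And>S. (\<And>N p. N \<le> 2 \<Longrightarrow> \<bar>snd p\<bar> ^ N * norm (H p) \<le> S) \<Longrightarrow>
      (LINT p|lborel. norm (H p)) \<le> 2 * S * freq_mass Y"
proof -
  have le: "norm (H p) \<le> 2 * S * (indicator Y (fst p) * inverse (1 + (snd p)\<^sup>2))"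
    if "\<And>N p. N \<le> 2 \<Longrightarrow> \<bar>snd p\<bar> ^ N * norm (H p) \<le> S" for p S
  proof (cases "fst p \<in> Y")
    case True
    have pos: "1 + (snd p)\<^sup>2 > 0" by (simp add: add_pos_nonneg)
    have "norm (H p) * (1 + (snd p)\<^sup>2) \<le> 2 * S"
      using that[of 0 p] that[of 2 p] by (simp add: algebra_simps)
    then have "norm (H p) \<le> 2 * S / (1 + (snd p)\<^sup>2)"
      using pos by (simp add: pos_le_divide_eq)
    then show ?thesis using True by (simp add: divide_inverse)
  qed (simp add: rapidly_decreasing_outside[OF H])
  obtain C0 C1 C2 where "\<And>p. \<bar>snd p\<bar> ^ 0 * norm (H p) \<le> C0" "\<And>p. \<bar>snd p\<bar> ^ 1 * norm (H p) \<le> C1"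
    "\<And>p. \<bar>snd p\<bar> ^ 2 * norm (H p) \<le> C2"
    using H unfolding rapidly_decreasing_def by meson
  moreover have "N = 0 \<or> N = 1 \<or> N = 2" if "N \<le> 2" for N :: nat
    using that by auto
  ultimately have "\<bar>snd p\<bar> ^ N * norm (H p) \<le> max C0 (max C1 C2)" if "N \<le> 2" for N p
    using that by (metis le_max_iff_disj)
  then have "norm (H p) \<le> 2 * max C0 (max C1 C2) * (indicator Y (fst p) * inverse (1 + (snd p)\<^sup>2))" for p
    by (rule le)
  then show int: "integrable lborel H"
    by (intro Bochner_Integration.integrable_bound[OF
          integrable_mult_right[OF integrable_freq_mass[OF Y], of "2 * max C0 (max C1 C2)"]] AE_I2)
      (use H in \<open>auto simp: rapidly_decreasing_def intro: order_trans[OF _ abs_ge_self]\<close>)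
  show "(LINT p|lborel. norm (H p)) \<le> 2 * S * freq_mass Y"
    if "\<And>N p. N \<le> 2 \<Longrightarrow> \<bar>snd p\<bar> ^ N * norm (H p) \<le> S" for S
  proof -
    have "(LINT p|lborel. norm (H p)) \<le>
        (LINT p|lborel. 2 * S * (indicator Y (fst p) * inverse (1 + (snd p)\<^sup>2)))"
      by (rule integral_mono) (use int integrable_freq_mass[OF Y] le[OF that] in auto)
    then show ?thesis by (simp add: freq_mass_def)
  qed
qed

lemma param_osc_integrand_measurable:
  fixes H :: "'y::euclidean_space \<times> real \<Rightarrow> complex"
  assumes Y: "compact Y" and H: "rapidly_decreasing Y H"
    and u: "continuous_on Y u" and v: "continuous_on Y v"
  shows "(\<lambda>p. H p * u (fst p) * osc (snd p * v (fst p))) \<in> borel_measurable borel"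
proof -
  have [measurable]: "Y \<in> sets borel" using Y by (rule borel_compact)
  have [measurable]: "H \<in> borel_measurable borel" using H by (simp add: rapidly_decreasing_def)
  have [measurable]: "(\<lambda>y. indicator Y y *\<^sub>R u y) \<in> borel_measurable borel"
    "(\<lambda>y. indicator Y y *\<^sub>R v y) \<in> borel_measurable borel"
    using Y u v by (intro borel_measurable_continuous_on_indicator borel_compact; simp)+
  have [measurable]: "(fst :: 'y \<times> real \<Rightarrow> 'y) \<in> borel_measurable borel"
    "(snd :: 'y \<times> real \<Rightarrow> real) \<in> borel_measurable borel"
    by (auto intro!: borel_measurable_continuous_onI continuous_intros)
  have "(\<lambda>p. H p * (indicator Y (fst p) *\<^sub>R u (fst p)) *
      osc (snd p * (indicator Y (fst p) *\<^sub>R v (fst p)))) \<in> borel_measurable borel"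
    by measurable
  moreover have "H p * (indicator Y (fst p) *\<^sub>R u (fst p)) *
      osc (snd p * (indicator Y (fst p) *\<^sub>R v (fst p))) =
      H p * u (fst p) * osc (snd p * v (fst p))" for p
    by (cases "fst p \<in> Y") (auto simp: rapidly_decreasing_outside[OF H])
  ultimately show ?thesis by simp
qed

lemma param_osc_integrand_integrable:
  fixes H :: "'y::euclidean_space \<times> real \<Rightarrow> complex"
  assumes Y: "compact Y" and H: "rapidly_decreasing Y H"
    and u: "continuous_on Y u" and v: "continuous_on Y v"
  shows "integrable lborel (\<lambda>p. H p * u (fst p) * osc (snd p * v (fst p)))"
proof -
  have "bounded (u ` Y)"
    by (intro compact_imp_bounded compact_continuous_image u Y)
  then obtain R where R: "\<And>y. y \<in> Y \<Longrightarrow> norm (u y) \<le> R"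
    unfolding bounded_iff by blast
  show ?thesis
  proof (rule Bochner_Integration.integrable_bound)
    show "integrable lborel (\<lambda>p. R * norm (H p))"
      using rapidly_decreasing_integrable(1)[OF Y H] by simp
    show "(\<lambda>p. H p * u (fst p) * osc (snd p * v (fst p))) \<in> borel_measurable lborel"
      using param_osc_integrand_measurable[OF assms] by simp
    have "norm (H p * u (fst p)) \<le> R * norm (H p)" for p
    proof (cases "fst p \<in> Y")
      case True
      then show ?thesis using mult_right_mono[OF R norm_ge_zero[of "H p"]] by (simp add: norm_mult mult.commute)
    qed (simp add: rapidly_decreasing_outside[OF H])
    then have "norm (H p * u (fst p) * osc (snd p * v (fst p))) \<le> norm (R * norm (H p))" for p
      by (simp only: norm_mult[of _ "exp _"] norm_exp_i_times mult_1_right real_norm_def)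
        (rule order_trans[OF _ abs_ge_self])
    then show "AE p in lborel. norm (H p * u (fst p) * osc (snd p * v (fst p))) \<le> norm (R * norm (H p))"
      by (rule AE_I2)
  qed
qed

text \<open>The points \<open>x\<close> range over \<open>W\<close> and \<open>H\<close> is supported over the compact set \<open>Y\<close>; the open set
  \<open>O'\<close> is where \<open>r\<close> and \<open>\<tau>\<close> are smooth.\<close>

context
  fixes O' :: "('x::euclidean_space \<times> 'y::euclidean_space) set" and Y W and \<tau> :: "'x \<times> 'y \<Rightarrow> real"
  assumes O: "open O'" and Y: "compact Y" and W: "open W" and WY: "W \<times> Y \<subseteq> O'"
    and \<tau>: "\<And>k. Ck_on k O' \<tau>"
begin

lemma continuous_on_slice:
  assumes "Ck_on k O' f" "x \<in> W"
  shows "continuous_on Y (\<lambda>y. f (x, y))"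
proof (rule continuous_on_compose2[OF Ck_on_imp_continuous_on[OF assms(1)]])
  show "continuous_on Y (\<lambda>y. (x, y))" by (intro continuous_intros)
qed (use assms(2) WY in auto)

lemma Ck_on_partial: "(\<And>k. Ck_on k O' f) \<Longrightarrow> Ck_on k O' (\<lambda>p. frechet_derivative f (at p) (v, 0))"
  by (metis Ck_on.simps(2))

lemma has_derivative_slice:
  assumes "Ck_on (Suc k) O' f" "(x, y) \<in> O'"
  shows "((\<lambda>x. f (x, y)) has_derivative (\<lambda>v. frechet_derivative f (at (x, y)) (v, 0))) (at x)"
  by (rule has_derivative_compose[of "\<lambda>x. (x, y)" "\<lambda>v. (v, 0)" _ UNIV f])
    (use Ck_on_has_derivative[OF assms] in \<open>auto intro!: derivative_eq_intros\<close>)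

text \<open>On a compact ball in \<open>W\<close> times \<open>Y\<close> the functions \<open>r\<close>, \<open>dr\<close> and \<open>d\<tau>\<close> are bounded, so \<open>H\<close> and \<open>H\<close>
  times the frequency provide an integrable majorant.\<close>

lemma has_derivative_param_osc:
  fixes r :: "'x \<times> 'y \<Rightarrow> complex"
  assumes H: "rapidly_decreasing Y H" and r: "\<And>k. Ck_on k O' r" and x0: "x0 \<in> W"
  shows "(param_osc H r \<tau> has_derivative
    (\<lambda>v. param_osc H (\<lambda>p. frechet_derivative r (at p) (v, 0)) \<tau> x0 +
      param_osc (\<lambda>p. \<i> * of_real (snd p) * H p)
        (\<lambda>p. r p * of_real (frechet_derivative \<tau> (at p) (v, 0))) \<tau> x0)) (at x0)"
proof -
  obtain d where d: "d > 0" "cball x0 d \<subseteq> W"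
    using W x0 open_contains_cball by blast
  let ?K = "cball x0 d \<times> Y"
  have K: "compact ?K" "?K \<subseteq> O'"
    using Y d WY by (auto intro: compact_Times)
  obtain R1 where R1: "R1 \<ge> 0" "\<And>p v. p \<in> ?K \<Longrightarrow> norm (frechet_derivative r (at p) v) \<le> R1 * norm v"
    using frechet_derivative_bounded_on_compact[OF O r K] by blast
  obtain T1 where T1: "T1 \<ge> 0" "\<And>p v. p \<in> ?K \<Longrightarrow> norm (frechet_derivative \<tau> (at p) v) \<le> T1 * norm v"
    using frechet_derivative_bounded_on_compact[OF O \<tau> K] by blast
  have "bounded (r ` ?K)"
    using K Ck_on_imp_continuous_on[OF r]
    by (intro compact_imp_bounded compact_continuous_image) (auto intro: continuous_on_subset)
  then obtain R0' where "\<forall>z\<in>r ` ?K. norm z \<le> R0'"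
    unfolding bounded_iff by blast
  then obtain R0 where R0: "R0 \<ge> 0" "\<And>p. p \<in> ?K \<Longrightarrow> norm (r p) \<le> R0"
    using that[of "max 0 R0'"] by (fastforce simp: le_max_iff_disj)
  let ?e = "\<lambda>x p. osc (snd p * \<tau> (x, fst p))"
  let ?H = "\<lambda>p. \<i> * of_real (snd p) * H p"
  let ?F = "\<lambda>x p. H p * r (x, fst p) * ?e x p"
  let ?A = "\<lambda>x p v. H p * frechet_derivative r (at (x, fst p)) (v, 0) * ?e x p"
  let ?B = "\<lambda>x p v. ?H p * (r (x, fst p) * of_real (frechet_derivative \<tau> (at (x, fst p)) (v, 0))) * ?e x p"
  have H': "rapidly_decreasing Y ?H" by (rule rapidly_decreasing_mult_freq[OF H])
  have \<tau>_v: "Ck_on k O' (\<lambda>p. r p * of_real (frechet_derivative \<tau> (at p) (v, 0)))" for k v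
    by (rule Ck_on_mult[OF O r Ck_on_of_real[OF O Ck_on_partial[OF \<tau>]]])
  have int: "integrable lborel (\<lambda>p. ?A x0 p v)" "integrable lborel (\<lambda>p. ?B x0 p v)" for v
    using param_osc_integrand_integrable[OF Y H continuous_on_slice[OF Ck_on_partial[OF r] x0]
        continuous_on_slice[OF \<tau> x0]]
      param_osc_integrand_integrable[OF Y H' continuous_on_slice[OF \<tau>_v x0] continuous_on_slice[OF \<tau> x0]]
    by auto
  have "((\<lambda>x. LINT p|lborel. ?F x p) has_derivative (\<lambda>v. LINT p|lborel. ?A x0 p v + ?B x0 p v)) (at x0)"
  proof (rule has_derivative_integral[of "ball x0 d"])
    fix x assume x: "x \<in> ball x0 d"
    then have xW: "x \<in> W" using d by auto
    show "integrable lborel (?F x)"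
      by (rule param_osc_integrand_integrable[OF Y H continuous_on_slice[OF r xW] continuous_on_slice[OF \<tau> xW]])
    fix p
    show "((\<lambda>x. ?F x p) has_derivative (\<lambda>v. ?A x p v + ?B x p v)) (at x)"
    proof (cases "fst p \<in> Y")
      case True
      then have xp: "(x, fst p) \<in> O'" using xW WY by auto
      have D\<tau>: "((\<lambda>x. \<tau> (x, fst p)) has_derivative (\<lambda>v. frechet_derivative \<tau> (at (x, fst p)) (v, 0))) (at x)"
        by (rule has_derivative_slice[OF \<tau> xp])
      have "((\<lambda>x. \<i> * complex_of_real (snd p * \<tau> (x, fst p))) has_derivative
          (\<lambda>v. \<i> * complex_of_real (snd p * frechet_derivative \<tau> (at (x, fst p)) (v, 0)))) (at x)"
        by (intro has_derivative_mult_right has_derivative_of_real D\<tau>)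
      from has_derivative_compose[OF this has_field_derivative_imp_has_derivative[OF DERIV_exp]]
      have De: "((\<lambda>x. ?e x p) has_derivative
          (\<lambda>v. ?e x p * (\<i> * complex_of_real (snd p * frechet_derivative \<tau> (at (x, fst p)) (v, 0))))) (at x)" .
      show ?thesis
        by (rule has_derivative_eq_rhs[OF has_derivative_mult[OF has_derivative_mult_right[OF
                has_derivative_slice[OF r xp]] De]])
          (simp add: algebra_simps)
    qed (simp add: rapidly_decreasing_outside[OF H])
    fix v
    show "norm (?A x p v + ?B x p v) \<le> (R1 * norm (H p) + R0 * T1 * norm (?H p)) * norm v"
    proof (cases "fst p \<in> Y")
      case True
      then have xp: "(x, fst p) \<in> ?K" using x by auto
      have nv: "norm (v, 0::'y) = norm v" by simp
      have "norm (?A x p v) = norm (H p) * norm (frechet_derivative r (at (x, fst p)) (v, 0))"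
        by (simp add: norm_mult)
      also have "\<dots> \<le> norm (H p) * (R1 * norm v)"
        using R1(2)[OF xp, of "(v, 0)"] unfolding nv by (intro mult_left_mono) auto
      finally have A: "norm (?A x p v) \<le> R1 * norm (H p) * norm v" by (simp add: mult_ac)
      have "norm (?B x p v) = norm (?H p) * (norm (r (x, fst p)) * norm (frechet_derivative \<tau> (at (x, fst p)) (v, 0)))"
        by (simp only: norm_mult norm_exp_i_times norm_of_real real_norm_def mult_1_right)
      also have "\<dots> \<le> norm (?H p) * (R0 * (T1 * norm v))"
        using T1(2)[OF xp, of "(v, 0)"] R0 T1(1) R0(2)[OF xp] unfolding nv
        by (intro mult_left_mono mult_mono) auto
      finally have B: "norm (?B x p v) \<le> R0 * T1 * norm (?H p) * norm v" by (simp only: mult_ac)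
      show ?thesis
        using norm_triangle_mono[OF A B] by (simp only: distrib_right)
    qed (simp add: rapidly_decreasing_outside[OF H])
  next
    show "integrable lborel (\<lambda>p. R1 * norm (H p) + R0 * T1 * norm (?H p))"
      using rapidly_decreasing_integrable(1)[OF Y H] rapidly_decreasing_integrable(1)[OF Y H']
      by (intro Bochner_Integration.integrable_add integrable_mult_right integrable_norm)
    show "(\<lambda>p. ?A x0 p v + ?B x0 p v) \<in> borel_measurable lborel" for v
      using int[of v] by (intro borel_measurable_add) auto
  qed (use d in auto)
  moreover have "(LINT p|lborel. ?A x0 p v + ?B x0 p v) =
      (LINT p|lborel. ?A x0 p v) + (LINT p|lborel. ?B x0 p v)" for v
    by (rule Bochner_Integration.integral_add[OF int])
  ultimately show ?thesis
    unfolding param_osc_def[abs_def] by simp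
qed

lemma Ck_on_param_osc:
  assumes "rapidly_decreasing Y H" "\<And>k. Ck_on k O' r"
  shows "Ck_on k W (param_osc H r \<tau>)"
  using assms
proof (induction k arbitrary: H r)
  case 0
  then show ?case
    using has_derivative_continuous[OF has_derivative_param_osc]
    by (auto intro!: continuous_at_imp_continuous_on)
next
  case (Suc k)
  show ?case
  proof (rule Ck_on_SucI[OF W has_derivative_param_osc[OF Suc.prems]])
    fix v
    have "Ck_on k W (param_osc H (\<lambda>p. frechet_derivative r (at p) (v, 0)) \<tau>)"
      by (rule Suc.IH[OF Suc.prems(1) Ck_on_partial[OF Suc.prems(2)]])
    moreover have "Ck_on k O' (\<lambda>p. r p * of_real (frechet_derivative \<tau> (at p) (v, 0)))" for k
      by (rule Ck_on_mult[OF O Suc.prems(2) Ck_on_of_real[OF O Ck_on_partial[OF \<tau>]]])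
    then have "Ck_on k W (param_osc (\<lambda>p. \<i> * of_real (snd p) * H p)
        (\<lambda>p. r p * of_real (frechet_derivative \<tau> (at p) (v, 0))) \<tau>)"
      by (rule Suc.IH[OF rapidly_decreasing_mult_freq[OF Suc.prems(1)]])
    ultimately show "Ck_on k W (\<lambda>x. param_osc H (\<lambda>p. frechet_derivative r (at p) (v, 0)) \<tau> x +
      param_osc (\<lambda>p. \<i> * of_real (snd p) * H p)
        (\<lambda>p. r p * of_real (frechet_derivative \<tau> (at p) (v, 0))) \<tau> x)"
      by (rule Ck_on_add[OF W])
  qed
qed

text \<open>The constant depends on \<open>r\<close>, \<open>\<tau>\<close> and \<open>L\<close> but not on \<open>H\<close>.  Applied with \<open>H\<close> built from a
  test function, this becomes the continuity estimate for a distribution.  The induction peels off the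
  innermost derivative, which costs one moment of \<open>H\<close>; two more moments make \<open>H\<close> integrable.\<close>

lemma param_osc_bound:
  assumes L: "compact L" "L \<subseteq> W" and r: "\<And>k. Ck_on k O' r"
  shows "\<exists>C. \<forall>H S. rapidly_decreasing Y H \<longrightarrow>
    (\<forall>N p. N \<le> length vs + 2 \<longrightarrow> \<bar>snd p\<bar> ^ N * norm (H p) \<le> S) \<longrightarrow>
    (\<forall>x\<in>L. norm (iter_deriv vs (param_osc H r \<tau>) x) \<le> C * S)"
  using r
proof (induction vs arbitrary: r rule: rev_induct)
  case Nil
  have "L \<times> Y \<subseteq> O'" using L WY by auto
  then have "bounded (r ` (L \<times> Y))"
    using L Y Ck_on_imp_continuous_on[OF Nil]
    by (intro compact_imp_bounded compact_continuous_image compact_Times) (auto intro: continuous_on_subset)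
  then obtain R where "\<forall>z\<in>r ` (L \<times> Y). norm z \<le> R"
    unfolding bounded_iff by blast
  then have R: "norm (r (x, y)) \<le> R" if "x \<in> L" "y \<in> Y" for x y
    using that by blast
  show ?case
  proof (intro exI[of _ "max 0 R * (2 * freq_mass Y)"] allI impI ballI)
    fix H S x assume H: "rapidly_decreasing Y H" and x: "x \<in> L"
      and S: "\<forall>N p. N \<le> length [] + 2 \<longrightarrow> \<bar>snd p\<bar> ^ N * norm (H p) \<le> S"
    have xW: "x \<in> W" using x L by auto
    let ?F = "\<lambda>p. H p * r (x, fst p) * osc (snd p * \<tau> (x, fst p))"
    have le: "norm (?F p) \<le> max 0 R * norm (H p)" for p
    proof (cases "fst p \<in> Y")
      case True
      have "norm (?F p) = norm (r (x, fst p)) * norm (H p)"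
        by (simp only: norm_mult norm_exp_i_times mult_1_right mult.commute)
      also have "\<dots> \<le> max 0 R * norm (H p)"
        using R[OF x True] by (intro mult_right_mono) auto
      finally show ?thesis .
    qed (simp add: rapidly_decreasing_outside[OF H])
    have "norm (param_osc H r \<tau> x) \<le> (LINT p|lborel. norm (?F p))"
      unfolding param_osc_def by (rule integral_norm_bound)
    also have "\<dots> \<le> (LINT p|lborel. max 0 R * norm (H p))"
      using param_osc_integrand_integrable[OF Y H continuous_on_slice[OF Nil xW] continuous_on_slice[OF \<tau> xW]]
        rapidly_decreasing_integrable(1)[OF Y H] le
      by (intro integral_mono integrable_norm integrable_mult_right) auto
    also have "\<dots> = max 0 R * (LINT p|lborel. norm (H p))" by simp
    also have "\<dots> \<le> max 0 R * (2 * S * freq_mass Y)"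
      by (intro mult_left_mono rapidly_decreasing_integrable(2)[OF Y H]) (use S in auto)
    finally show "norm (iter_deriv [] (param_osc H r \<tau>) x) \<le> max 0 R * (2 * freq_mass Y) * S"
      by (simp add: mult_ac)
  qed
next
  case (snoc v vs)
  let ?r1 = "\<lambda>p. frechet_derivative r (at p) (v, 0)"
  let ?r2 = "\<lambda>p. r p * of_real (frechet_derivative \<tau> (at p) (v, 0))"
  have r1: "\<And>k. Ck_on k O' ?r1" by (rule Ck_on_partial[OF snoc.prems])
  have r2: "\<And>k. Ck_on k O' ?r2"
    by (rule Ck_on_mult[OF O snoc.prems Ck_on_of_real[OF O Ck_on_partial[OF \<tau>]]])
  obtain C1 where C1: "\<And>H S x. rapidly_decreasing Y H \<Longrightarrow>
    (\<And>N p. N \<le> length vs + 2 \<Longrightarrow> \<bar>snd p\<bar> ^ N * norm (H p) \<le> S) \<Longrightarrow>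
    x \<in> L \<Longrightarrow> norm (iter_deriv vs (param_osc H ?r1 \<tau>) x) \<le> C1 * S"
    using snoc.IH[OF r1] by blast
  obtain C2 where C2: "\<And>H S x. rapidly_decreasing Y H \<Longrightarrow>
    (\<And>N p. N \<le> length vs + 2 \<Longrightarrow> \<bar>snd p\<bar> ^ N * norm (H p) \<le> S) \<Longrightarrow>
    x \<in> L \<Longrightarrow> norm (iter_deriv vs (param_osc H ?r2 \<tau>) x) \<le> C2 * S"
    using snoc.IH[OF r2] by blast
  show ?case
  proof (intro exI[of _ "C1 + C2"] allI impI ballI)
    fix H S x assume H: "rapidly_decreasing Y H" and x: "x \<in> L"
      and S: "\<forall>N p. N \<le> length (vs @ [v]) + 2 \<longrightarrow> \<bar>snd p\<bar> ^ N * norm (H p) \<le> S"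
    let ?H = "\<lambda>p. \<i> * of_real (snd p) * H p"
    have H': "rapidly_decreasing Y ?H" by (rule rapidly_decreasing_mult_freq[OF H])
    have xW: "x \<in> W" using x L by auto
    have S': "\<bar>snd p\<bar> ^ N * norm (?H p) \<le> S" if "N \<le> length vs + 2" for N p
      using S[rule_format, of "Suc N" p] that by (simp add: norm_mult mult_ac)
    have "iter_deriv (vs @ [v]) (param_osc H r \<tau>) x =
        iter_deriv vs (\<lambda>x. frechet_derivative (param_osc H r \<tau>) (at x) v) x"
      by (simp add: iter_deriv_append)
    also have "\<dots> = iter_deriv vs (\<lambda>x. param_osc H ?r1 \<tau> x + param_osc ?H ?r2 \<tau> x) x"
    proof (rule iter_deriv_cong[OF W _ _ xW])
      show "frechet_derivative (param_osc H r \<tau>) (at x) v =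
          param_osc H ?r1 \<tau> x + param_osc ?H ?r2 \<tau> x" if "x \<in> W" for x
        using frechet_derivative_at[OF has_derivative_param_osc[OF H snoc.prems that], symmetric] by simp
      show "Ck_on k W (\<lambda>x. frechet_derivative (param_osc H r \<tau>) (at x) v)" for k
        using Ck_on_param_osc[OF H snoc.prems, of "Suc k"] by simp
    qed
    also have "\<dots> = iter_deriv vs (param_osc H ?r1 \<tau>) x + iter_deriv vs (param_osc ?H ?r2 \<tau>) x"
      by (rule iter_deriv_add[OF W Ck_on_param_osc[OF H r1] Ck_on_param_osc[OF H' r2] xW])
    finally show "norm (iter_deriv (vs @ [v]) (param_osc H r \<tau>) x) \<le> (C1 + C2) * S"
      using norm_triangle_mono[OF C1[OF H _ x, of S] C2[OF H' S' x]] S by (simp add: distrib_right)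
  qed
qed

end


section \<open>Oscillatory integrals with a phase linear in the frequency\<close>

lemma lborel_fubini_fst:
  fixes f :: "'a::euclidean_space \<times> 'b::euclidean_space \<Rightarrow> complex"
  assumes "integrable lborel f"
  shows "(LINT p|lborel. f p) = (LINT x|lborel. LINT y|lborel. f (x, y))"
    and "integrable lborel (\<lambda>x. LINT y|lborel. f (x, y))"
  using lborel_pair.integral_fst'[of f] lborel_pair.integrable_fst'[of f] assms
  by (simp_all add: lborel_prod)

lemma lborel_fubini_snd:
  fixes f :: "'a::euclidean_space \<times> 'b::euclidean_space \<Rightarrow> complex"
  assumes "integrable lborel f"
  shows "(LINT p|lborel. f p) = (LINT y|lborel. LINT x|lborel. f (x, y))"
    and "integrable lborel (\<lambda>y. LINT x|lborel. f (x, y))"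
  using lborel_pair.integral_snd[of "\<lambda>x y. f (x, y)"] lborel_pair.integrable_snd[of "\<lambda>x y. f (x, y)"] assms
  by (simp_all add: lborel_prod)

lemma compactly_supported_integrable:
  fixes f :: "'a::euclidean_space \<Rightarrow> complex"
  assumes "continuous_on UNIV f" "compact K" "\<And>x. x \<notin> K \<Longrightarrow> f x = 0"
  shows "integrable lborel f"
proof -
  have "(\<lambda>x. indicator K x *\<^sub>R f x) = f"
    using assms(3) by (auto simp: fun_eq_iff split: split_indicator)
  then show ?thesis
    using borel_integrable_compact[OF assms(2) continuous_on_subset[OF assms(1) subset_UNIV]] by simp
qed

lemma compactly_supported_bounded:
  fixes f :: "'a::euclidean_space \<Rightarrow> complex"
  assumes "continuous_on UNIV f" "compact K" "\<And>x. x \<notin> K \<Longrightarrow> f x = 0"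
  obtains C where "C \<ge> 0" "\<And>x. norm (f x) \<le> C"
proof -
  have "bounded (f ` K)"
    by (rule compact_imp_bounded[OF compact_continuous_image[OF continuous_on_subset[OF assms(1) subset_UNIV] assms(2)]])
  then obtain C where "\<forall>z\<in>f ` K. norm z \<le> C"
    unfolding bounded_iff by blast
  then have "norm (f x) \<le> max C 0" for x
    using assms(3)[of x] by (cases "x \<in> K") (auto simp: le_max_iff_disj)
  then show ?thesis using that[of "max C 0"] by simp
qed

lemma test_funsE:
  assumes "\<phi> \<in> test_funs U"
  obtains K where "compact K" "K \<subseteq> U" "\<And>x. x \<notin> K \<Longrightarrow> \<phi> x = 0" "\<And>k. Ck_on k UNIV \<phi>" "continuous_on UNIV \<phi>"
proof -
  have *: "Ck_on k UNIV \<phi>" for k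
    using assms by (simp add: test_funs_def smooth_on_open)
  obtain K where "compact K" "K \<subseteq> U" "\<And>x. x \<notin> K \<Longrightarrow> \<phi> x = 0"
    using assms by (auto simp: test_funs_def)
  then show ?thesis using *[of 0] by (intro that[OF _ _ _ *]) auto
qed

lemma has_osc_integral_unique:
  fixes \<phi> :: "'x::euclidean_space \<times> real \<Rightarrow> real"
  assumes "has_osc_integral \<phi> a w I" "has_osc_integral \<phi> a w J"
  shows "I = J"
proof -
  have 1: "(\<lambda>w. complex_of_real (cutoff w)) 0 = 1"
    by (simp add: cutoff_eq_1)
  from assms[unfolded has_osc_integral_def, rule_format, OF cutoff_in_test_funs 1]
  show ?thesis
    by (blast intro: tendsto_unique[OF trivial_limit_at_right_real])
qed

lemma osc_integral_eq:
  fixes \<phi> :: "'x::euclidean_space \<times> real \<Rightarrow> real"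
  shows "has_osc_integral \<phi> a w I \<Longrightarrow> osc_integral \<phi> a w = I"
  unfolding osc_integral_def using has_osc_integral_unique by blast

lemma integrable_damped_osc:
  fixes \<tau> :: "'z::euclidean_space \<Rightarrow> real" and u :: "'z \<Rightarrow> complex" and c :: "real \<Rightarrow> complex"
  assumes "\<tau> \<in> borel_measurable borel" "integrable lborel u" "integrable lborel c"
  shows "integrable lborel (\<lambda>p. c (snd p) * u (fst p) * osc (snd p * \<tau> (fst p)))"
proof (rule Bochner_Integration.integrable_bound)
  have [measurable]: "(fst :: 'z \<times> real \<Rightarrow> 'z) \<in> borel_measurable borel"
    "(snd :: 'z \<times> real \<Rightarrow> real) \<in> borel_measurable borel"
    by (auto intro!: borel_measurable_continuous_onI continuous_intros)
  have [measurable]: "u \<in> borel_measurable borel" "c \<in> borel_measurable borel" "\<tau> \<in> borel_measurable borel"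
    using assms borel_measurable_integrable by auto
  show "(\<lambda>p. c (snd p) * u (fst p) * osc (snd p * \<tau> (fst p))) \<in> borel_measurable lborel"
    by measurable
  show "integrable lborel (\<lambda>p. u (fst p) * c (snd p))"
    by (rule integrable_lborel_prod[OF assms(2,3)])
qed (simp add: norm_mult mult.commute)

text \<open>After the integration over the space variables the cutoff in the frequency can be removed by
  dominated convergence, because what is left decays.\<close>

lemma has_osc_integral_linear_phase:
  fixes \<tau> :: "'z::euclidean_space \<Rightarrow> real" and r w :: "'z \<Rightarrow> complex" and b :: "real \<Rightarrow> complex"
  assumes \<tau>: "\<tau> \<in> borel_measurable borel" and rw: "integrable lborel (\<lambda>z. r z * w z)"
    and b: "continuous_on UNIV b"
    and bm: "integrable lborel (\<lambda>s. b s * (LINT z|lborel. r z * w z * osc (s * \<tau> z)))"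
  shows "has_osc_integral (\<lambda>(z, s). s * \<tau> z) (\<lambda>(z, s). b s * r z) w
    (LINT s|lborel. b s * (LINT z|lborel. r z * w z * osc (s * \<tau> z)))"
  unfolding has_osc_integral_def
proof (intro ballI impI conjI allI)
  let ?m = "\<lambda>s. LINT z|lborel. r z * w z * osc (s * \<tau> z)"
  fix \<rho> :: "real \<Rightarrow> complex" assume \<rho>: "\<rho> \<in> test_funs UNIV" and \<rho>0: "\<rho> 0 = 1"
  obtain K where K: "compact K" "\<And>x. x \<notin> K \<Longrightarrow> \<rho> x = 0" and cont: "continuous_on UNIV \<rho>"
    using test_funsE[OF \<rho>] by metis
  obtain C where C: "\<And>x. norm (\<rho> x) \<le> C"
    using compactly_supported_bounded[OF cont K] by metis
  have cont_eps: "continuous_on UNIV (\<lambda>s. \<rho> (e * s))" for e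
    by (rule continuous_on_compose2[OF cont]) (auto intro: continuous_intros)
  have eq: "(\<lambda>(z, s). \<rho> (e *\<^sub>R s) * osc (case (z, s) of (z, s) \<Rightarrow> s * \<tau> z) *
      (case (z, s) of (z, s) \<Rightarrow> b s * r z) * w z) =
    (\<lambda>p. \<rho> (e * snd p) * b (snd p) * (r (fst p) * w (fst p)) * osc (snd p * \<tau> (fst p)))" for e
    by (auto simp: fun_eq_iff)
  have int: "integrable lborel (\<lambda>p. \<rho> (e * snd p) * b (snd p) * (r (fst p) * w (fst p)) *
      osc (snd p * \<tau> (fst p)))" if "e > 0" for e
  proof (rule integrable_damped_osc[OF \<tau> rw, of "\<lambda>s. \<rho> (e * s) * b s"])
    show "integrable lborel (\<lambda>s. \<rho> (e * s) * b s)"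
    proof (rule compactly_supported_integrable)
      show "continuous_on UNIV (\<lambda>s. \<rho> (e * s) * b s)"
        by (intro continuous_on_mult cont_eps b)
      show "compact ((\<lambda>x. inverse e *\<^sub>R x) ` K)"
        by (rule compact_scaling[OF K(1)])
      show "\<rho> (e * s) * b s = 0" if "s \<notin> (\<lambda>x. inverse e *\<^sub>R x) ` K" for s
      proof -
        have "e * s \<notin> K"
        proof
          assume "e * s \<in> K"
          then have "inverse e *\<^sub>R (e * s) \<in> (\<lambda>x. inverse e *\<^sub>R x) ` K" by (rule imageI)
          moreover have "inverse e *\<^sub>R (e * s) = s" using \<open>e > 0\<close> by simp
          ultimately show False using that by metis
        qed
        then show ?thesis using K(2) by simp
      qed
    qed
  qed
  show "integrable lborel (\<lambda>(z, s). \<rho> (e *\<^sub>R s) * osc (case (z, s) of (z, s) \<Rightarrow> s * \<tau> z) *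
      (case (z, s) of (z, s) \<Rightarrow> b s * r z) * w z)" if "e > 0" for e
    unfolding eq by (rule int[OF that])
  have val: "(LINT p|lborel. (case p of (z, s) \<Rightarrow> \<rho> (e *\<^sub>R s) * osc (case (z, s) of (z, s) \<Rightarrow> s * \<tau> z) *
      (case (z, s) of (z, s) \<Rightarrow> b s * r z) * w z)) = (LINT s|lborel. \<rho> (e * s) * (b s * ?m s))" if "e > 0" for e
    unfolding eq lborel_fubini_snd(1)[OF int[OF that]] fst_conv snd_conv
    by (simp only: mult.assoc integral_mult_right_zero)
  show "((\<lambda>e. LINT p|lborel. (case p of (z, s) \<Rightarrow> \<rho> (e *\<^sub>R s) * osc (case (z, s) of (z, s) \<Rightarrow> s * \<tau> z) *
      (case (z, s) of (z, s) \<Rightarrow> b s * r z) * w z)) \<longlongrightarrow> (LINT s|lborel. b s * ?m s)) (at_right 0)"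
    unfolding tendsto_at_iff_sequentially comp_def
  proof (intro allI impI)
    fix X :: "nat \<Rightarrow> real" assume X: "\<forall>i. X i \<in> {0<..} - {0}" "X \<longlonglongrightarrow> 0"
    have "(\<lambda>i. LINT s|lborel. \<rho> (X i * s) * (b s * ?m s)) \<longlonglongrightarrow> (LINT s|lborel. b s * ?m s)"
    proof (rule integral_dominated_convergence)
      show "integrable lborel (\<lambda>s. C * norm (b s * ?m s))"
        by (intro integrable_mult_right integrable_norm bm)
      show "(\<lambda>s. \<rho> (X i * s) * (b s * ?m s)) \<in> borel_measurable lborel" for i
        by (rule borel_measurable_times[OF _ borel_measurable_integrable[OF bm]])
          (use borel_measurable_continuous_onI[OF cont_eps] in simp)
      show "AE s in lborel. (\<lambda>i. \<rho> (X i * s) * (b s * ?m s)) \<longlonglongrightarrow> b s * ?m s"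
      proof (rule AE_I2)
        fix s
        have "isCont \<rho> 0" using cont continuous_on_eq_continuous_at open_UNIV by blast
        moreover have "(\<lambda>i. X i * s) \<longlonglongrightarrow> 0" using tendsto_mult_left_zero[OF X(2)] .
        ultimately have "(\<lambda>i. \<rho> (X i * s)) \<longlonglongrightarrow> \<rho> 0"
          by (rule isCont_tendsto_compose)
        then have "(\<lambda>i. \<rho> (X i * s) * (b s * ?m s)) \<longlonglongrightarrow> \<rho> 0 * (b s * ?m s)"
          by (rule tendsto_mult_right)
        then show "(\<lambda>i. \<rho> (X i * s) * (b s * ?m s)) \<longlonglongrightarrow> b s * ?m s"
          unfolding \<rho>0 by simp
      qed
      show "AE s in lborel. norm (\<rho> (X i * s) * (b s * ?m s)) \<le> C * norm (b s * ?m s)" for i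
        by (rule AE_I2, subst norm_mult) (intro mult_right_mono C norm_ge_zero)
    qed (use bm in auto)
    moreover have "X i > 0" for i using X(1) by auto
    ultimately show "(\<lambda>i. LINT p|lborel. (case p of (z, s) \<Rightarrow> \<rho> (X i *\<^sub>R s) * osc (case (z, s) of (z, s) \<Rightarrow> s * \<tau> z) *
      (case (z, s) of (z, s) \<Rightarrow> b s * r z) * w z)) \<longlonglongrightarrow> (LINT s|lborel. b s * ?m s)"
      using val by simp
  qed
qed

section \<open>Decay of the Fourier transform in one variable\<close>

definition time_fourier :: "('y::euclidean_space \<times> real \<Rightarrow> complex) \<Rightarrow> 'y \<times> real \<Rightarrow> complex" where
  "time_fourier g p = (LINT t|lborel. g (fst p, t) * osc (snd p * t))"

lemma slice_integrable:
  fixes g :: "'y::euclidean_space \<times> real \<Rightarrow> complex"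
  assumes "continuous_on UNIV g" "compact K" "\<And>p. p \<notin> K \<Longrightarrow> g p = 0"
  shows "integrable lborel (\<lambda>t. g (y, t) * osc (s * t))"
proof (rule compactly_supported_integrable)
  show "continuous_on UNIV (\<lambda>t. g (y, t) * osc (s * t))"
    by (intro continuous_intros continuous_on_compose2[OF assms(1)]) auto
  show "compact (snd ` K)"
    by (rule compact_continuous_image[OF continuous_on_snd[OF continuous_on_id] assms(2)])
  show "g (y, t) * osc (s * t) = 0" if "t \<notin> snd ` K" for t
    using assms(3)[of "(y, t)"] that by force
qed

lemma time_fourier_measurable:
  fixes g :: "'y::euclidean_space \<times> real \<Rightarrow> complex"
  assumes "continuous_on UNIV g"
  shows "time_fourier g \<in> borel_measurable borel"
proof -
  have "(\<lambda>q. g (fst (fst q), snd q) * osc (snd (fst q) * snd q)) \<in>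
      borel_measurable (borel :: (('y \<times> real) \<times> real) measure)"
    by (intro borel_measurable_continuous_onI continuous_intros continuous_on_compose2[OF assms]) auto
  then have "case_prod (\<lambda>p t. g (fst p, t) * osc (snd p * t)) \<in>
      borel_measurable (lborel \<Otimes>\<^sub>M (lborel :: real measure))"
    by (simp add: lborel_prod case_prod_unfold)
  then show ?thesis
    unfolding time_fourier_def[abs_def]
    using lborel.borel_measurable_lebesgue_integral[of "\<lambda>p t. g (fst p, t) * osc (snd p * t)" lborel]
    by simp
qed

text \<open>Integration by parts in the last variable; the boundary terms vanish outside the support of \<open>g\<close>.\<close>

lemma time_fourier_derivative:
  fixes g :: "'y::euclidean_space \<times> real \<Rightarrow> complex"
  assumes g: "Ck_on (Suc 0) UNIV g" and K: "compact K" "\<And>p. p \<notin> K \<Longrightarrow> g p = 0"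
  shows "time_fourier (\<lambda>p. frechet_derivative g (at p) (0, 1)) p = - \<i> * of_real (snd p) * time_fourier g p"
proof -
  obtain y s where p: "p = (y, s)" by (cases p)
  let ?g' = "\<lambda>p. frechet_derivative g (at p) (0, 1)"
  have cont: "continuous_on UNIV g" "continuous_on UNIV ?g'"
    using Ck_on_imp_continuous_on[OF g] g by auto
  have K': "?g' p = 0" if "p \<notin> K" for p
    using iter_deriv_eq_0[of K g p "[(0, 1)]"] K compact_imp_closed that by auto
  have "bounded (snd ` K)"
    by (rule compact_imp_bounded[OF compact_continuous_image[OF continuous_on_snd[OF continuous_on_id] K(1)]])
  then obtain T' where T': "\<forall>t\<in>snd ` K. norm t \<le> T'"
    unfolding bounded_iff by blast
  \<comment> \<open>one unit of room, so that the endpoints lie outside the support\<close>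
  define T where "T = \<bar>T'\<bar> + 1"
  have out: "q \<notin> K" if "T \<le> \<bar>snd q\<bar>" for q
  proof
    assume "q \<in> K"
    then have "\<bar>snd q\<bar> \<le> T'" using T' by fastforce
    with that show False by (simp add: T_def)
  qed
  let ?F = "\<lambda>t. g (y, t) * osc (s * t)"
  let ?f = "\<lambda>t. ?g' (y, t) * osc (s * t) + \<i> * of_real s * ?F t"
  have "has_bochner_integral lborel (\<lambda>t. indicator {-T..T} t *\<^sub>R ?f t) (?F T - ?F (-T))"
  proof (rule has_bochner_integral_FTC_Icc)
    show "-T \<le> T" by (simp add: T_def)
    fix t
    have "((\<lambda>t. (y, t)) has_derivative (\<lambda>h. (0, h))) (at t within {-T..T})"
      by (auto intro!: derivative_eq_intros)
    from has_derivative_compose[OF this Ck_on_has_derivative[OF g UNIV_I]]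
    have "((\<lambda>t. g (y, t)) has_derivative (\<lambda>h. frechet_derivative g (at (y, t)) (0, h))) (at t within {-T..T})" .
    moreover have "(\<lambda>h. frechet_derivative g (at (y, t)) (0, h)) = (\<lambda>h. h *\<^sub>R ?g' (y, t))"
    proof
      fix h
      have "linear (frechet_derivative g (at (y, t)))"
        using g by (intro linear_frechet_derivative) auto
      from linear_scale[OF this, of h "(0, 1)"]
      show "frechet_derivative g (at (y, t)) (0, h) = h *\<^sub>R ?g' (y, t)" by simp
    qed
    ultimately have "((\<lambda>t. g (y, t)) has_vector_derivative ?g' (y, t)) (at t within {-T..T})"
      unfolding has_vector_derivative_def by (simp only:)
    moreover have "((\<lambda>z. exp (\<i> * (of_real s * z))) has_field_derivative
        (\<i> * of_real s) * exp (\<i> * (of_real s * of_real t))) (at (of_real t))"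
      by (auto intro!: derivative_eq_intros)
    from has_vector_derivative_real_field[OF this]
    have "((\<lambda>t. osc (s * t)) has_vector_derivative
        (\<i> * of_real s) * osc (s * t)) (at t within {-T..T})"
      by simp
    ultimately show "(?F has_vector_derivative ?f t) (at t within {-T..T})"
      by (rule has_vector_derivative_eq_rhs[OF has_vector_derivative_mult]) (simp add: algebra_simps)
  next
    show "continuous_on {-T..T} ?f"
      by (intro continuous_intros continuous_on_compose2[OF cont(1)] continuous_on_compose2[OF cont(2)]) auto
  qed
  moreover have "?F T = 0" "?F (- T) = 0"
    using K(2) out by (auto simp: T_def)
  moreover have "(\<lambda>t. indicator {-T..T} t *\<^sub>R ?f t) = ?f"
  proof
    fix t show "indicator {-T..T} t *\<^sub>R ?f t = ?f t"
      using K(2)[OF out[of "(y, t)"]] K'[OF out[of "(y, t)"]] by (auto split: split_indicator)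
  qed
  ultimately have "(LINT t|lborel. ?f t) = 0"
    by (simp add: has_bochner_integral_iff)
  moreover have "(LINT t|lborel. ?f t) = time_fourier ?g' p + \<i> * of_real s * time_fourier g p"
    unfolding time_fourier_def p fst_conv snd_conv
    using slice_integrable[OF cont(1) K] slice_integrable[OF cont(2) K(1) K']
    by (subst Bochner_Integration.integral_add) auto
  ultimately show ?thesis
    by (simp add: p add_eq_0_iff)
qed

text \<open>Every power of the frequency trades for a derivative in the last variable.  The bound is
  expressed by the seminorms that occur in the continuity of distributions.\<close>

lemma time_fourier_decay:
  fixes g :: "'y::euclidean_space \<times> real \<Rightarrow> complex"
  assumes g: "\<And>k. Ck_on k UNIV g" and K: "compact K" "\<And>p. p \<notin> K \<Longrightarrow> g p = 0"
    and T: "\<And>p. p \<in> K \<Longrightarrow> \<bar>snd p\<bar> \<le> T" "T \<ge> 0"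
  shows "\<bar>snd p\<bar> ^ N * norm (time_fourier g p) \<le> 2 * T * Ck_seminorm N K g"
proof -
  have K': "iter_deriv vs g p = 0" if "p \<notin> K" for p vs
    using iter_deriv_eq_0[of K g p vs] K compact_imp_closed that by auto
  have C: "Ck_on k UNIV (iter_deriv vs g)" for k vs
    by (rule Ck_on_iter_deriv[OF g])
  have "norm (time_fourier (iter_deriv (replicate N (0, 1)) g) p) = \<bar>snd p\<bar> ^ N * norm (time_fourier g p)"
  proof (induction N)
    case (Suc N)
    show ?case
      using time_fourier_derivative[OF C K(1) K', of "replicate N (0, 1)" p] Suc by (simp add: norm_mult)
  qed simp
  moreover have "norm (time_fourier (iter_deriv (replicate N (0, 1)) g) p) \<le> 2 * T * Ck_seminorm N K g"
  proof -
    let ?h = "iter_deriv (replicate N (0, 1)) g"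
    have sm: "smooth_on K g"
      using g by (auto simp: smooth_on_def)
    have cont: "continuous_on UNIV ?h" by (rule Ck_on_imp_continuous_on[OF C[of 0]])
    have le: "norm (?h q) \<le> Ck_seminorm N K g" if "q \<in> K" for q
      by (rule iter_deriv_le_Ck_seminorm[OF K(1) sm that]) (auto simp: Basis_prod_def set_replicate_conv_if)
    have "norm (time_fourier ?h p) \<le> (LINT t|lborel. norm (?h (fst p, t) * osc (snd p * t)))"
      unfolding time_fourier_def by (rule integral_norm_bound)
    also have "\<dots> \<le> (LINT t|lborel. indicator {-T..T} t * Ck_seminorm N K g)"
    proof (rule integral_mono)
      show "integrable lborel (\<lambda>t. norm (?h (fst p, t) * osc (snd p * t)))"
        by (intro integrable_norm slice_integrable[OF cont K(1) K'])
      show "integrable lborel (\<lambda>t. indicator {-T..T} t * Ck_seminorm N K g :: real)"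
        using emeasure_compact_finite[OF compact_Icc[of "-T" T]]
        by (intro integrable_mult_left integrable_real_indicator) auto
      show "norm (?h (fst p, t) * osc (snd p * t)) \<le> indicator {-T..T} t * Ck_seminorm N K g" for t
      proof (cases "(fst p, t) \<in> K")
        case True
        then have "t \<in> {-T..T}" using T(1)[OF True] by auto
        then show ?thesis using le[OF True] by (simp add: norm_mult)
      next
        case False
        then show ?thesis using K'[OF False] Ck_seminorm_nonneg[OF K(1) sm] by simp
      qed
    qed
    also have "\<dots> = 2 * T * Ck_seminorm N K g"
      using T(2) by simp
    finally show ?thesis .
  qed
  ultimately show ?thesis by simp
qed


section \<open>Evaluation of the operator and of its pairing with functions\<close>

lemma compactly_supported_time_bound:
  fixes K :: "('y::euclidean_space \<times> real) set"
  assumes "compact K"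
  obtains T where "T \<ge> 0" "\<And>p. p \<in> K \<Longrightarrow> \<bar>snd p\<bar> \<le> T"
proof -
  have "bounded (snd ` K)"
    by (rule compact_imp_bounded[OF compact_continuous_image[OF continuous_on_snd[OF continuous_on_id] assms]])
  then obtain T' where "\<forall>t\<in>snd ` K. norm t \<le> T'"
    unfolding bounded_iff by blast
  then have "\<bar>snd p\<bar> \<le> max T' 0" if "p \<in> K" for p
    using that by (force simp: le_max_iff_disj)
  then show ?thesis using that[of "max T' 0"] by simp
qed

text \<open>The function \<open>H\<close> of \<open>param_osc\<close> that results from an amplitude factor \<open>b\<close> and a test function \<open>g\<close>.\<close>

definition freq_amp :: "(real \<Rightarrow> complex) \<Rightarrow> ('y::euclidean_space \<times> real \<Rightarrow> complex) \<Rightarrow> 'y \<times> real \<Rightarrow> complex" where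
  "freq_amp b g p = b (snd p) * time_fourier g p"

lemma freq_amp_bound:
  fixes g :: "'y::euclidean_space \<times> real \<Rightarrow> complex"
  assumes g: "\<And>k. Ck_on k UNIV g" and K: "compact K" "\<And>p. p \<notin> K \<Longrightarrow> g p = 0"
    and T: "T \<ge> 0" "\<And>p. p \<in> K \<Longrightarrow> \<bar>snd p\<bar> \<le> T"
    and b: "\<And>s. norm (b s) \<le> 2 * \<bar>s\<bar>"
  shows "\<bar>snd p\<bar> ^ N * norm (freq_amp b g p) \<le> 4 * T * Ck_seminorm (Suc N) K g"
proof -
  have "\<bar>snd p\<bar> ^ N * norm (freq_amp b g p) \<le> \<bar>snd p\<bar> ^ N * (2 * \<bar>snd p\<bar> * norm (time_fourier g p))"
    unfolding freq_amp_def norm_mult by (intro mult_left_mono mult_right_mono b) auto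
  also have "\<dots> = 2 * (\<bar>snd p\<bar> ^ Suc N * norm (time_fourier g p))" by simp
  also have "\<dots> \<le> 2 * (2 * T * Ck_seminorm (Suc N) K g)"
    by (intro mult_left_mono time_fourier_decay[OF g K T(2,1)]) auto
  finally show ?thesis by simp
qed

lemma rapidly_decreasing_freq_amp:
  fixes g :: "'y::euclidean_space \<times> real \<Rightarrow> complex"
  assumes g: "\<And>k. Ck_on k UNIV g" and K: "compact K" "\<And>p. p \<notin> K \<Longrightarrow> g p = 0"
    and b: "continuous_on UNIV b" "\<And>s. norm (b s) \<le> 2 * \<bar>s\<bar>"
  shows "rapidly_decreasing (fst ` K) (freq_amp b g)"
  unfolding rapidly_decreasing_def
proof (intro conjI allI impI)
  have "(\<lambda>p :: 'y \<times> real. b (snd p)) \<in> borel_measurable borel"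
    by (intro borel_measurable_continuous_onI continuous_on_compose2[OF b(1)] continuous_intros) auto
  moreover have "time_fourier g \<in> borel_measurable borel"
    by (rule time_fourier_measurable[OF Ck_on_imp_continuous_on[OF g]])
  ultimately show "freq_amp b g \<in> borel_measurable borel"
    unfolding freq_amp_def[abs_def] by (rule borel_measurable_times)
  show "freq_amp b g p = 0" if "fst p \<notin> fst ` K" for p
  proof -
    have "(fst p, t) \<notin> K" for t using that by (metis fst_conv imageI)
    then have "g (fst p, t) = 0" for t using K(2) by simp
    then show ?thesis by (simp add: freq_amp_def time_fourier_def)
  qed
  obtain T where "T \<ge> 0" "\<And>p. p \<in> K \<Longrightarrow> \<bar>snd p\<bar> \<le> T"
    using compactly_supported_time_bound[OF K(1)] by blast
  from freq_amp_bound[OF g K this b(2)]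
  show "\<exists>C. \<forall>p. \<bar>snd p\<bar> ^ N * norm (freq_amp b g p) \<le> C" for N
    by blast
qed

context
  fixes r :: "'x::euclidean_space \<times> 'y::euclidean_space \<Rightarrow> complex" and Q :: "'x \<times> 'y \<Rightarrow> real"
    and g :: "'y \<times> real \<Rightarrow> complex" and K :: "('y \<times> real) set"
  assumes r: "continuous_on UNIV r" and Q: "continuous_on UNIV Q"
    and g: "\<And>k. Ck_on k UNIV g" and K: "compact K" "\<And>p. p \<notin> K \<Longrightarrow> g p = 0"
begin

lemma cont_g: "continuous_on UNIV g"
  by (rule Ck_on_imp_continuous_on[OF g])

lemma compact_fst_K: "compact (fst ` K)" and compact_snd_K: "compact (snd ` K)"
  by (auto intro!: compact_continuous_image K continuous_intros)

text \<open>The phase is affine in the time variable, so integrating it out first leaves a Fourier transform.\<close>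

lemma space_integral_eq:
  "(LINT z|lborel. r (x, fst z) * g z * osc (s * (snd z - Q (x, fst z)))) =
    (LINT y|lborel. r (x, y) * osc (s * - Q (x, y)) * time_fourier g (y, s))"
proof -
  have "integrable lborel (\<lambda>z. r (x, fst z) * g z * osc (s * (snd z - Q (x, fst z))))"
  proof (rule compactly_supported_integrable[OF _ K(1)])
    show "continuous_on UNIV (\<lambda>z. r (x, fst z) * g z * osc (s * (snd z - Q (x, fst z))))"
      by (intro continuous_intros cont_g continuous_on_compose2[OF r] continuous_on_compose2[OF Q]) auto
  qed (simp add: K(2))
  note lborel_fubini_fst(1)[OF this]
  moreover have "r (x, y) * g (y, t) * osc (s * (t - Q (x, y))) =
      (r (x, y) * osc (s * - Q (x, y))) * (g (y, t) * osc (s * t))" for y t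
    by (simp add: mult_exp_exp algebra_simps flip: exp_add)
  ultimately show ?thesis
    by (simp only: fst_conv snd_conv time_fourier_def integral_mult_right_zero)
qed

lemma param_osc_freq_amp_integrable:
  assumes b: "continuous_on UNIV b" "\<And>s. norm (b s) \<le> 2 * \<bar>s\<bar>"
  shows "integrable lborel (\<lambda>p. freq_amp b g p * r (x, fst p) * osc (snd p * - Q (x, fst p)))"
  by (intro param_osc_integrand_integrable[OF compact_fst_K rapidly_decreasing_freq_amp[OF g K b]]
      continuous_intros continuous_on_compose2[OF r] continuous_on_compose2[OF Q]) auto

text \<open>The functions \<open>r\<close> and \<open>Q\<close> need only be continuous here, so the oscillatory integral exists for every
  \<open>x\<close>, also on the half sphere; smoothness matters only for its dependence on \<open>x\<close>.\<close>

lemma has_osc_integral_param_osc: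
  assumes b: "continuous_on UNIV b" "\<And>s. norm (b s) \<le> 2 * \<bar>s\<bar>"
  shows "has_osc_integral (\<lambda>(z, s). s * (snd z - Q (x, fst z))) (\<lambda>(z, s). b s * r (x, fst z)) g
    (param_osc (freq_amp b g) r (\<lambda>p. - Q p) x)"
proof -
  let ?m = "\<lambda>s. LINT z|lborel. r (x, fst z) * g z * osc (s * (snd z - Q (x, fst z)))"
  let ?F = "\<lambda>p. freq_amp b g p * r (x, fst p) * osc (snd p * - Q (x, fst p))"
  have F: "(LINT y|lborel. ?F (y, s)) = b s * ?m s" for s
    unfolding space_integral_eq freq_amp_def
    by (subst integral_mult_right_zero[symmetric]) (simp add: mult_ac)
  note int = param_osc_freq_amp_integrable[OF b, of x]
  have val: "param_osc (freq_amp b g) r (\<lambda>p. - Q p) x = (LINT s|lborel. b s * ?m s)"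
    unfolding param_osc_def lborel_fubini_snd(1)[OF int] F ..
  show ?thesis
    unfolding val
  proof (rule has_osc_integral_linear_phase[OF _ _ b(1)])
    show "(\<lambda>z. snd z - Q (x, fst z)) \<in> borel_measurable borel"
      by (intro borel_measurable_continuous_onI continuous_intros continuous_on_compose2[OF Q]) auto
    show "integrable lborel (\<lambda>z. r (x, fst z) * g z)"
    proof (rule compactly_supported_integrable[OF _ K(1)])
      show "continuous_on UNIV (\<lambda>z. r (x, fst z) * g z)"
        by (intro continuous_intros cont_g continuous_on_compose2[OF r]) auto
    qed (simp add: K(2))
    show "integrable lborel (\<lambda>s. b s * ?m s)"
      using lborel_fubini_snd(2)[OF int] unfolding F .
  qed
qed

context
  fixes h :: "'x \<Rightarrow> complex" and L :: "'x set"
  assumes h: "continuous_on UNIV h" and L: "compact L" "\<And>x. x \<notin> L \<Longrightarrow> h x = 0"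
begin

abbreviation (input) double_weight :: "('y \<times> real) \<times> 'x \<Rightarrow> complex" where
  "double_weight \<equiv> \<lambda>z. r (snd z, fst (fst z)) * (g (fst z) * h (snd z))"

abbreviation (input) double_phase :: "('y \<times> real) \<times> 'x \<Rightarrow> real" where
  "double_phase \<equiv> \<lambda>z. snd (fst z) - Q (snd z, fst (fst z))"

abbreviation (input) double_mean :: "real \<Rightarrow> complex" where
  "double_mean \<equiv> \<lambda>s. LINT z|lborel. double_weight z * osc (s * double_phase z)"

lemma double_weight_integrable: "integrable lborel double_weight"
proof (rule compactly_supported_integrable)
  show "continuous_on UNIV double_weight"
    by (intro continuous_intros continuous_on_compose2[OF cont_g] continuous_on_compose2[OF h]
        continuous_on_compose2[OF r]) auto
  show "compact (K \<times> L)" by (intro compact_Times K L)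
  show "double_weight z = 0" if "z \<notin> K \<times> L" for z
    using that by (cases "fst z \<in> K") (auto simp: K(2) L(2) mem_Times_iff)
qed

lemma double_phase_measurable: "double_phase \<in> borel_measurable borel"
  by (intro borel_measurable_continuous_onI continuous_intros continuous_on_compose2[OF Q]) auto

text \<open>The iterated integral over \<open>x\<close>, \<open>y\<close> and the time is regrouped so that the time comes first.\<close>

lemma double_mean_eq:
  "double_mean s = (LINT q|lborel. h (fst q) * (r q * osc (s * - Q q) * time_fourier g (snd q, s)))"
proof -
  have "integrable lborel (\<lambda>z. double_weight z * osc (s * double_phase z))"
  proof (rule compactly_supported_integrable)
    show "continuous_on UNIV (\<lambda>z. double_weight z * osc (s * double_phase z))"
      by (intro continuous_intros continuous_on_compose2[OF cont_g] continuous_on_compose2[OF h]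
          continuous_on_compose2[OF r] continuous_on_compose2[OF Q]) auto
    show "compact (K \<times> L)" by (intro compact_Times K L)
    show "double_weight z * osc (s * double_phase z) = 0" if "z \<notin> K \<times> L" for z
      using that by (cases "fst z \<in> K") (auto simp: K(2) L(2) mem_Times_iff)
  qed
  note lborel_fubini_snd(1)[OF this]
  also have "(LINT x|lborel. LINT u|lborel. double_weight (u, x) * osc (s * double_phase (u, x))) =
      (LINT x|lborel. h x * (LINT z|lborel. r (x, fst z) * g z * osc (s * (snd z - Q (x, fst z)))))"
    unfolding integral_mult_right_zero[symmetric] by (simp add: mult_ac)
  also have "\<dots> = (LINT x|lborel. LINT y|lborel. h x * (r (x, y) * osc (s * - Q (x, y)) * time_fourier g (y, s)))"
    unfolding space_integral_eq integral_mult_right_zero ..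
  also have "\<dots> = (LINT q|lborel. h (fst q) * (r q * osc (s * - Q q) * time_fourier g (snd q, s)))"
  proof -
    let ?f = "\<lambda>w :: ('x \<times> 'y) \<times> real. h (fst (fst w)) * (r (fst w) * osc (s * - Q (fst w))) *
        (g (snd (fst w), snd w) * osc (s * snd w))"
    have "integrable lborel ?f"
    proof (rule compactly_supported_integrable)
      show "continuous_on UNIV ?f"
        by (intro continuous_intros continuous_on_compose2[OF cont_g] continuous_on_compose2[OF h]
            continuous_on_compose2[OF r] continuous_on_compose2[OF Q]) auto
      show "compact ((L \<times> fst ` K) \<times> snd ` K)" by (intro compact_Times L compact_fst_K compact_snd_K)
      show "?f w = 0" if "w \<notin> (L \<times> fst ` K) \<times> snd ` K" for w
      proof (cases "fst (fst w) \<in> L")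
        case True
        then have "(snd (fst w), snd w) \<notin> K" using that by (force simp: mem_Times_iff)
        then show ?thesis by (simp add: K(2))
      qed (simp add: L(2))
    qed
    from lborel_fubini_fst(2)[OF this]
    have "integrable lborel (\<lambda>q. h (fst q) * (r q * osc (s * - Q q) * time_fourier g (snd q, s)))"
      unfolding time_fourier_def by (simp add: mult.assoc)
    from lborel_fubini_fst(1)[OF this] show ?thesis by simp
  qed
  finally show ?thesis .
qed

text \<open>Fubini for the triple integral over \<open>x\<close>, \<open>y\<close> and the frequency.  It converges absolutely because the
  product of \<open>h\<close> with \<open>freq_amp b g\<close> is rapidly decreasing with \<open>(x, y)\<close> as space variable.\<close>

lemma double_mean_integral:
  assumes b: "continuous_on UNIV b" "\<And>s. norm (b s) \<le> 2 * \<bar>s\<bar>"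
  shows "integrable lborel (\<lambda>s. b s * double_mean s)"
    and "(LINT s|lborel. b s * double_mean s) =
      (LINT x|lborel. h x * param_osc (freq_amp b g) r (\<lambda>p. - Q p) x)"
proof -
  let ?H = "\<lambda>q :: ('x \<times> 'y) \<times> real. h (fst (fst q)) * freq_amp b g (snd (fst q), snd q)"
  let ?G = "\<lambda>q :: ('x \<times> 'y) \<times> real. ?H q * r (fst q) * osc (snd q * - Q (fst q))"
  note rd = rapidly_decreasing_freq_amp[OF g K b]
  obtain Ch where Ch: "Ch \<ge> 0" "\<And>x. norm (h x) \<le> Ch"
    using compactly_supported_bounded[OF h L] by blast
  have "rapidly_decreasing (L \<times> fst ` K) ?H"
    unfolding rapidly_decreasing_def
  proof (intro conjI allI impI)
    have [measurable]: "freq_amp b g \<in> borel_measurable borel" "h \<in> borel_measurable borel"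
      using rd borel_measurable_continuous_onI[OF h] by (auto simp: rapidly_decreasing_def)
    have [measurable]: "(\<lambda>q :: ('x \<times> 'y) \<times> real. (snd (fst q), snd q)) \<in> borel_measurable borel"
      "(\<lambda>q :: ('x \<times> 'y) \<times> real. fst (fst q)) \<in> borel_measurable borel"
      by (auto intro!: borel_measurable_continuous_onI continuous_intros)
    show "?H \<in> borel_measurable borel" by measurable
    show "?H p = 0" if "fst p \<notin> L \<times> fst ` K" for p
      using that L(2) rapidly_decreasing_outside[OF rd, of "(snd (fst p), snd p)"]
      by (cases "fst (fst p) \<in> L") (auto simp: mem_Times_iff)
    fix N
    obtain C where C: "\<And>p. \<bar>snd p\<bar> ^ N * norm (freq_amp b g p) \<le> C"
      using rd unfolding rapidly_decreasing_def by blast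
    have "\<bar>snd p\<bar> ^ N * norm (?H p) \<le> Ch * C" for p
    proof -
      have "\<bar>snd p\<bar> ^ N * norm (?H p) = norm (h (fst (fst p))) * (\<bar>snd p\<bar> ^ N * norm (freq_amp b g (snd (fst p), snd p)))"
        by (simp add: norm_mult)
      also have "\<dots> \<le> Ch * C"
        using C[of "(snd (fst p), snd p)"] by (intro mult_mono Ch) auto
      finally show ?thesis .
    qed
    then show "\<exists>C. \<forall>p. \<bar>snd p\<bar> ^ N * norm (?H p) \<le> C" by blast
  qed
  then have G: "integrable lborel ?G"
    by (intro param_osc_integrand_integrable[of "L \<times> fst ` K"] compact_Times L(1) compact_fst_K
        continuous_on_subset[OF r subset_UNIV] continuous_on_minus continuous_on_subset[OF Q subset_UNIV])
  have eq: "(LINT q|lborel. ?G (q, s)) = b s * double_mean s" for s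
    unfolding double_mean_eq freq_amp_def
    by (subst integral_mult_right_zero[symmetric]) (simp add: mult_ac)
  show "integrable lborel (\<lambda>s. b s * double_mean s)"
    using lborel_fubini_snd(2)[OF G] unfolding eq .
  have "(LINT s|lborel. b s * double_mean s) = (LINT q|lborel. ?G q)"
    using lborel_fubini_snd(1)[OF G] unfolding eq by simp
  also have "\<dots> = (LINT x|lborel. LINT y|lborel. LINT s|lborel. ?G ((x, y), s))"
    unfolding lborel_fubini_fst(1)[OF G] lborel_fubini_fst(1)[OF lborel_fubini_fst(2)[OF G]] ..
  also have "\<dots> = (LINT x|lborel. h x * param_osc (freq_amp b g) r (\<lambda>p. - Q p) x)"
  proof (rule Bochner_Integration.integral_cong[OF refl])
    fix x
    show "(LINT y|lborel. LINT s|lborel. ?G ((x, y), s)) = h x * param_osc (freq_amp b g) r (\<lambda>p. - Q p) x"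
      unfolding param_osc_def lborel_fubini_fst(1)[OF param_osc_freq_amp_integrable[OF b]]
      unfolding integral_mult_right_zero[symmetric] by (simp add: mult_ac)
  qed
  finally show "(LINT s|lborel. b s * double_mean s) =
      (LINT x|lborel. h x * param_osc (freq_amp b g) r (\<lambda>p. - Q p) x)" .
qed

text \<open>The low frequencies, those in the support of the amplitude \<open>b2\<close>, contribute a kernel given
  by a convergent integral.\<close>

lemma pairing_split:
  assumes b1: "continuous_on UNIV b1" "\<And>s. norm (b1 s) \<le> 2 * \<bar>s\<bar>"
    and b2: "continuous_on UNIV b2" "\<And>s. norm (b2 s) \<le> 2 * \<bar>s\<bar>" "integrable lborel b2"
    and b: "\<And>s. b s = b1 s + b2 s" "\<And>s. norm (b s) \<le> 2 * \<bar>s\<bar>"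
  shows "has_osc_integral (\<lambda>(z, s). s * double_phase z) (\<lambda>(z, s). b1 s * r (snd z, fst (fst z)))
      (\<lambda>z. g (fst z) * h (snd z)) (LINT s|lborel. b1 s * double_mean s)"
    and "(LINT x|lborel. h x * param_osc (freq_amp b g) r (\<lambda>p. - Q p) x) =
      (LINT s|lborel. b1 s * double_mean s) +
      (LINT z|lborel. (LINT s|lborel. b2 s * osc (s * double_phase z)) * double_weight z)"
proof -
  show "has_osc_integral (\<lambda>(z, s). s * double_phase z) (\<lambda>(z, s). b1 s * r (snd z, fst (fst z)))
      (\<lambda>z. g (fst z) * h (snd z)) (LINT s|lborel. b1 s * double_mean s)"
    by (rule has_osc_integral_linear_phase[OF double_phase_measurable double_weight_integrable b1(1)
          double_mean_integral(1)[OF b1]])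
  have "continuous_on UNIV b"
    unfolding b(1)[abs_def] by (intro continuous_intros b1 b2)
  from double_mean_integral(2)[OF this b(2)]
  have "(LINT x|lborel. h x * param_osc (freq_amp b g) r (\<lambda>p. - Q p) x) =
      (LINT s|lborel. b1 s * double_mean s + b2 s * double_mean s)"
    unfolding b(1) by (simp add: distrib_right)
  also have "\<dots> = (LINT s|lborel. b1 s * double_mean s) + (LINT s|lborel. b2 s * double_mean s)"
    by (rule Bochner_Integration.integral_add[OF double_mean_integral(1)[OF b1] double_mean_integral(1)[OF b2(1,2)]])
  also have "(LINT s|lborel. b2 s * double_mean s) =
      (LINT z|lborel. (LINT s|lborel. b2 s * osc (s * double_phase z)) * double_weight z)"
  proof -
    note int = integrable_damped_osc[OF double_phase_measurable double_weight_integrable b2(3)]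
    have "(LINT s|lborel. b2 s * double_mean s) =
        (LINT s|lborel. LINT z|lborel. b2 s * double_weight z * osc (s * double_phase z))"
      by (simp only: mult.assoc integral_mult_right_zero)
    also have "\<dots> = (LINT z|lborel. LINT s|lborel. b2 s * double_weight z * osc (s * double_phase z))"
      using lborel_fubini_fst(1)[OF int] lborel_fubini_snd(1)[OF int] by simp
    also have "\<dots> = (LINT z|lborel. (LINT s|lborel. b2 s * osc (s * double_phase z)) * double_weight z)"
      unfolding integral_mult_left_zero[symmetric] by (simp only: mult_ac)
    finally show ?thesis .
  qed
  finally show "(LINT x|lborel. h x * param_osc (freq_amp b g) r (\<lambda>p. - Q p) x) =
      (LINT s|lborel. b1 s * double_mean s) +
      (LINT z|lborel. (LINT s|lborel. b2 s * osc (s * double_phase z)) * double_weight z)" .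
qed

end

end

text \<open>Bounded frequencies produce no singularities: this is the smoothing kernel left over from the
  part of the amplitude near frequency zero.\<close>

lemma Ck_on_compact_frequency_integral:
  fixes r :: "'z::euclidean_space \<Rightarrow> complex" and \<tau> :: "'z \<Rightarrow> real"
  assumes S: "open S" and r: "\<And>k. Ck_on k S r" and \<tau>: "\<And>k. Ck_on k S \<tau>"
    and b: "continuous_on UNIV b" "\<And>s. B \<le> \<bar>s\<bar> \<Longrightarrow> b s = 0"
  shows "Ck_on k S (\<lambda>z. (LINT s|lborel. b s * osc (s * \<tau> z)) * r z)"
proof -
  have supp: "b s = 0" if "s \<notin> {-\<bar>B\<bar>..\<bar>B\<bar>}" for s
    using b(2)[of s] that by auto
  obtain C where C: "C \<ge> 0" "\<And>s. norm (b s) \<le> C"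
    using compactly_supported_bounded[OF b(1) compact_Icc supp] by blast
  have bint: "integrable lborel b"
    by (rule compactly_supported_integrable[OF b(1) compact_Icc supp])
  \<comment> \<open>a dummy space variable in the unit interval makes this a special case of \<open>param_osc\<close>\<close>
  let ?H = "\<lambda>p :: real \<times> real. indicator {0..1} (fst p) * b (snd p)"
  have "rapidly_decreasing {0..1} ?H"
    unfolding rapidly_decreasing_def
  proof (intro conjI allI impI)
    have [measurable]: "b \<in> borel_measurable borel" by (rule borel_measurable_continuous_onI[OF b(1)])
    have [measurable]: "(fst :: real \<times> real \<Rightarrow> real) \<in> borel_measurable borel"
      "(snd :: real \<times> real \<Rightarrow> real) \<in> borel_measurable borel"
      by (auto intro!: borel_measurable_continuous_onI continuous_intros)
    show "?H \<in> borel_measurable borel" by measurable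
    fix N
    have "\<bar>snd p\<bar> ^ N * norm (?H p) \<le> \<bar>B\<bar> ^ N * C" for p
    proof (cases "snd p \<in> {-\<bar>B\<bar>..\<bar>B\<bar>}")
      case True
      then have "\<bar>snd p\<bar> \<le> \<bar>B\<bar>" by auto
      then show ?thesis
        using C by (intro mult_mono power_mono) (auto simp: norm_mult split: split_indicator)
    qed (use supp C in simp)
    then show "\<exists>C. \<forall>p. \<bar>snd p\<bar> ^ N * norm (?H p) \<le> C" by blast
  qed simp
  then have "Ck_on k S (param_osc ?H (\<lambda>p. r (fst p)) (\<lambda>p. \<tau> (fst p)))"
  proof (rule Ck_on_param_osc[of "S \<times> UNIV", rotated 5])
    show "Ck_on k (S \<times> UNIV) (\<lambda>p. r (fst p))" "Ck_on k (S \<times> UNIV) (\<lambda>p. \<tau> (fst p))" for k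
      by (rule Ck_on_compose[of "S \<times> UNIV" S]; use S r \<tau> in \<open>auto intro!: open_Times Ck_on_linear bounded_linear_fst\<close>)+
  qed (use S in \<open>auto intro: open_Times\<close>)
  moreover have eq: "param_osc ?H (\<lambda>p. r (fst p)) (\<lambda>p. \<tau> (fst p)) z =
      (LINT s|lborel. b s * osc (s * \<tau> z)) * r z" for z
  proof -
    have i1: "integrable lborel (indicator {0..1} :: real \<Rightarrow> complex)"
    proof -
      have "integrable lborel (\<lambda>y. complex_of_real (indicator {0..1::real} y))"
        by (intro integrable_of_real integrable_real_indicator) auto
      then show ?thesis by (simp only: of_real_indicator)
    qed
    have i2: "integrable lborel (\<lambda>s. b s * (r z * osc (s * \<tau> z)))"
    proof (rule compactly_supported_integrable[OF _ compact_Icc])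
      show "continuous_on UNIV (\<lambda>s. b s * (r z * osc (s * \<tau> z)))"
        by (intro continuous_intros b)
      show "b s * (r z * osc (s * \<tau> z)) = 0" if "s \<notin> {-\<bar>B\<bar>..\<bar>B\<bar>}" for s
        using supp[OF that] by simp
    qed
    have "param_osc ?H (\<lambda>p. r (fst p)) (\<lambda>p. \<tau> (fst p)) z =
        (LINT p|lborel. indicator {0..1::real} (fst p) * (b (snd p) * (r z * osc (snd p * \<tau> z))))"
      by (simp add: param_osc_def mult_ac)
    also have "\<dots> = (LINT y|lborel. indicator {0..1::real} y * (LINT s|lborel. b s * (r z * osc (s * \<tau> z))))"
      unfolding lborel_fubini_fst(1)[OF integrable_lborel_prod[OF i1 i2]] by simp
    also have "\<dots> = (LINT s|lborel. b s * (r z * osc (s * \<tau> z)))"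
    proof -
      have "(LINT y|lborel. indicator {0..1::real} y :: complex) = 1"
        using integral_complex_of_real[of lborel "indicator {0..1::real}"] by (simp add: of_real_indicator)
      then show ?thesis by simp
    qed
    also have "\<dots> = (LINT s|lborel. b s * osc (s * \<tau> z)) * r z"
      unfolding integral_mult_left_zero[symmetric] by (simp add: mult_ac)
    finally show ?thesis .
  qed
  moreover have "param_osc ?H (\<lambda>p. r (fst p)) (\<lambda>p. \<tau> (fst p)) =
      (\<lambda>z. (LINT s|lborel. b s * osc (s * \<tau> z)) * r z)"
    by (rule ext) (rule eq)
  ultimately show ?thesis by (simp only:)
qed


section \<open>Gradients\<close>

lemma gradient_eqI: "GDERIV f x :> D \<Longrightarrow> gradient f x = D"
  unfolding gradient_def
proof (rule the_equality)
  fix D' assume "GDERIV f x :> D" "GDERIV f x :> D'"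
  then have "(\<lambda>h. h \<bullet> D) = (\<lambda>h. h \<bullet> D')"
    unfolding gderiv_def by (rule has_derivative_unique)
  then show "D' = D" by (simp add: fun_eq_iff vector_eq_ldot)
qed

text \<open>That a gradient does not vanish can be seen from a single directional derivative.\<close>

lemma inner_gradient:
  fixes f :: "'a::euclidean_space \<Rightarrow> real"
  assumes "(f has_derivative f') (at x)"
  shows "h \<bullet> gradient f x = f' h"
proof -
  have lin: "linear f'" using assms has_derivative_linear by blast
  define D where "D = (\<Sum>b\<in>Basis. f' b *\<^sub>R b)"
  have eq: "f' h = h \<bullet> D" for h
  proof -
    have "f' h = f' (\<Sum>b\<in>Basis. (h \<bullet> b) *\<^sub>R b)" by (simp add: euclidean_representation)
    also have "\<dots> = (\<Sum>b\<in>Basis. (h \<bullet> b) * f' b)" by (simp add: linear_sum[OF lin] linear_scale[OF lin])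
    also have "\<dots> = h \<bullet> D" by (simp add: D_def inner_sum_right mult.commute)
    finally show ?thesis .
  qed
  have "f' = (\<lambda>h. h \<bullet> D)" by (rule ext) (rule eq)
  then have "GDERIV f x :> D"
    using assms unfolding gderiv_def by (simp only:)
  from gradient_eqI[OF this] eq show ?thesis by simp
qed

lemma gradient_eqI':
  fixes f :: "'a::euclidean_space \<Rightarrow> real"
  assumes "(f has_derivative (\<lambda>h. h \<bullet> D)) (at x)"
  shows "gradient f x = D"
  by (rule gradient_eqI) (use assms in \<open>simp add: gderiv_def\<close>)

section \<open>The half sphere\<close>

lemma sum_option: "(\<Sum>i\<in>UNIV. f i) = f None + (\<Sum>j\<in>UNIV. f (Some (j::'m::finite)))"
  by (simp add: UNIV_option_conv sum.reindex)

lemma inner_option: "(x :: real ^ 'm::finite option) \<bullet> y = x $ None * y $ None + (\<Sum>j\<in>UNIV. x $ Some j * y $ Some j)"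
  by (simp add: inner_vec_def sum_option)

text \<open>Hence removing a part of the sphere from an open set does not change the closure.\<close>

lemma sphere_interior_empty: "interior (sphere (0 :: 'a::euclidean_space) 1) = {}"
proof -
  have "sphere (0 :: 'a) 1 \<subseteq> cball 0 1" by auto
  from interior_mono[OF this] have "interior (sphere (0 :: 'a) 1) \<subseteq> ball 0 1" by simp
  then show ?thesis using interior_subset[of "sphere (0 :: 'a) 1"] by fastforce
qed

lemma open_Omega: "open Omega"
  unfolding Omega_def by (intro open_Collect_less continuous_intros)

lemma q_eq: "q y = sqrt (1 - y \<bullet> y)"
  by (simp add: q_def inner_vec_def power2_eq_square)

lemma Omega_iff: "y \<in> Omega \<longleftrightarrow> y \<bullet> y < 1"
  by (simp add: Omega_def norm_eq_sqrt_inner)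

lemma q_pos: "y \<in> Omega \<Longrightarrow> q y > 0"
  by (simp add: q_eq Omega_iff)

lemma q_square: "y \<in> Omega \<Longrightarrow> q y * q y = 1 - y \<bullet> y"
  by (simp add: q_eq Omega_iff)

lemma sphere_pt_None [simp]: "sphere_pt y $ None = q y"
  and sphere_pt_Some [simp]: "sphere_pt y $ Some j = y $ j"
  by (simp_all add: sphere_pt_def)

lemma sphere_pt_unit: "y \<in> Omega \<Longrightarrow> sphere_pt y \<bullet> sphere_pt y = 1"
  by (simp add: inner_option q_square) (simp add: inner_vec_def)

lemma continuous_on_sphere_pt: "continuous_on S sphere_pt"
proof -
  have "continuous_on S (\<lambda>y. sphere_pt y $ i)" for i
    by (cases i) (auto simp: q_eq intro!: continuous_intros)
  then show ?thesis
    using continuous_on_vec_lambda[of S "\<lambda>i y. sphere_pt y $ i"] by simp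
qed

lemma Ck_on_q: "Ck_on k Omega q"
  unfolding q_eq[abs_def]
  by (intro Ck_on_sqrt Ck_on_diff Ck_on_inner Ck_on_const Ck_on_ident open_Omega) (simp add: Omega_iff)

lemma Ck_on_sphere_pt: "Ck_on k Omega sphere_pt"
proof (rule Ck_on_vec[OF open_Omega])
  fix i show "Ck_on k Omega (\<lambda>y. sphere_pt y $ i)"
    by (cases i) (auto intro: Ck_on_q Ck_on_vec_nth[OF open_Omega Ck_on_ident])
qed

lemma has_derivative_q:
  fixes y :: "real ^ 'a::finite"
  assumes "y \<in> Omega"
  shows "(q has_derivative (\<lambda>h. - (y \<bullet> h) / q y)) (at y)"
proof -
  have d: "((\<lambda>y. 1 - y \<bullet> y) has_derivative (\<lambda>h. - (2 * (y \<bullet> h)))) (at y)"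
    by (auto intro!: derivative_eq_intros simp: inner_commute)
  have pos: "0 < 1 - y \<bullet> y" using assms by (simp add: Omega_iff)
  have "((\<lambda>y. sqrt (1 - y \<bullet> y)) has_derivative
      (\<lambda>h. inverse (sqrt (1 - y \<bullet> y)) / 2 * (- (2 * (y \<bullet> h))))) (at y)"
    by (rule has_derivative_compose[OF d has_field_derivative_imp_has_derivative[OF DERIV_real_sqrt[OF pos]]])
  moreover have "inverse (sqrt (1 - y \<bullet> y)) / 2 * (- (2 * (y \<bullet> h))) = - (y \<bullet> h) / q y" for h
    by (simp add: q_eq inverse_eq_divide)
  moreover have "(\<lambda>y :: real ^ 'a. sqrt (1 - y \<bullet> y)) = q"
    by (rule ext) (simp add: q_eq)
  ultimately show ?thesis by (simp only:)
qed

lemma gradient_q: "y \<in> Omega \<Longrightarrow> gradient q y = (- inverse (q y)) *\<^sub>R y"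
proof (rule gradient_eqI')
  assume "y \<in> Omega"
  moreover have "(\<lambda>h. - (y \<bullet> h) / q y) = (\<lambda>h. h \<bullet> ((- inverse (q y)) *\<^sub>R y))"
    by (auto simp: fun_eq_iff divide_inverse inner_commute)
  ultimately show "(q has_derivative (\<lambda>h. h \<bullet> ((- inverse (q y)) *\<^sub>R y))) (at y)"
    using has_derivative_q[of y] by (simp only:)
qed

text \<open>The differential of \<open>sphere_pt\<close> at \<open>y\<close>; its transpose is the matrix \<open>Bmat y\<close>.\<close>

definition sphere_diff :: "real ^ 'm::finite \<Rightarrow> real ^ 'm \<Rightarrow> real ^ 'm option" where
  "sphere_diff y h = (\<chi> i. case i of None \<Rightarrow> - (y \<bullet> h) / q y | Some j \<Rightarrow> h $ j)"

lemma sphere_diff_None [simp]: "sphere_diff y h $ None = - (y \<bullet> h) / q y"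
  and sphere_diff_Some [simp]: "sphere_diff y h $ Some j = h $ j"
  by (simp_all add: sphere_diff_def)

lemma vec_eq_option: "(z :: 'a ^ 'm::finite option) = w \<longleftrightarrow> z $ None = w $ None \<and> (\<forall>j. z $ Some j = w $ Some j)"
  by (auto simp: vec_eq_iff) (metis option.exhaust)

lemma linear_sphere_diff: "linear (sphere_diff y)"
  by (rule linearI) (simp_all add: vec_eq_option inner_add_right add_divide_distrib diff_divide_distrib)

lemma has_derivative_sphere_pt:
  assumes "y \<in> Omega"
  shows "(sphere_pt has_derivative sphere_diff y) (at y)"
proof -
  have "((\<lambda>y. sphere_pt y $ i) has_derivative (\<lambda>h. sphere_diff y h $ i)) (at y)" for i
    using has_derivative_q[OF assms]
    by (cases i) (auto intro: bounded_linear_imp_has_derivative bounded_linear_vec_nth)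
  then show ?thesis
    by (subst has_derivative_componentwise_within) (auto simp: Basis_vec_def inner_axis)
qed

lemma Bmat_mult: "y \<in> Omega \<Longrightarrow> (Bmat y *v w) $ i = w $ Some i - y $ i * w $ None / q y"
  by (simp add: matrix_vector_mult_def Bmat_def sum_option gradient_q divide_inverse mult_delta_left)

lemma inner_Bmat: "y \<in> Omega \<Longrightarrow> h \<bullet> (Bmat y *v w) = sphere_diff y h \<bullet> w"
  by (simp add: inner_option Bmat_mult inner_vec_def algebra_simps sum_subtractf sum_distrib_left
      sum_divide_distrib sum_negf)

lemma Ck_on_quad_diff:
  fixes A :: "real ^ ('m option) ^ ('m::finite option)"
  shows "Ck_on k (UNIV \<times> Omega) (\<lambda>(x, y). quad A (x - sphere_pt y))"
proof -
  have op: "open (UNIV \<times> Omega :: ((real ^ 'm option) \<times> (real ^ 'm)) set)"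
    by (intro open_Times open_UNIV open_Omega)
  have fst: "Ck_on k (UNIV \<times> Omega) (fst :: (real ^ 'm option) \<times> (real ^ 'm) \<Rightarrow> _)"
    and snd: "Ck_on k (UNIV \<times> Omega) (snd :: (real ^ 'm option) \<times> (real ^ 'm) \<Rightarrow> _)"
    by (rule Ck_on_linear[OF op bounded_linear_fst] Ck_on_linear[OF op bounded_linear_snd])+
  have s: "Ck_on k (UNIV \<times> Omega) (\<lambda>p :: (real ^ 'm option) \<times> (real ^ 'm). sphere_pt (snd p))"
    by (rule Ck_on_compose[OF op open_Omega snd Ck_on_sphere_pt]) auto
  have d: "Ck_on k (UNIV \<times> Omega) (\<lambda>p :: (real ^ 'm option) \<times> (real ^ 'm). fst p - sphere_pt (snd p))"
    by (rule Ck_on_diff[OF op fst s])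
  show ?thesis
    unfolding quad_def case_prod_unfold
    by (rule Ck_on_inner[OF op d Ck_on_bounded_linear[OF op d matrix_vector_mul_bounded_linear]])
qed

lemma Ck_on_distance:
  "Ck_on k {(x :: real ^ 'm::finite option, y). y \<in> Omega \<and> x \<noteq> sphere_pt y} (\<lambda>(x :: real ^ 'm option, y). complex_of_real (norm (x - sphere_pt y)))"
  and open_distance: "open {(x :: real ^ 'm option, y). y \<in> Omega \<and> x \<noteq> sphere_pt y}"
proof -
  let ?O = "{(x :: real ^ 'm option, y). y \<in> Omega \<and> x \<noteq> sphere_pt y}"
  have "?O = {p. norm (snd p) < 1} \<inter> {p. norm (fst p - sphere_pt (snd p)) > 0}"
    by (auto simp: Omega_def)
  moreover have "open \<dots>"
    by (intro open_Int open_Collect_less continuous_intros continuous_on_compose2[OF continuous_on_sphere_pt]) auto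
  ultimately show op: "open ?O" by simp
  have fst: "Ck_on k ?O fst" and snd: "Ck_on k ?O snd"
    by (rule Ck_on_linear[OF op bounded_linear_fst] Ck_on_linear[OF op bounded_linear_snd])+
  have s: "Ck_on k ?O (\<lambda>p. sphere_pt (snd p))"
    by (rule Ck_on_compose[OF op open_Omega snd Ck_on_sphere_pt]) auto
  have "Ck_on k ?O (\<lambda>p. complex_of_real (norm (fst p - sphere_pt (snd p))))"
    by (intro Ck_on_of_real[OF op] Ck_on_norm[OF op] Ck_on_diff[OF op fst s]) auto
  then show "Ck_on k ?O (\<lambda>(x, y). complex_of_real (norm (x - sphere_pt y)))"
    unfolding case_prod_unfold .
qed

section \<open>The phase function\<close>

context
  fixes A :: "real ^ ('m option) ^ ('m::finite option)"
  assumes diagonal: "\<And>i j. i \<noteq> j \<Longrightarrow> A $ i $ j = 0"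
    and entries: "\<exists>k. A $ k $ k = 1 \<and> (\<forall>i. i \<noteq> k \<longrightarrow> A $ i $ i = -1)"
begin

lemma A_nth: "(A *v x) $ i = A $ i $ i * x $ i"
proof -
  have "(A *v x) $ i = (\<Sum>j\<in>UNIV. A $ i $ j * x $ j)"
    by (simp add: matrix_vector_mult_def)
  also have "\<dots> = (\<Sum>j\<in>UNIV. if j = i then A $ i $ i * x $ i else 0)"
    by (rule sum.cong) (use diagonal in auto)
  finally have "(A *v x) $ i = (\<Sum>j\<in>UNIV. if j = i then A $ i $ i * x $ i else 0)" .
  then show ?thesis by simp
qed

lemma A_entry_square: "A $ i $ i * A $ i $ i = 1"
  using entries by (metis mult_1 mult_minus1 minus_minus)

lemma A_involution: "A *v (A *v x) = x"
  by (simp add: vec_eq_iff A_nth mult.assoc[symmetric] A_entry_square)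

lemma A_symmetric: "x \<bullet> (A *v y) = (A *v x) \<bullet> y"
  by (simp add: inner_vec_def A_nth mult_ac)

lemma norm_A: "norm (A *v x) = norm x"
  by (simp add: norm_eq_sqrt_inner A_symmetric[symmetric] A_involution)

lemma has_derivative_quad: "(quad A has_derivative (\<lambda>h. 2 * (h \<bullet> (A *v x)))) (at x)"
proof -
  have "((\<lambda>x. x \<bullet> (A *v x)) has_derivative (\<lambda>h. x \<bullet> (A *v h) + h \<bullet> (A *v x))) (at x)"
    by (intro has_derivative_inner has_derivative_ident bounded_linear_imp_has_derivative
        matrix_vector_mul_bounded_linear)
  moreover have "x \<bullet> (A *v h) = h \<bullet> (A *v x)" for h
    by (metis A_symmetric inner_commute)
  ultimately show ?thesis by (simp add: quad_def[abs_def])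
qed

text \<open>The derivatives in the separate groups of variables all follow from the total derivative.\<close>

lemma has_derivative_psi:
  assumes "y \<in> Omega"
  shows "(psi A has_derivative (\<lambda>(((dy, dt), dx), ds).
      ds * (t - quad A (x - sphere_pt y)) + s * (dt - 2 * ((dx - sphere_diff y dy) \<bullet> (A *v (x - sphere_pt y))))))
    (at (((y, t), x), s))"
proof -
  let ?p = "(((y, t), x), s)"
  have y: "((\<lambda>p :: (((real ^ 'm) \<times> real) \<times> (real ^ 'm option)) \<times> real. fst (fst (fst p))) has_derivative
      (\<lambda>d. fst (fst (fst d)))) (at ?p)"
    and t: "((\<lambda>p :: (((real ^ 'm) \<times> real) \<times> (real ^ 'm option)) \<times> real. snd (fst (fst p))) has_derivative
      (\<lambda>d. snd (fst (fst d)))) (at ?p)"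
    and x: "((\<lambda>p :: (((real ^ 'm) \<times> real) \<times> (real ^ 'm option)) \<times> real. snd (fst p)) has_derivative
      (\<lambda>d. snd (fst d))) (at ?p)"
    and s: "((\<lambda>p :: (((real ^ 'm) \<times> real) \<times> (real ^ 'm option)) \<times> real. snd p) has_derivative
      (\<lambda>d. snd d)) (at ?p)"
    by (auto intro!: derivative_eq_intros)
  have "(sphere_pt has_derivative sphere_diff y) (at (fst (fst (fst ?p))))"
    using has_derivative_sphere_pt[OF assms] by simp
  from has_derivative_diff[OF x has_derivative_compose[OF y this]]
  have xT: "((\<lambda>p. snd (fst p) - sphere_pt (fst (fst (fst p)))) has_derivative
      (\<lambda>d. snd (fst d) - sphere_diff y (fst (fst (fst d))))) (at ?p)" .
  have "((\<lambda>p. snd p * (snd (fst (fst p)) - quad A (snd (fst p) - sphere_pt (fst (fst (fst p)))))) has_derivative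
      (\<lambda>d. s * (snd (fst (fst d)) - 2 * ((snd (fst d) - sphere_diff y (fst (fst (fst d)))) \<bullet> (A *v (x - sphere_pt y))))
        + snd d * (t - quad A (x - sphere_pt y)))) (at ?p)"
    using has_derivative_mult[OF s has_derivative_diff[OF t has_derivative_compose[OF xT has_derivative_quad]]]
    by simp
  then show ?thesis
    by (simp add: psi_def case_prod_unfold add.commute)
qed

lemma gradient_psi_x:
  "gradient (\<lambda>x. psi A ((u, x), s)) x = - ((2 * s) *\<^sub>R (A *v (x - sphere_pt (fst u))))"
proof (rule gradient_eqI')
  have "((\<lambda>x. x - sphere_pt (fst u)) has_derivative (\<lambda>h. h)) (at x)"
    by (auto intro!: derivative_eq_intros)
  from has_derivative_compose[OF this has_derivative_quad]
  have "((\<lambda>x. s * (snd u - quad A (x - sphere_pt (fst u)))) has_derivative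
      (\<lambda>h. s * (0 - 2 * (h \<bullet> (A *v (x - sphere_pt (fst u))))))) (at x)"
    by (intro has_derivative_mult_right has_derivative_diff has_derivative_const)
  then show "((\<lambda>x. psi A ((u, x), s)) has_derivative
      (\<lambda>h. h \<bullet> - ((2 * s) *\<^sub>R (A *v (x - sphere_pt (fst u)))))) (at x)"
    by (simp add: psi_def case_prod_unfold mult_ac)
qed

lemma gradient_psi_u:
  assumes "y \<in> Omega"
  shows "gradient (\<lambda>u. psi A ((u, x), s)) (y, t) = ((2 * s) *\<^sub>R (Bmat y *v (A *v (x - sphere_pt y))), s)"
proof (rule gradient_eqI')
  have "((\<lambda>u. ((u, x), s)) has_derivative (\<lambda>h. ((h, 0), 0))) (at (y, t))"
    by (auto intro!: derivative_eq_intros)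
  from has_derivative_compose[OF this has_derivative_psi[OF assms]]
  show "((\<lambda>u. psi A ((u, x), s)) has_derivative
      (\<lambda>h. h \<bullet> ((2 * s) *\<^sub>R (Bmat y *v (A *v (x - sphere_pt y))), s))) (at (y, t))"
    by (simp add: case_prod_unfold inner_prod_def inner_Bmat[OF assms] inner_diff_left algebra_simps)
qed

lemma gradient_psi_theta:
  "gradient (\<lambda>s. psi A (((y, t), x), s)) s = t - quad A (x - sphere_pt y)"
proof (rule gradient_eqI')
  show "((\<lambda>s. psi A (((y, t), x), s)) has_derivative (\<lambda>h. h \<bullet> (t - quad A (x - sphere_pt y)))) (at s)"
    by (auto simp: psi_def intro!: derivative_eq_intros)
qed

text \<open>The derivative of the phase in the direction of \<open>t\<close> is the frequency, and that of \<open>d\<psi>/d\<omega>\<close> is \<open>1\<close>.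
  For the gradient in \<open>(x, \<omega>)\<close> positivity of \<open>t\<close> is essential: the derivative in \<open>x\<close>
  vanishes only at \<open>x = s(y)\<close>, where the derivative in \<open>\<omega>\<close> is \<open>t\<close>.\<close>

lemma nondegenerate_phase_psi: "nondegenerate_phase Omega_times_pos (- top_half) (psi A)"
  unfolding nondegenerate_phase_def
proof (intro conjI ballI allI impI)
  let ?O = "((Omega \<times> UNIV) \<times> UNIV) \<times> UNIV :: ((((real ^ 'm) \<times> real) \<times> (real ^ 'm option)) \<times> real) set"
  have op: "open ?O" by (intro open_Times open_UNIV open_Omega)
  have C1: "Ck_on k ?O (\<lambda>p. (snd (fst p), fst (fst (fst p))))" and C2: "Ck_on k ?O (\<lambda>p. snd (fst (fst p)))"
    and C3: "Ck_on k ?O snd" for k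
    by (intro Ck_on_linear[OF op] bounded_linear_Pair bounded_linear_fst bounded_linear_snd
        bounded_linear_compose[OF bounded_linear_fst] bounded_linear_compose[OF bounded_linear_snd])+
  have diff: "Ck_on k ?O (\<lambda>p. snd (fst (fst p)) - quad A (snd (fst p) - sphere_pt (fst (fst (fst p)))))" for k
    using Ck_on_compose[OF op _ C1 Ck_on_quad_diff] open_Omega
    by (intro Ck_on_diff[OF op C2]) (auto intro: open_Times simp: mem_Times_iff)
  have "Ck_on k ?O (psi A)" for k
    unfolding psi_def case_prod_unfold by (rule Ck_on_mult[OF op C3 diff])
  then show "smooth_on ((Omega_times_pos \<times> - top_half) \<times> (UNIV - {0})) (psi A)"
    unfolding smooth_on_def Omega_times_pos_def using op by (intro exI[of _ ?O]) auto
  fix u :: "(real ^ 'm) \<times> real" and x :: "real ^ 'm option" and s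
  assume u: "u \<in> Omega_times_pos" and x: "x \<in> - top_half" and s: "s \<noteq> (0::real)"
  obtain y t where yt: "u = (y, t)" "y \<in> Omega" "t > 0"
    using u by (auto simp: Omega_times_pos_def)
  show "psi A ((u, x), c *\<^sub>R s) = c * psi A ((u, x), s)" if "c > 0" for c
    by (simp add: psi_def yt)
  have "((\<lambda>p. ((fst p, x), snd p)) has_derivative (\<lambda>d. ((fst d, 0), snd d))) (at (u, s))"
    by (auto intro!: derivative_eq_intros)
  from has_derivative_compose[OF this, of "psi A"] has_derivative_psi[OF yt(2)]
  have "((\<lambda>(u, s). psi A ((u, x), s)) has_derivative
      (\<lambda>d. (case ((fst d, 0), snd d) of (((dy, dt), dx), ds) \<Rightarrow> ds * (t - quad A (x - sphere_pt y)) +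
        s * (dt - 2 * ((dx - sphere_diff y dy) \<bullet> (A *v (x - sphere_pt y))))))) (at (u, s))"
    by (fastforce simp: yt case_prod_unfold)
  from inner_gradient[OF this, of "((0, 1), 0)"]
  show "gradient (\<lambda>(u, s). psi A ((u, x), s)) (u, s) \<noteq> 0"
  proof -
    assume "((0, 1), 0) \<bullet> gradient (\<lambda>(u, s). psi A ((u, x), s)) (u, s) =
      (case ((fst ((0, 1), 0), 0), snd ((0, 1), 0)) of (((dy, dt), dx), ds) \<Rightarrow> ds * (t - quad A (x - sphere_pt y)) +
        s * (dt - 2 * ((dx - sphere_diff y dy) \<bullet> (A *v (x - sphere_pt y)))))"
    then show ?thesis using s by (auto simp: linear_0[OF linear_sphere_diff])
  qed
  have "((\<lambda>p. ((u, fst p), snd p)) has_derivative (\<lambda>d. ((0, fst d), snd d))) (at (x, s))"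
    by (auto intro!: derivative_eq_intros)
  from has_derivative_compose[OF this, of "psi A"] has_derivative_psi[OF yt(2)]
  have D: "((\<lambda>(x, s). psi A ((u, x), s)) has_derivative
      (\<lambda>d. (case ((0, fst d), snd d) of (((dy, dt), dx), ds) \<Rightarrow> ds * (t - quad A (x - sphere_pt y)) +
        s * (dt - 2 * ((dx - sphere_diff y dy) \<bullet> (A *v (x - sphere_pt y))))))) (at (x, s))"
    by (fastforce simp: yt case_prod_unfold)
  show "gradient (\<lambda>(x, s). psi A ((u, x), s)) (x, s) \<noteq> 0"
  proof
    assume 0: "gradient (\<lambda>(x, s). psi A ((u, x), s)) (x, s) = 0"
    have "t - quad A (x - sphere_pt y) = 0"
      using inner_gradient[OF D, of "(0, 1)"] unfolding 0 by (simp add: linear_0[OF linear_sphere_diff] zero_prod_def)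
    moreover have "(A *v (x - sphere_pt y)) \<bullet> (A *v (x - sphere_pt y)) = 0"
      using inner_gradient[OF D, of "(A *v (x - sphere_pt y), 0)"] s unfolding 0 by (simp add: linear_0[OF linear_sphere_diff] zero_prod_def)
    then have "quad A (x - sphere_pt y) = 0"
      by (simp add: quad_def)
    ultimately show False using yt by simp
  qed
  fix c :: "real \<Rightarrow> real" and b :: real
  assume c: "(\<Sum>b\<in>Basis. c b *\<^sub>R gradient (\<lambda>p. frechet_derivative (psi A) (at p) (0, b)) ((u, x), s)) = 0"
    and b: "b \<in> Basis"
  have "((\<lambda>p. snd (fst (fst p)) - quad A (snd (fst p) - sphere_pt (fst (fst (fst p))))) has_derivative
      (\<lambda>d. snd (fst (fst d)) - 2 * ((snd (fst d) - sphere_diff y (fst (fst (fst d)))) \<bullet> (A *v (x - sphere_pt y)))))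
      (at ((u, x), s))" (is "(?f has_derivative ?f') _")
  proof -
    have "((\<lambda>p. (((fst (fst (fst p))), snd (fst (fst p))), snd (fst p), 1::real)) has_derivative
        (\<lambda>d. (((fst (fst (fst d))), snd (fst (fst d))), snd (fst d), 0::real))) (at ((u, x), s))"
      by (auto intro!: derivative_eq_intros)
    then have "((\<lambda>p. ((((fst (fst (fst p))), snd (fst (fst p))), snd (fst p)), 1::real)) has_derivative
        (\<lambda>d. ((((fst (fst (fst d))), snd (fst (fst d))), snd (fst d)), 0::real))) (at ((u, x), s))"
      by (auto intro!: derivative_eq_intros)
    from has_derivative_compose[OF this, of "psi A"] has_derivative_psi[OF yt(2), of t x 1]
    show ?thesis
      by (fastforce simp: yt psi_def case_prod_unfold)
  qed
  then have "((\<lambda>p. frechet_derivative (psi A) (at p) (0, 1)) has_derivative ?f') (at ((u, x), s))"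
  proof (rule has_derivative_transform_within_open[OF _ op])
    show "?f p = frechet_derivative (psi A) (at p) (0, 1)" if "p \<in> ?O" for p
    proof -
      obtain y' t' x' s' where p: "p = (((y', t'), x'), s')" by (metis prod.exhaust)
      have y': "y' \<in> Omega" using that p by simp
      show ?thesis
        unfolding p frechet_derivative_at[OF has_derivative_psi[OF y'], symmetric] by (simp add: linear_0[OF linear_sphere_diff] zero_prod_def)
    qed
  qed (use yt in auto)
  from inner_gradient[OF this, of "(((0, 1), 0), 0)"]
  have "gradient (\<lambda>p. frechet_derivative (psi A) (at p) (0, 1)) ((u, x), s) \<noteq> 0"
  proof -
    assume "(((0, 1), 0), 0) \<bullet> gradient (\<lambda>p. frechet_derivative (psi A) (at p) (0, 1)) ((u, x), s) =
      ?f' (((0, 1), 0), 0)"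
    then show ?thesis by (auto simp: linear_0[OF linear_sphere_diff])
  qed
  then show "c b = 0" using c b by simp
qed

end


lemma Ck_seminorm_mono:
  assumes "compact K" "smooth_on K \<phi>" "N \<le> N'"
  shows "Ck_seminorm N K \<phi> \<le> Ck_seminorm N' K \<phi>"
  by (rule Ck_seminorm_least[OF Ck_seminorm_nonneg[OF assms(1,2)]])
    (use assms in \<open>auto intro: iter_deriv_le_Ck_seminorm\<close>)

lemma time_fourier_add:
  fixes g1 g2 :: "'y::euclidean_space \<times> real \<Rightarrow> complex"
  assumes "continuous_on UNIV g1" "compact K1" "\<And>p. p \<notin> K1 \<Longrightarrow> g1 p = 0"
    and "continuous_on UNIV g2" "compact K2" "\<And>p. p \<notin> K2 \<Longrightarrow> g2 p = 0"
  shows "time_fourier (\<lambda>p. g1 p + g2 p) p = time_fourier g1 p + time_fourier g2 p"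
  unfolding time_fourier_def distrib_right
  by (rule Bochner_Integration.integral_add[OF slice_integrable[OF assms(1-3)] slice_integrable[OF assms(4-6)]])

lemma time_fourier_cmult: "time_fourier (\<lambda>p. c * g p) p = c * time_fourier g p"
  unfolding time_fourier_def by (simp add: mult.assoc)

lemma half_sphere_complement_subset: "- top_half \<subseteq> closure (interior (- top_half :: (real ^ 'm::finite option) set))"
proof -
  have "top_half \<subseteq> sphere (0 :: real ^ 'm option) 1"
    by (auto simp: top_half_def norm_eq_sqrt_inner sphere_pt_unit)
  then have "closure top_half \<subseteq> sphere (0 :: real ^ 'm option) 1"
    by (rule closure_minimal) simp
  then have "interior (closure top_half) \<subseteq> interior (sphere (0 :: real ^ 'm option) 1)"
    by (rule interior_mono)
  then have "interior (closure (top_half :: (real ^ 'm option) set)) = {}"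
    unfolding sphere_interior_empty by blast
  then show ?thesis by (simp add: interior_complement closure_complement)
qed

definition low_abs :: "real \<Rightarrow> complex" where
  "low_abs s = of_real (cutoff s * (2 * \<bar>s\<bar>))"

lemma high_low_abs: "complex_of_real (2 * \<bar>s\<bar>) = high_abs s + low_abs s"
  unfolding high_abs_def low_abs_def of_real_add[symmetric] by (simp add: algebra_simps)

lemma norm_high_abs_le: "norm (high_abs s) \<le> 2 * \<bar>s\<bar>"
proof -
  have "\<bar>1 - cutoff s\<bar> * (2 * \<bar>s\<bar>) \<le> 1 * (2 * \<bar>s\<bar>)"
    using cutoff_nonneg[of s] cutoff_le_1[of s] by (intro mult_right_mono) auto
  then show ?thesis by (simp add: high_abs_def norm_mult abs_mult del: of_real_mult of_real_diff)
qed

lemma norm_low_abs_le: "norm (low_abs s) \<le> 2 * \<bar>s\<bar>"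
proof -
  have "\<bar>cutoff s\<bar> * (2 * \<bar>s\<bar>) \<le> 1 * (2 * \<bar>s\<bar>)"
    using cutoff_nonneg[of s] cutoff_le_1[of s] by (intro mult_right_mono) auto
  then show ?thesis by (simp add: low_abs_def norm_mult abs_mult del: of_real_mult)
qed

lemma low_abs_eq_0: "2 \<le> \<bar>s\<bar> \<Longrightarrow> low_abs s = 0"
  by (simp add: low_abs_def cutoff_eq_0)

lemma continuous_on_high_abs: "continuous_on S high_abs"
  using Ck_on_imp_continuous_on[OF Ck_on_high_abs] continuous_on_subset by blast

lemma continuous_on_low_abs: "continuous_on S low_abs"
  unfolding low_abs_def[abs_def]
  by (intro continuous_intros continuous_on_subset[OF Ck_on_imp_continuous_on[OF Ck_on_cutoff] subset_UNIV])

lemma integrable_low_abs: "integrable lborel low_abs"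
  by (rule compactly_supported_integrable[OF continuous_on_low_abs compact_Icc[of "-2" 2]])
    (auto simp: low_abs_eq_0 not_le)

definition sphere_dist :: "(real ^ 'm::finite option) \<times> (real ^ 'm) \<Rightarrow> complex" where
  "sphere_dist = (\<lambda>(x, y). complex_of_real (norm (x - sphere_pt y)))"

lemma continuous_on_sphere_dist: "continuous_on UNIV sphere_dist"
  unfolding sphere_dist_def case_prod_unfold
  by (intro continuous_intros continuous_on_compose2[OF continuous_on_sphere_pt]) auto

section \<open>The Radon transform as a Fourier integral operator\<close>

context
  fixes A :: "real ^ ('m option) ^ ('m::finite option)"
  assumes diagonal: "\<And>i j. i \<noteq> j \<Longrightarrow> A $ i $ j = 0"
    and entries: "\<exists>k. A $ k $ k = 1 \<and> (\<forall>i. i \<noteq> k \<longrightarrow> A $ i $ i = -1)"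
begin

definition shifted_quad :: "(real ^ 'm option) \<times> (real ^ 'm) \<Rightarrow> real" where
  "shifted_quad = (\<lambda>(x, y). quad A (x - sphere_pt y))"

text \<open>The function to which a distribution is applied when its transform is paired with \<open>g\<close>.\<close>

definition radon_transpose :: "((real ^ 'm) \<times> real \<Rightarrow> complex) \<Rightarrow> real ^ 'm option \<Rightarrow> complex" where
  "radon_transpose g = param_osc (freq_amp (\<lambda>s. of_real (2 * \<bar>s\<bar>)) g) sphere_dist (\<lambda>p. - shifted_quad p)"

lemma continuous_on_shifted_quad: "continuous_on UNIV shifted_quad"
  unfolding shifted_quad_def quad_def case_prod_unfold
  by (intro continuous_intros continuous_on_compose2[OF continuous_on_sphere_pt]
      bounded_linear.continuous_on[OF matrix_vector_mul_bounded_linear]) auto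

lemma amplitude_continuous: "continuous_on UNIV (\<lambda>s. complex_of_real (2 * \<bar>s\<bar>))"
  and amplitude_bound: "norm (complex_of_real (2 * \<bar>s\<bar>)) \<le> 2 * \<bar>s\<bar>"
  by (auto intro!: continuous_intros simp: norm_mult)

lemma psi_eq: "psi A = (\<lambda>(z, s). s * (snd (fst z) - shifted_quad (snd z, fst (fst z))))"
  by (simp add: psi_def shifted_quad_def case_prod_unfold)

lemma radon_eq:
  assumes "g \<in> test_funs U"
  shows "radon A f g = f (radon_transpose g)"
proof -
  obtain K where K: "compact K" "\<And>p. p \<notin> K \<Longrightarrow> g p = 0" "\<And>k. Ck_on k UNIV g"
    using test_funsE[OF assms] by metis
  have "osc_integral (\<lambda>(u, \<theta>). psi A ((u, x), \<theta>))
      (\<lambda>(u, \<theta>). case ((u, x), \<theta>) of ((u, x), s) \<Rightarrow> complex_of_real (norm (gradient (\<lambda>x. psi A ((u, x), s)) x))) g =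
    radon_transpose g x" for x
  proof -
    have "(\<lambda>(u, \<theta>). psi A ((u, x), \<theta>)) = (\<lambda>(z, s). s * (snd z - shifted_quad (x, fst z)))"
      by (simp add: psi_eq)
    moreover have "(\<lambda>(u, \<theta>). case ((u, x), \<theta>) of ((u, x), s) \<Rightarrow>
        complex_of_real (norm (gradient (\<lambda>x. psi A ((u, x), s)) x))) =
      (\<lambda>(z, s). complex_of_real (2 * \<bar>s\<bar>) * sphere_dist (x, fst z))"
      by (simp add: gradient_psi_x[OF diagonal entries] norm_A[OF diagonal entries] sphere_dist_def fun_eq_iff abs_mult)
    moreover have "has_osc_integral (\<lambda>(z, s). s * (snd z - shifted_quad (x, fst z)))
        (\<lambda>(z, s). complex_of_real (2 * \<bar>s\<bar>) * sphere_dist (x, fst z)) g (radon_transpose g x)"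
      unfolding radon_transpose_def
      by (rule has_osc_integral_param_osc[OF continuous_on_sphere_dist continuous_on_shifted_quad
          K(3,1) _ amplitude_continuous amplitude_bound]) (rule K(2))
    ultimately show ?thesis
      using osc_integral_eq by simp
  qed
  then show ?thesis
    unfolding radon_def osc_operator_def by simp
qed

text \<open>Additivity holds at every point and not only on some neighbourhood, so it may be used inside a
  functional whose values on arbitrary functions are unconstrained.\<close>

lemma radon_transpose_add:
  assumes g1: "g1 \<in> test_funs U" and g2: "g2 \<in> test_funs U"
  shows "radon_transpose (\<lambda>p. g1 p + g2 p) = (\<lambda>x. radon_transpose g1 x + radon_transpose g2 x)"
proof -
  obtain K1 where K1: "compact K1" "\<And>p. p \<notin> K1 \<Longrightarrow> g1 p = 0" "\<And>k. Ck_on k UNIV g1" "continuous_on UNIV g1"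
    using test_funsE[OF g1] by metis
  obtain K2 where K2: "compact K2" "\<And>p. p \<notin> K2 \<Longrightarrow> g2 p = 0" "\<And>k. Ck_on k UNIV g2" "continuous_on UNIV g2"
    using test_funsE[OF g2] by metis
  note int = param_osc_freq_amp_integrable[OF continuous_on_sphere_dist continuous_on_shifted_quad
      _ _ _ amplitude_continuous amplitude_bound]
  have "freq_amp (\<lambda>s. of_real (2 * \<bar>s\<bar>)) (\<lambda>p. g1 p + g2 p) p =
      freq_amp (\<lambda>s. of_real (2 * \<bar>s\<bar>)) g1 p + freq_amp (\<lambda>s. of_real (2 * \<bar>s\<bar>)) g2 p" for p
  proof -
    have "time_fourier (\<lambda>p. g1 p + g2 p) p = time_fourier g1 p + time_fourier g2 p"
      by (rule time_fourier_add[OF K1(4,1) _ K2(4,1)]) (use K1(2) K2(2) in auto)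
    then show ?thesis
      by (simp only: freq_amp_def distrib_left)
  qed
  moreover have "integrable lborel (\<lambda>p. freq_amp (\<lambda>s. of_real (2 * \<bar>s\<bar>)) g1 p * sphere_dist (x, fst p) *
        osc (snd p * - shifted_quad (x, fst p)))"
    "integrable lborel (\<lambda>p. freq_amp (\<lambda>s. of_real (2 * \<bar>s\<bar>)) g2 p * sphere_dist (x, fst p) *
        osc (snd p * - shifted_quad (x, fst p)))" for x
    by (rule int[OF K1(3,1)] int[OF K2(3,1)]; use K1(2) K2(2) in auto)+
  ultimately show ?thesis
    unfolding radon_transpose_def param_osc_def fun_eq_iff
    by (simp only: distrib_right Bochner_Integration.integral_add) simp
qed

lemma radon_transpose_cmult: "radon_transpose (\<lambda>p. c * g p) = (\<lambda>x. c * radon_transpose g x)"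
proof -
  have "freq_amp (\<lambda>s. of_real (2 * \<bar>s\<bar>)) (\<lambda>p. c * g p) p = c * freq_amp (\<lambda>s. of_real (2 * \<bar>s\<bar>)) g p" for p
    unfolding freq_amp_def time_fourier_cmult by simp
  then show ?thesis
    unfolding radon_transpose_def param_osc_def[abs_def] by (simp only: mult.assoc integral_mult_right_zero)
qed

lemma Ck_on_phase: "Ck_on k {(x :: real ^ 'm option, y). y \<in> Omega \<and> x \<noteq> sphere_pt y} (\<lambda>p. - shifted_quad p)"
  unfolding shifted_quad_def
  by (rule Ck_on_uminus[OF open_distance Ck_on_subset[OF Ck_on_quad_diff]]) auto

lemma Ck_on_sphere_dist: "Ck_on k {(x :: real ^ 'm option, y). y \<in> Omega \<and> x \<noteq> sphere_pt y} sphere_dist"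
  unfolding sphere_dist_def by (rule Ck_on_distance)

context
  fixes K :: "((real ^ 'm) \<times> real) set"
  assumes K: "compact K" "K \<subseteq> Omega_times_pos"
begin

lemma fst_K_Omega: "fst ` K \<subseteq> Omega"
  using K(2) by (auto simp: Omega_times_pos_def)

lemma compact_fst_image_K: "compact (fst ` K)"
  by (intro compact_continuous_image K continuous_intros)

text \<open>The points at which \<open>|x - s(y)|\<close> is smooth for all \<open>y\<close> in the support of \<open>g\<close>.  Only a compact
  part of the half sphere is removed, so neighbourhoods of equatorial points remain.\<close>

lemma open_regular_points: "open (- sphere_pt ` fst ` K :: (real ^ 'm option) set)"
  using compact_continuous_image[OF continuous_on_sphere_pt compact_fst_image_K]
  by (simp add: compact_imp_closed open_Compl)

lemma complement_subset_regular_points: "- top_half \<subseteq> - sphere_pt ` fst ` K"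
  using fst_K_Omega by (auto simp: top_half_def)

lemma regular_points_domain:
  "(- sphere_pt ` fst ` K) \<times> fst ` K \<subseteq> {(x, y). y \<in> Omega \<and> x \<noteq> sphere_pt y}"
  using fst_K_Omega by auto

lemma smooth_on_radon_transpose:
  assumes "\<And>k. Ck_on k UNIV g" "\<And>p. p \<notin> K \<Longrightarrow> g p = 0"
  shows "smooth_on (- sphere_pt ` fst ` K) (radon_transpose g)"
  unfolding smooth_on_open[OF open_regular_points] radon_transpose_def
  by (intro allI Ck_on_param_osc[OF open_distance compact_fst_image_K open_regular_points
        regular_points_domain Ck_on_phase _ Ck_on_sphere_dist]
      rapidly_decreasing_freq_amp[OF assms(1) K(1) assms(2) amplitude_continuous amplitude_bound])

text \<open>The maximum over the finitely many derivatives in the seminorm is replaced by the sum of the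
  constants of \<open>param_osc_bound\<close>.\<close>

lemma radon_transpose_seminorm:
  assumes L: "compact L" "L \<subseteq> - sphere_pt ` fst ` K"
  shows "\<exists>C N'. C \<ge> 0 \<and> (\<forall>g. (\<forall>k. Ck_on k UNIV g) \<longrightarrow> (\<forall>p. p \<notin> K \<longrightarrow> g p = 0) \<longrightarrow>
    Ck_seminorm N L (radon_transpose g) \<le> C * Ck_seminorm N' K g)"
proof -
  let ?V = "{vs :: (real ^ 'm option) list. set vs \<subseteq> Basis \<and> length vs \<le> N}"
  let ?H = "\<lambda>g. freq_amp (\<lambda>s. of_real (2 * \<bar>s\<bar>)) g"
  obtain T where T: "T \<ge> 0" "\<And>p. p \<in> K \<Longrightarrow> \<bar>snd p\<bar> \<le> T"
    using compactly_supported_time_bound[OF K(1)] by blast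
  have "\<forall>vs. \<exists>C. \<forall>H S. rapidly_decreasing (fst ` K) H \<longrightarrow>
    (\<forall>N p. N \<le> length vs + 2 \<longrightarrow> \<bar>snd p\<bar> ^ N * norm (H p) \<le> S) \<longrightarrow>
    (\<forall>x\<in>L. norm (iter_deriv vs (param_osc H sphere_dist (\<lambda>p. - shifted_quad p)) x) \<le> C * S)"
    by (intro allI param_osc_bound[OF open_distance compact_fst_image_K open_regular_points
        regular_points_domain Ck_on_phase L Ck_on_sphere_dist])
  then obtain C where C: "\<And>vs H S x. rapidly_decreasing (fst ` K) H \<Longrightarrow>
      (\<And>N p. N \<le> length vs + 2 \<Longrightarrow> \<bar>snd p\<bar> ^ N * norm (H p) \<le> S) \<Longrightarrow> x \<in> L \<Longrightarrow>
      norm (iter_deriv vs (param_osc H sphere_dist (\<lambda>p. - shifted_quad p)) x) \<le> C vs * S"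
    by metis
  define M where "M = (\<Sum>vs\<in>?V. \<bar>C vs\<bar>)"
  have M: "C vs \<le> M" if "vs \<in> ?V" for vs
    unfolding M_def using that finite_lists_length_le[OF finite_Basis]
    by (intro order_trans[OF abs_ge_self member_le_sum[of vs ?V "\<lambda>vs. \<bar>C vs\<bar>"]]) auto
  have M0: "M \<ge> 0" unfolding M_def by (rule sum_nonneg) simp
  have "Ck_seminorm N L (radon_transpose g) \<le> (M * (4 * T)) * Ck_seminorm (N + 3) K g"
    if g: "\<And>k. Ck_on k UNIV g" and gK: "\<And>p. p \<notin> K \<Longrightarrow> g p = 0" for g
  proof (rule Ck_seminorm_least)
    have sm: "smooth_on K g" using g by (auto simp: smooth_on_def)
    note nn = Ck_seminorm_nonneg[OF K(1) sm]
    show "0 \<le> M * (4 * T) * Ck_seminorm (N + 3) K g"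
      by (intro mult_nonneg_nonneg M0 T nn) auto
    fix vs :: "(real ^ 'm option) list" and x
    assume x: "x \<in> L" and vs: "set vs \<subseteq> Basis" "length vs \<le> N"
    have "norm (iter_deriv vs (radon_transpose g) x) \<le> C vs * (4 * T * Ck_seminorm (N + 3) K g)"
      unfolding radon_transpose_def
    proof (rule C[OF rapidly_decreasing_freq_amp[OF g K(1) gK amplitude_continuous amplitude_bound] _ x])
      fix n p assume n: "n \<le> length vs + 2"
      have "\<bar>snd p\<bar> ^ n * norm (?H g p) \<le> 4 * T * Ck_seminorm (Suc n) K g"
        by (rule freq_amp_bound[OF g K(1) gK T amplitude_bound])
      also have "\<dots> \<le> 4 * T * Ck_seminorm (N + 3) K g"
        by (intro mult_left_mono Ck_seminorm_mono[OF K(1) sm]) (use n vs T in auto)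
      finally show "\<bar>snd p\<bar> ^ n * norm (?H g p) \<le> 4 * T * Ck_seminorm (N + 3) K g" .
    qed
    also have "\<dots> \<le> M * (4 * T * Ck_seminorm (N + 3) K g)"
      by (intro mult_right_mono M mult_nonneg_nonneg nn) (use vs T in auto)
    finally show "norm (iter_deriv vs (radon_transpose g) x) \<le> M * (4 * T) * Ck_seminorm (N + 3) K g"
      by (simp add: mult.assoc)
  qed
  then show ?thesis
    using M0 T by (intro exI[of _ "M * (4 * T)"] exI[of _ "N + 3"]) auto
qed

end

lemma radon_in_distributions:
  assumes f: "f \<in> compact_dists (- top_half)"
  shows "radon A f \<in> distributions Omega_times_pos"
proof -
  obtain Kf where Kf: "compact Kf" "Kf \<subseteq> - top_half" and fK: "f \<in> dists_supported_in Kf"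
    using f by (auto simp: compact_dists_def)
  have fW: "linear_functional_on {\<phi>. smooth_on W \<phi>} f"
    "\<exists>L C N. compact L \<and> L \<subseteq> W \<and> (\<forall>\<phi>. smooth_on W \<phi> \<longrightarrow> norm (f \<phi>) \<le> C * Ck_seminorm N L \<phi>)"
    if "open W" "- top_half \<subseteq> W" for W
    using fK that Kf(2) unfolding dists_supported_in_def by blast+
  have "linear_functional_on (test_funs Omega_times_pos) (radon A f)"
    unfolding linear_functional_on_def
  proof (intro conjI ballI allI)
    fix g1 g2 :: "(real ^ 'm) \<times> real \<Rightarrow> complex"
    assume g1: "g1 \<in> test_funs Omega_times_pos" and g2: "g2 \<in> test_funs Omega_times_pos"
    obtain K1 where K1: "compact K1" "K1 \<subseteq> Omega_times_pos" "\<And>p. p \<notin> K1 \<Longrightarrow> g1 p = 0" "\<And>k. Ck_on k UNIV g1"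
      using test_funsE[OF g1] by metis
    obtain K2 where K2: "compact K2" "K2 \<subseteq> Omega_times_pos" "\<And>p. p \<notin> K2 \<Longrightarrow> g2 p = 0" "\<And>k. Ck_on k UNIV g2"
      using test_funsE[OF g2] by metis
    let ?K = "K1 \<union> K2"
    have K: "compact ?K" "?K \<subseteq> Omega_times_pos"
      using K1 K2 by auto
    have g12: "(\<lambda>p. g1 p + g2 p) \<in> test_funs Omega_times_pos"
      unfolding test_funs_def mem_Collect_eq smooth_on_open[OF open_UNIV]
      by (intro conjI allI impI exI[of _ ?K] K Ck_on_add open_UNIV K1(4) K2(4)) (simp add: K1(3) K2(3))
    have sm: "smooth_on (- sphere_pt ` fst ` ?K) (radon_transpose g1)"
      "smooth_on (- sphere_pt ` fst ` ?K) (radon_transpose g2)"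
      by (rule smooth_on_radon_transpose[OF K]; use K1 K2 in auto)+
    show "radon A f (\<lambda>p. g1 p + g2 p) = radon A f g1 + radon A f g2"
      unfolding radon_eq[OF g1] radon_eq[OF g2] radon_eq[OF g12] radon_transpose_add[OF g1 g2]
      using fW(1)[OF open_regular_points[OF K] complement_subset_regular_points[OF K]] sm
      unfolding linear_functional_on_def by blast
  next
    fix c and g :: "(real ^ 'm) \<times> real \<Rightarrow> complex"
    assume g: "g \<in> test_funs Omega_times_pos"
    obtain K where K: "compact K" "K \<subseteq> Omega_times_pos" "\<And>p. p \<notin> K \<Longrightarrow> g p = 0" "\<And>k. Ck_on k UNIV g"
      using test_funsE[OF g] by metis
    have cg: "(\<lambda>p. c * g p) \<in> test_funs Omega_times_pos"
      unfolding test_funs_def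
      using K by (auto simp: smooth_on_open intro!: Ck_on_mult exI[of _ K])
    show "radon A f (\<lambda>p. c * g p) = c * radon A f g"
      unfolding radon_eq[OF g] radon_eq[OF cg] radon_transpose_cmult
      using fW(1)[OF open_regular_points[OF K(1,2)] complement_subset_regular_points[OF K(1,2)]]
        smooth_on_radon_transpose[OF K(1,2,4,3)]
      unfolding linear_functional_on_def by blast
  qed
  moreover have "\<exists>C N. \<forall>g\<in>test_funs Omega_times_pos. (\<forall>p. p \<notin> K \<longrightarrow> g p = 0) \<longrightarrow>
      norm (radon A f g) \<le> C * Ck_seminorm N K g" if K: "compact K" "K \<subseteq> Omega_times_pos" for K
  proof -
    obtain L C N where L: "compact L" "L \<subseteq> - sphere_pt ` fst ` K"
      and C: "\<And>\<phi>. smooth_on (- sphere_pt ` fst ` K) \<phi> \<Longrightarrow> norm (f \<phi>) \<le> C * Ck_seminorm N L \<phi>"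
      using fW(2)[OF open_regular_points[OF K] complement_subset_regular_points[OF K]] by blast
    obtain C' N' where C': "C' \<ge> 0" "\<And>g. (\<And>k. Ck_on k UNIV g) \<Longrightarrow> (\<And>p. p \<notin> K \<Longrightarrow> g p = 0) \<Longrightarrow>
        Ck_seminorm N L (radon_transpose g) \<le> C' * Ck_seminorm N' K g"
      using radon_transpose_seminorm[OF K L, of N] by blast
    have "norm (radon A f g) \<le> (\<bar>C\<bar> * C') * Ck_seminorm N' K g"
      if g: "g \<in> test_funs Omega_times_pos" and gK: "\<forall>p. p \<notin> K \<longrightarrow> g p = 0" for g
    proof -
      have Cg: "\<And>k. Ck_on k UNIV g" using test_funsE[OF g] by metis
      have sm: "smooth_on (- sphere_pt ` fst ` K) (radon_transpose g)"
        by (rule smooth_on_radon_transpose[OF K Cg]) (use gK in auto)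
      have "norm (radon A f g) \<le> C * Ck_seminorm N L (radon_transpose g)"
        unfolding radon_eq[OF g] by (rule C[OF sm])
      also have "\<dots> \<le> \<bar>C\<bar> * Ck_seminorm N L (radon_transpose g)"
        by (rule mult_right_mono[OF abs_ge_self Ck_seminorm_nonneg[OF L(1) smooth_on_mono[OF sm L(2)]]])
      also have "\<dots> \<le> \<bar>C\<bar> * (C' * Ck_seminorm N' K g)"
        by (rule mult_left_mono[OF C'(2)[OF Cg]]) (use gK in auto)
      finally show ?thesis by (simp add: mult.assoc)
    qed
    then show ?thesis by blast
  qed
  ultimately show ?thesis
    unfolding distributions_def by blast
qed

lemma dist_operator_radon: "dist_operator Omega_times_pos (- top_half) (radon A)"
  unfolding dist_operator_def
proof (intro conjI ballI allI impI)
  fix g :: "(real ^ 'm) \<times> real \<Rightarrow> complex" assume g: "g \<in> test_funs Omega_times_pos"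
  fix F and f :: "(real ^ 'm option) functional"
  assume "compact_dists_tendsto (- top_half) F f"
  then obtain Kf where Kf: "Kf \<subseteq> - top_half"
    and lim: "\<forall>W \<phi>. open W \<and> Kf \<subseteq> W \<and> smooth_on W \<phi> \<longrightarrow> (\<lambda>j. F j \<phi>) \<longlonglongrightarrow> f \<phi>"
    unfolding compact_dists_tendsto_def by (elim exE conjE) (rule that)
  obtain K where K: "compact K" "K \<subseteq> Omega_times_pos" "\<And>p. p \<notin> K \<Longrightarrow> g p = 0" "\<And>k. Ck_on k UNIV g"
    using test_funsE[OF g] by metis
  show "(\<lambda>j. radon A (F j) g) \<longlonglongrightarrow> radon A f g"
    unfolding radon_eq[OF g]
    by (rule lim[rule_format, OF conjI[OF open_regular_points[OF K(1,2)]
          conjI[OF order_trans[OF Kf complement_subset_regular_points[OF K(1,2)]]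
            smooth_on_radon_transpose[OF K(1,2,4)]]]]) (rule K(3))
next
  show "radon A f \<in> distributions Omega_times_pos" if "f \<in> compact_dists (- top_half)" for f
    by (rule radon_in_distributions[OF that])
qed (simp_all add: radon_def osc_operator_def)

abbreviation (input) regular_pairs :: "(((real ^ 'm) \<times> real) \<times> (real ^ 'm option)) set" where
  "regular_pairs \<equiv> {z. fst (fst z) \<in> Omega \<and> snd z \<noteq> sphere_pt (fst (fst z))}"

lemma open_regular_pairs: "open regular_pairs"
  and Ck_on_pair_dist: "Ck_on k regular_pairs (\<lambda>z. sphere_dist (snd z, fst (fst z)))"
  and Ck_on_pair_phase: "Ck_on k regular_pairs (\<lambda>z. snd (fst z) - shifted_quad (snd z, fst (fst z)))"
proof -
  have lin: "bounded_linear (\<lambda>z :: ((real ^ 'm) \<times> real) \<times> (real ^ 'm option). (snd z, fst (fst z)))"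
    "bounded_linear (\<lambda>z :: ((real ^ 'm) \<times> real) \<times> (real ^ 'm option). snd (fst z))"
    by (intro bounded_linear_Pair bounded_linear_snd bounded_linear_compose[OF bounded_linear_fst]
        bounded_linear_compose[OF bounded_linear_snd] bounded_linear_fst)+
  have "regular_pairs = (\<lambda>z. (snd z, fst (fst z))) -` {(x, y). y \<in> Omega \<and> x \<noteq> sphere_pt y}"
    by auto
  moreover have "open ((\<lambda>z :: ((real ^ 'm) \<times> real) \<times> (real ^ 'm option). (snd z, fst (fst z))) -`
      {(x, y). y \<in> Omega \<and> x \<noteq> sphere_pt y})"
    by (rule open_vimage[OF open_distance bounded_linear.continuous_on[OF lin(1) continuous_on_id]])
  ultimately show op: "open regular_pairs" by (simp only:)
  show "Ck_on k regular_pairs (\<lambda>z. sphere_dist (snd z, fst (fst z)))"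
    by (rule Ck_on_compose[OF op open_distance Ck_on_linear[OF op lin(1)] Ck_on_sphere_dist]) auto
  have "Ck_on k regular_pairs (\<lambda>z. - shifted_quad (snd z, fst (fst z)))"
    by (rule Ck_on_compose[OF op open_distance Ck_on_linear[OF op lin(1)] Ck_on_phase]) auto
  from Ck_on_add[OF op Ck_on_linear[OF op lin(2)] this]
  show "Ck_on k regular_pairs (\<lambda>z. snd (fst z) - shifted_quad (snd z, fst (fst z)))"
    by simp
qed

lemma domain_subset_regular_pairs: "Omega_times_pos \<times> - top_half \<subseteq> regular_pairs"
  by (auto simp: Omega_times_pos_def top_half_def)

text \<open>The factor \<open>|x - s(y)|\<close> is smooth near the domain, since \<open>x\<close> avoids the half sphere.\<close>

lemma symbol_amplitude_radon:
  "symbol_amplitude 1 Omega_times_pos (- top_half :: (real ^ 'm option) set)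
    (\<lambda>(z, s). sphere_dist (snd z, fst (fst z)) * high_abs s)"
  unfolding symbol_amplitude_def
proof (intro conjI allI impI)
  have op: "open (regular_pairs \<times> (UNIV :: real set))"
    by (intro open_Times open_regular_pairs open_UNIV)
  have "Ck_on k (regular_pairs \<times> UNIV) (\<lambda>p. sphere_dist (snd (fst p), fst (fst (fst p))) * high_abs (snd p))" for k
  proof (rule Ck_on_mult[OF op])
    show "Ck_on k (regular_pairs \<times> (UNIV :: real set)) (\<lambda>p. sphere_dist (snd (fst p), fst (fst (fst p))))"
      by (rule Ck_on_compose[OF op open_regular_pairs Ck_on_linear[OF op bounded_linear_fst] Ck_on_pair_dist]) auto
    show "Ck_on k (regular_pairs \<times> UNIV) (\<lambda>p. high_abs (snd p))"
      by (rule Ck_on_compose[OF op open_UNIV Ck_on_linear[OF op bounded_linear_snd] Ck_on_high_abs]) auto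
  qed
  then have "smooth_on (regular_pairs \<times> (UNIV :: real set))
      (\<lambda>(z, s). sphere_dist (snd z, fst (fst z)) * high_abs s)"
    unfolding smooth_on_open[OF op] case_prod_unfold by blast
  then show "smooth_on ((Omega_times_pos \<times> - (top_half :: (real ^ 'm option) set)) \<times> UNIV)
      (\<lambda>(z, s). sphere_dist (snd z, fst (fst z)) * high_abs s)"
    by (rule smooth_on_mono) (use domain_subset_regular_pairs in blast)
  fix K :: "(((real ^ 'm) \<times> real) \<times> (real ^ 'm option)) set"
    and xs :: "(((real ^ 'm) \<times> real) \<times> (real ^ 'm option)) list" and ts :: "real list"
  assume a: "compact K \<and> K \<subseteq> Omega_times_pos \<times> - top_half \<and> set xs \<subseteq> Basis \<and> set ts \<subseteq> Basis"
  have ts: "ts = replicate (length ts) 1"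
    using a by (auto simp: list_eq_iff_nth_eq subset_iff in_set_conv_nth)
  have KS: "K \<subseteq> regular_pairs" using a domain_subset_regular_pairs by auto
  let ?r = "\<lambda>z :: ((real ^ 'm) \<times> real) \<times> (real ^ 'm option). sphere_dist (snd z, fst (fst z))"
  have "continuous_on regular_pairs (iter_deriv xs ?r)"
    by (rule Ck_on_imp_continuous_on[OF Ck_on_iter_deriv[OF Ck_on_pair_dist]])
  from compact_imp_bounded[OF compact_continuous_image[OF continuous_on_subset[OF this KS]]]
  have "bounded (iter_deriv xs ?r ` K)" using a by blast
  then obtain B where "\<forall>w\<in>iter_deriv xs ?r ` K. norm w \<le> B"
    unfolding bounded_iff by blast
  then have B: "norm (iter_deriv xs ?r z) \<le> \<bar>B\<bar>" if "z \<in> K" for z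
    using that by fastforce
  obtain C where C: "\<And>s. norm (iter_deriv ts high_abs s) \<le> C * (1 + \<bar>s\<bar>) powr (1 - real (length ts))"
    using high_abs_symbol[of "length ts"] ts by metis
  show "\<exists>C. \<forall>z\<in>K. \<forall>s. norm (iter_deriv (map (\<lambda>b. (b, 0)) xs @ map (\<lambda>b. (0, b)) ts)
      (\<lambda>(z, s). ?r z * high_abs s) (z, s)) \<le> C * (1 + norm s) powr (1 - real (length ts))"
  proof (intro exI[of _ "\<bar>B\<bar> * C"] ballI allI)
    fix z s assume z: "z \<in> K"
    have "norm (iter_deriv (map (\<lambda>b. (b, 0)) xs @ map (\<lambda>b. (0, b)) ts) (\<lambda>(z, s). ?r z * high_abs s) (z, s)) =
        norm (iter_deriv xs ?r z) * norm (iter_deriv ts high_abs s)"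
      by (subst iter_deriv_tensor[OF open_regular_pairs Ck_on_pair_dist Ck_on_high_abs])
        (use z KS in \<open>auto simp: norm_mult\<close>)
    also have "\<dots> \<le> \<bar>B\<bar> * (C * (1 + \<bar>s\<bar>) powr (1 - real (length ts)))"
      by (intro mult_mono B z C) auto
    finally show "norm (iter_deriv (map (\<lambda>b. (b, 0)) xs @ map (\<lambda>b. (0, b)) ts) (\<lambda>(z, s). ?r z * high_abs s) (z, s))
        \<le> \<bar>B\<bar> * C * (1 + norm s) powr (1 - real (length ts))"
      by (simp add: mult.assoc)
  qed
qed

text \<open>The amplitude is \<open>high_abs\<close> times the distance; the complementary part \<open>low_abs\<close> has compact support
  in frequency and gives the smooth error kernel.\<close>

lemma fourier_integral_operator_radon:
  "fourier_integral_operator Omega_times_pos (- top_half) (psi A) (radon A)"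
  unfolding fourier_integral_operator_def
proof (intro conjI)
  show "open (Omega_times_pos :: ((real ^ 'm) \<times> real) set)"
    unfolding Omega_times_pos_def by (intro open_Times open_Omega) auto
  show "- top_half \<subseteq> closure (interior (- top_half :: (real ^ 'm option) set))"
    by (rule half_sphere_complement_subset)
  show "dist_operator Omega_times_pos (- top_half) (radon A)"
    by (rule dist_operator_radon)
  show "nondegenerate_phase Omega_times_pos (- top_half) (psi A)"
    by (rule nondegenerate_phase_psi[OF diagonal entries])
  let ?a = "\<lambda>(z, s). sphere_dist (snd z, fst (fst z)) * high_abs s"
  let ?\<tau> = "\<lambda>z :: ((real ^ 'm) \<times> real) \<times> (real ^ 'm option). snd (fst z) - shifted_quad (snd z, fst (fst z))"
  let ?k = "\<lambda>z. (LINT s|lborel. low_abs s * osc (s * ?\<tau> z)) * sphere_dist (snd z, fst (fst z))"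
  have "Ck_on k regular_pairs ?k" for k
    by (rule Ck_on_compact_frequency_integral[OF open_regular_pairs Ck_on_pair_dist Ck_on_pair_phase
          continuous_on_low_abs low_abs_eq_0])
  then have "smooth_on (Omega_times_pos \<times> - top_half) ?k"
    unfolding smooth_on_def using open_regular_pairs domain_subset_regular_pairs by blast
  moreover have "\<exists>I. has_osc_integral (psi A) ?a (\<lambda>(u, v). g u * h v) I \<and>
      radon A (dist_of_fun h) g = I + (LINT p|lborel. (case p of (u, v) \<Rightarrow> ?k (u, v) * g u * h v))"
    if g: "g \<in> test_funs Omega_times_pos" and h: "h \<in> test_funs (- top_half)" for g h
  proof -
    obtain K where K: "compact K" "\<And>p. p \<notin> K \<Longrightarrow> g p = 0" "\<And>k. Ck_on k UNIV g"
      using test_funsE[OF g] by metis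
    obtain L where L: "compact L" "\<And>x. x \<notin> L \<Longrightarrow> h x = 0" "continuous_on UNIV h"
      using test_funsE[OF h] by metis
    note split = pairing_split[OF continuous_on_sphere_dist continuous_on_shifted_quad K(3,1) _ L(3,1) _
        continuous_on_high_abs norm_high_abs_le continuous_on_low_abs norm_low_abs_le integrable_low_abs
        high_low_abs amplitude_bound]
    let ?m = "\<lambda>s. LINT z|lborel. sphere_dist (snd z, fst (fst z)) * (g (fst z) * h (snd z)) * osc (s * ?\<tau> z)"
    let ?I = "LINT s|lborel. high_abs s * ?m s"
    have "has_osc_integral (\<lambda>(z, s). s * ?\<tau> z) (\<lambda>(z, s). high_abs s * sphere_dist (snd z, fst (fst z)))
          (\<lambda>z. g (fst z) * h (snd z)) ?I"
      by (rule split(1)) (use K(2) L(2) in auto)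
    moreover have "(LINT x|lborel. h x * radon_transpose g x) = ?I +
        (LINT z|lborel. (LINT s|lborel. low_abs s * osc (s * ?\<tau> z)) *
          (sphere_dist (snd z, fst (fst z)) * (g (fst z) * h (snd z))))"
      unfolding radon_transpose_def by (rule split(2)) (use K(2) L(2) in auto)
    moreover have "has_osc_integral (psi A) ?a (\<lambda>(u, v). g u * h v) I \<longleftrightarrow>
        has_osc_integral (\<lambda>(z, s). s * ?\<tau> z) (\<lambda>(z, s). high_abs s * sphere_dist (snd z, fst (fst z)))
          (\<lambda>z. g (fst z) * h (snd z)) I" for I
      by (simp add: psi_eq case_prod_unfold mult.commute)
    moreover have "radon A (dist_of_fun h) g = (LINT x|lborel. h x * radon_transpose g x)"
      by (simp add: radon_eq[OF g] dist_of_fun_def)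
    moreover have "(LINT p|lborel. (case p of (u, v) \<Rightarrow> ?k (u, v) * g u * h v)) =
        (LINT z|lborel. (LINT s|lborel. low_abs s * osc (s * ?\<tau> z)) *
          (sphere_dist (snd z, fst (fst z)) * (g (fst z) * h (snd z))))"
      by (simp add: case_prod_unfold mult.assoc)
    ultimately have "has_osc_integral (psi A) ?a (\<lambda>(u, v). g u * h v) ?I \<and>
        radon A (dist_of_fun h) g = ?I + (LINT p|lborel. (case p of (u, v) \<Rightarrow> ?k (u, v) * g u * h v))"
      by (simp only: simp_thms)
    then show ?thesis by blast
  qed
  ultimately show "\<exists>m a k. symbol_amplitude m Omega_times_pos (- top_half) a \<and> smooth_on (Omega_times_pos \<times> - top_half) k \<and>
      (\<forall>g\<in>test_funs Omega_times_pos. \<forall>h\<in>test_funs (- top_half).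
         \<exists>I. has_osc_integral (psi A) a (\<lambda>(u, v). g u * h v) I \<and>
           radon A (dist_of_fun h) g = I + (LINT p|lborel. (case p of (u, v) \<Rightarrow> k (u, v) * g u * h v)))"
    by (intro exI[of _ "1::real"] exI[of _ ?a] exI[of _ ?k] conjI ballI symbol_amplitude_radon)
qed

end


section \<open>Determinants with respect to orthonormal bases\<close>

text \<open>The sum in the definition of \<open>lin_det\<close> for a given matching \<open>\<beta>\<close> of the bases.\<close>

definition basis_det :: "('a::euclidean_space \<Rightarrow> 'b::euclidean_space) \<Rightarrow> ('a \<Rightarrow> 'b) \<Rightarrow> real" where
  "basis_det \<beta> L = (\<Sum>p | p permutes Basis. of_int (sign p) * (\<Prod>i\<in>Basis. L i \<bullet> \<beta> (p i)))"

lemma lin_det_eq: "lin_det L = basis_det (SOME \<beta>. bij_betw \<beta> Basis Basis) L"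
  by (simp add: lin_det_def basis_det_def Let_def)

context
  fixes h :: "'a::euclidean_space \<Rightarrow> 'i::finite"
  assumes h: "bij_betw h Basis UNIV"
begin

abbreviation (input) "hi \<equiv> inv_into Basis h"

lemma hi_h: "b \<in> Basis \<Longrightarrow> hi (h b) = b"
  using h by (rule bij_betw_inv_into_left)

lemma hi_Basis: "hi i \<in> Basis" and h_hi: "h (hi i) = i"
  using bij_betw_inv_into[OF h] bij_betw_inv_into_right[OF h] by (auto simp: bij_betw_def)

lemma sum_Basis: "(\<Sum>b\<in>Basis. f b) = (\<Sum>i\<in>UNIV. f (hi i))"
  by (rule sum.reindex_bij_betw[symmetric, OF bij_betw_inv_into[OF h]])

text \<open>Indexing the basis by a finite type makes the determinant theory of square matrices available.\<close>

lemma basis_det_eq_det: "basis_det \<beta> L = det (\<chi> i j. L (hi i) \<bullet> \<beta> (hi j))"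
proof -
  have "det (\<chi> i j. L (hi i) \<bullet> \<beta> (hi j)) =
      (\<Sum>p | p permutes (Basis :: 'a set). of_int (sign (map_permutation Basis h p)) *
        (\<Prod>i\<in>UNIV. L (hi i) \<bullet> \<beta> (hi (map_permutation Basis h p i))))"
    unfolding det_def
    by (rule sum.reindex_bij_witness[where j = "map_permutation UNIV hi" and i = "map_permutation Basis h"])
      (auto simp: map_permutation_permutes[OF h] map_permutation_permutes[OF bij_betw_inv_into[OF h]]
        map_permutation_compose_inv[OF h] hi_h
        map_permutation_compose_inv[OF bij_betw_inv_into[OF h]] h_hi)
  also have "\<dots> = basis_det \<beta> L"
    unfolding basis_det_def
  proof (intro sum.cong refl arg_cong2[of _ _ _ _ "(*)"])
    fix p assume "p \<in> {p. p permutes (Basis :: 'a set)}"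
    then have p: "p permutes Basis" by simp
    show "of_int (sign (map_permutation Basis h p)) = (of_int (sign p) :: real)"
      by (subst sign_map_permutation) (use p h bij_betw_imp_inj_on in auto)
    show "(\<Prod>i\<in>UNIV. L (hi i) \<bullet> \<beta> (hi (map_permutation Basis h p i))) = (\<Prod>i\<in>Basis. L i \<bullet> \<beta> (p i))"
    proof (rule prod.reindex_bij_witness[where j = hi and i = h])
      fix i :: 'i
      have "map_permutation Basis h p (h (hi i)) = h (p (hi i))"
        by (rule map_permutation_apply[OF bij_betw_imp_inj_on[OF h] hi_Basis])
      then show "L (hi i) \<bullet> \<beta> (p (hi i)) = L (hi i) \<bullet> \<beta> (hi (map_permutation Basis h p i))"
        using permutes_in_image[OF p] hi_Basis by (simp add: h_hi hi_h)
    qed (auto simp: hi_h h_hi hi_Basis)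
  qed
  finally show ?thesis by simp
qed

lemma basis_det_compose:
  fixes L :: "'a \<Rightarrow> 'b::euclidean_space" and T :: "'a \<Rightarrow> 'a"
  assumes "linear L"
  shows "basis_det \<beta> (\<lambda>v. L (T v)) = basis_det id T * basis_det \<beta> L"
proof -
  have "L (T u) \<bullet> w = (\<Sum>k\<in>UNIV. (T u \<bullet> hi k) * (L (hi k) \<bullet> w))" for u w
  proof -
    have "L (T u) = L (\<Sum>b\<in>Basis. (T u \<bullet> b) *\<^sub>R b)" by (simp add: euclidean_representation)
    also have "\<dots> = (\<Sum>k\<in>UNIV. (T u \<bullet> hi k) *\<^sub>R L (hi k))"
      unfolding sum_Basis by (simp add: linear_sum[OF assms] linear_scale[OF assms])
    finally show ?thesis by (simp add: inner_sum_left)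
  qed
  then have "(\<chi> i j. L (T (hi i)) \<bullet> \<beta> (hi j)) = (\<chi> i j. T (hi i) \<bullet> id (hi j)) ** (\<chi> i j. L (hi i) \<bullet> \<beta> (hi j))"
    by (simp add: matrix_matrix_mult_def vec_eq_iff)
  then show ?thesis
    unfolding basis_det_eq_det by (simp add: det_mul)
qed

lemma basis_det_nonzero:
  fixes M :: "'a \<Rightarrow> 'b::euclidean_space"
  assumes "linear M" "inj M" "bij_betw \<beta> (Basis :: 'a set) (Basis :: 'b set)"
  shows "basis_det \<beta> M \<noteq> 0"
proof -
  let ?X = "\<chi> i j. M (hi i) \<bullet> \<beta> (hi j)"
  have "x = 0" if x: "transpose ?X *v x = 0" for x
  proof -
    let ?v = "\<Sum>i\<in>UNIV. (x $ i) *\<^sub>R hi i"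
    have Mv: "M ?v \<bullet> b = 0" if "b \<in> Basis" for b
    proof -
      from that have "b \<in> \<beta> ` Basis"
        unfolding bij_betw_imp_surj_on[OF assms(3)] .
      then obtain a where "b = \<beta> a" "a \<in> Basis" by (rule imageE)
      then have b: "b = \<beta> (hi (h a))" by (simp add: hi_h)
      have "M ?v \<bullet> b = (\<Sum>i\<in>UNIV. x $ i * (M (hi i) \<bullet> b))"
        by (simp add: linear_sum[OF assms(1)] linear_scale[OF assms(1)] inner_sum_left)
      also have "\<dots> = (transpose ?X *v x) $ h a"
        by (simp add: matrix_vector_mult_def transpose_def b mult.commute)
      finally show ?thesis using x by simp
    qed
    have "M ?v = M 0"
      unfolding linear_0[OF assms(1)] by (rule euclidean_eqI) (simp only: inner_zero_left Mv)
    then have v: "?v = 0" by (rule injD[OF assms(2)])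
    have "x $ j = ?v \<bullet> hi j" for j
    proof -
      have "hi i \<bullet> hi j = (if i = j then 1 else 0)" for i
        using hi_Basis[of i] hi_Basis[of j] h_hi by (metis inner_Basis)
      then have "?v \<bullet> hi j = (\<Sum>i\<in>UNIV. x $ i * (if i = j then 1 else 0))"
        by (simp only: inner_sum_left inner_scaleR_left)
      then show ?thesis by (simp add: mult_delta_right)
    qed
    then show "x = 0" unfolding v by (simp add: vec_eq_iff)
  qed
  then have "invertible (transpose ?X)"
    unfolding invertible_left_inverse matrix_left_invertible_ker by blast
  then show ?thesis
    unfolding basis_det_eq_det by (simp add: invertible_det_nz det_transpose)
qed

end

text \<open>Scaling a basis direction scales a single factor of every product in the determinant.\<close>

lemma basis_det_scale_direction:
  assumes M: "linear M" and e: "e \<in> Basis"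
  shows "basis_det \<beta> (\<lambda>v. M (v + ((c - 1) * (v \<bullet> e)) *\<^sub>R e)) = c * basis_det \<beta> M"
proof -
  have M': "M (b + ((c - 1) * (b \<bullet> e)) *\<^sub>R e) = (if b = e then c else 1) *\<^sub>R M b" if "b \<in> Basis" for b
  proof (cases "b = e")
    case True
    have "b + ((c - 1) * (b \<bullet> e)) *\<^sub>R e = c *\<^sub>R b"
      using True e by (simp add: algebra_simps)
    then show ?thesis using True by (simp add: linear_scale[OF M])
  next
    case False
    then show ?thesis using e that by (simp add: inner_Basis)
  qed
  have "(\<Prod>i\<in>Basis. M (i + ((c - 1) * (i \<bullet> e)) *\<^sub>R e) \<bullet> \<beta> (p i)) = c * (\<Prod>i\<in>Basis. M i \<bullet> \<beta> (p i))" for p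
  proof -
    have "(\<Prod>i\<in>Basis. M (i + ((c - 1) * (i \<bullet> e)) *\<^sub>R e) \<bullet> \<beta> (p i)) =
        (\<Prod>i\<in>Basis. (if i = e then c else 1) * (M i \<bullet> \<beta> (p i)))"
      by (rule prod.cong) (simp_all add: M')
    also have "\<dots> = (\<Prod>i\<in>Basis. if i = e then c else 1) * (\<Prod>i\<in>Basis. M i \<bullet> \<beta> (p i))"
      by (rule prod.distrib)
    also have "(\<Prod>i\<in>Basis. if i = e then c else 1) = c"
      using e by simp
    finally show ?thesis .
  qed
  then show ?thesis
    unfolding basis_det_def by (simp add: sum_distrib_left mult_ac)
qed

lemma continuous_on_basis_det:
  fixes M :: "'p::topological_space \<Rightarrow> 'a::euclidean_space \<Rightarrow> 'b::euclidean_space"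
  assumes "\<And>b. b \<in> Basis \<Longrightarrow> continuous_on S (\<lambda>p. M p b)"
  shows "continuous_on S (\<lambda>p. basis_det \<beta> (M p))"
  unfolding basis_det_def by (intro continuous_intros assms)

section \<open>A criterion for folds\<close>

text \<open>Mere continuity of the factor \<open>c\<close> suffices at a zero of \<open>g\<close>; in the application \<open>c\<close> is a
  determinant whose derivative would be unpleasant to compute.\<close>

lemma has_derivative_mult_at_zero:
  fixes c g :: "'a::euclidean_space \<Rightarrow> real"
  assumes c: "isCont c x" and g: "(g has_derivative g') (at x)" and "g x = 0"
  shows "((\<lambda>x. c x * g x) has_derivative (\<lambda>h. c x * g' h)) (at x)"
proof -
  have lin: "bounded_linear g'" using g by (rule has_derivative_bounded_linear)
  have lim: "(\<lambda>h. (g (x + h) - g x - g' h) /\<^sub>R norm h) \<midarrow>0\<rightarrow> 0"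
  proof (rule tendsto_norm_zero_cancel)
    have "(\<lambda>h. norm (g (x + h) - g x - g' h) / norm h) \<midarrow>0\<rightarrow> 0"
      using g unfolding has_derivative_at by blast
    then show "(\<lambda>h. norm ((g (x + h) - g x - g' h) /\<^sub>R norm h)) \<midarrow>0\<rightarrow> 0"
      by (simp add: divide_inverse_commute abs_mult)
  qed
  have c1: "(\<lambda>h. c (x + h)) \<midarrow>0\<rightarrow> c x"
    using c by (simp add: isCont_iff)
  have A: "(\<lambda>h. c (x + h) * ((g (x + h) - g x - g' h) /\<^sub>R norm h)) \<midarrow>0\<rightarrow> 0"
    using tendsto_mult[OF c1 lim] by simp
  obtain B where B: "\<And>h. norm (g' h) \<le> norm h * B"
    using bounded_linear.bounded[OF lin] by blast
  have B0: "(\<lambda>h. (c (x + h) - c x) * (g' h /\<^sub>R norm h)) \<midarrow>0\<rightarrow> 0"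
  proof (rule Lim_null_comparison)
    show "eventually (\<lambda>h. norm ((c (x + h) - c x) * (g' h /\<^sub>R norm h)) \<le> \<bar>c (x + h) - c x\<bar> * B) (at 0)"
    proof (rule eventually_at_filter[THEN iffD2, OF always_eventually], safe)
      fix h :: 'a assume "h \<noteq> 0"
      then have "\<bar>g' h\<bar> / norm h \<le> B"
        using B[of h] by (simp add: pos_divide_le_eq mult.commute)
      then show "norm ((c (x + h) - c x) * (g' h /\<^sub>R norm h)) \<le> \<bar>c (x + h) - c x\<bar> * B"
        by (simp add: abs_mult divide_inverse_commute mult_left_mono)
    qed
    have "(\<lambda>h. c (x + h) - c x) \<midarrow>0\<rightarrow> 0"
      using tendsto_diff[OF c1 tendsto_const[of "c x"]] by simp
    then show "(\<lambda>h. \<bar>c (x + h) - c x\<bar> * B) \<midarrow>0\<rightarrow> 0"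
      by (intro tendsto_mult_left_zero tendsto_rabs_zero)
  qed
  have "(\<lambda>h. (c (x + h) * g (x + h) - c x * g x - c x * g' h) /\<^sub>R norm h) \<midarrow>0\<rightarrow> 0"
    using tendsto_add[OF A B0] \<open>g x = 0\<close> by (simp add: algebra_simps)
  then have "(\<lambda>h. norm (c (x + h) * g (x + h) - c x * g x - c x * g' h) / norm h) \<midarrow>0\<rightarrow> 0"
    by (subst (asm) tendsto_norm_zero_iff[symmetric]) (simp add: divide_inverse_commute abs_mult)
  then show ?thesis
    unfolding has_derivative_at using bounded_linear_const_mult[OF lin] by blast
qed

text \<open>The hypothesis factors the derivative through the map that multiplies the coordinate along
  \<open>e\<close> by \<open>g p\<close>; the Jacobian is then \<open>g\<close> times a nonvanishing continuous function, which need not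
  be computed.  A kernel vector along which \<open>g\<close> varies gives both conditions of a fold.\<close>

lemma fold_criterion:
  fixes f :: "'a::euclidean_space \<Rightarrow> 'b::euclidean_space" and h :: "'a \<Rightarrow> 'i::finite"
    and M :: "'a \<Rightarrow> 'a \<Rightarrow> 'b" and N :: "'a \<Rightarrow> 'a \<Rightarrow> 'a" and g g' :: "'a \<Rightarrow> real"
  assumes h: "bij_betw h (Basis :: 'a set) (UNIV :: 'i set)" and dim: "DIM('a) = DIM('b)"
    and S: "open S" "p0 \<in> S" and e: "e \<in> Basis"
    and D: "\<And>p v. p \<in> S \<Longrightarrow> frechet_derivative f (at p) v = M p (N p v + ((g p - 1) * (N p v \<bullet> e)) *\<^sub>R e)"
    and M: "\<And>p. p \<in> S \<Longrightarrow> linear (M p)" "\<And>p. p \<in> S \<Longrightarrow> inj (M p)"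
      "\<And>b. b \<in> Basis \<Longrightarrow> continuous_on S (\<lambda>p. M p b)"
    and N: "\<And>p. p \<in> S \<Longrightarrow> linear (N p)" "\<And>p. p \<in> S \<Longrightarrow> inj (N p)"
      "\<And>b. b \<in> Basis \<Longrightarrow> continuous_on S (\<lambda>p. N p b)"
    and g: "(g has_derivative g') (at p0)"
    and kernel: "g p0 = 0 \<Longrightarrow> frechet_derivative f (at p0) k = 0" "g p0 = 0 \<Longrightarrow> g' k \<noteq> 0"
    and zero: "jac_det f p0 = 0"
  shows "frechet_derivative (jac_det f) (at p0) \<noteq> (\<lambda>_. 0)" and "fold_at f p0"
proof -
  define \<beta> where "\<beta> = (SOME \<beta>. bij_betw \<beta> (Basis :: 'a set) (Basis :: 'b set))"
  have \<beta>: "bij_betw \<beta> (Basis :: 'a set) (Basis :: 'b set)"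
    unfolding \<beta>_def using finite_same_card_bij[OF finite_Basis finite_Basis dim] by (rule someI_ex)
  define c where "c p = basis_det id (N p) * basis_det \<beta> (M p)" for p
  have jac: "jac_det f p = c p * g p" if p: "p \<in> S" for p
  proof -
    let ?R = "\<lambda>v. v + ((g p - 1) * (v \<bullet> e)) *\<^sub>R e"
    have linR: "linear ?R"
      by (rule linearI) (simp_all add: inner_add_left algebra_simps)
    have "frechet_derivative f (at p) = (\<lambda>v. M p (?R (N p v)))"
      by (rule ext) (rule D[OF p])
    then have "jac_det f p = basis_det \<beta> (\<lambda>v. M p (?R (N p v)))"
      unfolding jac_det_def lin_det_eq \<beta>_def by (simp only:)
    also have "\<dots> = basis_det id (N p) * basis_det \<beta> (\<lambda>v. M p (?R v))"
      by (rule basis_det_compose[OF h linear_compose[OF linR M(1)[OF p], unfolded o_def]])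
    also have "\<dots> = c p * g p"
      unfolding basis_det_scale_direction[OF M(1)[OF p] e] c_def by (simp only: mult_ac)
    finally show ?thesis .
  qed
  have c0: "c p \<noteq> 0" if p: "p \<in> S" for p
    unfolding c_def
    using basis_det_nonzero[OF h M(1)[OF p] M(2)[OF p] \<beta>]
      basis_det_nonzero[OF h N(1)[OF p] N(2)[OF p], of id] by simp
  have "continuous_on S c"
    unfolding c_def by (intro continuous_on_mult continuous_on_basis_det M N)
  then have "isCont c p0"
    using S by (simp add: continuous_on_eq_continuous_at)
  moreover have g0: "g p0 = 0"
    using zero jac[OF S(2)] c0[OF S(2)] by simp
  ultimately have "((\<lambda>p. c p * g p) has_derivative (\<lambda>h. c p0 * g' h)) (at p0)"
    by (intro has_derivative_mult_at_zero g)
  then have "(jac_det f has_derivative (\<lambda>h. c p0 * g' h)) (at p0)"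
    by (rule has_derivative_transform_within_open[OF _ S]) (simp add: jac)
  from frechet_derivative_at[OF this]
  have J: "frechet_derivative (jac_det f) (at p0) = (\<lambda>h. c p0 * g' h)" by simp
  show "frechet_derivative (jac_det f) (at p0) \<noteq> (\<lambda>_. 0)"
    unfolding J using kernel(2)[OF g0] c0[OF S(2)] by (auto dest: fun_cong[of _ _ k])
  have lg: "linear g'" using g has_derivative_linear by blast
  have "w \<in> {x + y |x y. frechet_derivative f (at p0) x = 0 \<and> frechet_derivative (jac_det f) (at p0) y = 0}" for w
  proof -
    let ?t = "g' w / g' k"
    have "N p0 (?t *\<^sub>R k) = ?t *\<^sub>R N p0 k" by (rule linear_scale[OF N(1)[OF S(2)]])
    then have "frechet_derivative f (at p0) (?t *\<^sub>R k) = M p0 (?t *\<^sub>R (N p0 k + ((g p0 - 1) * (N p0 k \<bullet> e)) *\<^sub>R e))"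
      by (simp only: D[OF S(2)] inner_scaleR_left scaleR_add_right scaleR_scaleR mult.left_commute)
    also have "\<dots> = ?t *\<^sub>R frechet_derivative f (at p0) k"
      unfolding linear_scale[OF M(1)[OF S(2)]] D[OF S(2)] ..
    finally have "frechet_derivative f (at p0) (?t *\<^sub>R k) = 0"
      using kernel(1)[OF g0] by simp
    moreover have "frechet_derivative (jac_det f) (at p0) (w - ?t *\<^sub>R k) = 0"
      unfolding J using kernel(2)[OF g0] by (simp add: linear_diff[OF lg] linear_scale[OF lg])
    moreover have "w = ?t *\<^sub>R k + (w - ?t *\<^sub>R k)" by simp
    ultimately show ?thesis by blast
  qed
  then show "fold_at f p0"
    unfolding fold_at_def by blast
qed


section \<open>The canonical relation\<close>

text \<open>It vanishes exactly when \<open>x\<close> lies in the tangent plane of the sphere at \<open>sphere_pt y\<close>.\<close>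

definition tangency :: "(real ^ 'm::finite) \<times> (real ^ 'm option) \<times> real \<Rightarrow> real" where
  "tangency = (\<lambda>(y, x, s). sphere_pt y \<bullet> (x - sphere_pt y))"

definition head :: "real ^ 'm option \<Rightarrow> real ^ 'm::finite" where
  "head z = (\<chi> j. z $ Some j)"

text \<open>A linear change of coordinates in which multiplication by \<open>Bmat y\<close> just forgets the last coordinate.\<close>

definition slanted_head :: "real ^ 'm::finite \<Rightarrow> real ^ 'm option \<Rightarrow> real ^ 'm option" where
  "slanted_head y z = (\<chi> i. case i of None \<Rightarrow> z $ None | Some j \<Rightarrow> z $ Some j - z $ None * y $ j / q y)"

lemma head_nth [simp]: "head z $ j = z $ Some j"
  by (simp add: head_def)

lemma slanted_head_None [simp]: "slanted_head y z $ None = z $ None"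
  and slanted_head_Some [simp]: "slanted_head y z $ Some j = z $ Some j - z $ None * y $ j / q y"
  by (simp_all add: slanted_head_def)

lemma linear_head: "linear head"
  by (rule linearI) (simp_all add: vec_eq_iff)

lemma linear_slanted_head: "linear (slanted_head y)"
  by (rule linearI) (simp_all add: vec_eq_option algebra_simps add_divide_distrib)

lemma inj_slanted_head: "inj (slanted_head y)"
proof (rule injI)
  fix z w assume "slanted_head y z = slanted_head y w"
  then show "z = w" unfolding vec_eq_option by auto
qed

lemma sphere_diff_tangent: "y \<in> Omega \<Longrightarrow> sphere_pt y \<bullet> sphere_diff y h = 0"
  using q_pos[of y] by (simp add: inner_option) (simp add: inner_vec_def)

text \<open>A vector is tangent to the sphere up to a multiple of the last basis vector, and the multiple is
  proportional to the component of the vector along the normal \<open>sphere_pt y\<close>.\<close>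

lemma sphere_diff_head:
  assumes "y \<in> Omega"
  shows "sphere_diff y (head z) + ((sphere_pt y \<bullet> z) / q y) *\<^sub>R axis None 1 = z"
proof -
  have "sphere_pt y \<bullet> z = q y * z $ None + y \<bullet> head z"
    by (simp add: inner_option) (simp add: inner_vec_def)
  then show ?thesis
    using q_pos[OF assms] by (simp add: vec_eq_option axis_def add_divide_distrib)
qed

lemma has_derivative_tangency:
  assumes "y \<in> Omega"
  shows "(tangency has_derivative (\<lambda>(dy, dx, ds). sphere_diff y dy \<bullet> (x - sphere_pt y) + sphere_pt y \<bullet> dx))
    (at (y, x, s))"
proof -
  have y: "((\<lambda>p. fst p) has_derivative (\<lambda>d. fst d)) (at (y, x, s))"
    and x: "((\<lambda>p. fst (snd p)) has_derivative (\<lambda>d. fst (snd d))) (at (y, x, s))"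
    by (auto intro!: derivative_eq_intros)
  have "(sphere_pt has_derivative sphere_diff y) (at (fst (y, x, s)))"
    using has_derivative_sphere_pt[OF assms] by simp
  from has_derivative_compose[OF y this]
  have S: "((\<lambda>p. sphere_pt (fst p)) has_derivative (\<lambda>d. sphere_diff y (fst d))) (at (y, x, s))" .
  from has_derivative_inner[OF S has_derivative_diff[OF x S]]
  show ?thesis
    using sphere_diff_tangent[OF assms]
    by (simp add: tangency_def case_prod_unfold inner_diff_right add.commute)
qed

context
  fixes A :: "real ^ ('m option) ^ ('m::finite option)"
  assumes diagonal: "\<And>i j. i \<noteq> j \<Longrightarrow> A $ i $ j = 0"
    and entries: "\<exists>k. A $ k $ k = 1 \<and> (\<forall>i. i \<noteq> k \<longrightarrow> A $ i $ i = -1)"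
begin

lemma A_linear: "linear ((*v) A)"
  by (rule matrix_vector_mul_linear)

lemma A_inj: "A *v z = A *v w \<longleftrightarrow> z = w"
  by (metis A_involution[OF diagonal entries])

lemma quad_signature:
  obtains k where "\<And>z. quad A z = 2 * (z $ k)\<^sup>2 - z \<bullet> z"
proof -
  obtain k where k: "A $ k $ k = 1" "\<And>i. i \<noteq> k \<Longrightarrow> A $ i $ i = -1"
    using entries by blast
  have "quad A z = 2 * (z $ k)\<^sup>2 - z \<bullet> z" for z
  proof -
    have "A *v z = (2 * z $ k) *\<^sub>R axis k 1 - z"
      using k by (auto simp: vec_eq_iff A_nth[OF diagonal entries] axis_def)
    then show ?thesis
      by (simp add: quad_def inner_diff_right inner_axis power2_eq_square)
  qed
  then show ?thesis by (rule that)
qed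

text \<open>The form has signature \<open>(1, n-1)\<close>, so the orthogonal complement of a timelike vector contains
  no null vector.\<close>

lemma quad_nonzero_of_orthogonal:
  assumes "quad A x > 0" "x \<bullet> s = 0" "s \<noteq> 0"
  shows "quad A s \<noteq> 0"
proof
  assume 0: "quad A s = 0"
  obtain k where k: "\<And>z. quad A z = 2 * (z $ k)\<^sup>2 - z \<bullet> z"
    using quad_signature by blast
  \<comment> \<open>the projection onto the negative definite coordinates, to which Cauchy--Schwarz is applied\<close>
  define P where "P z = z - (z $ k) *\<^sub>R axis k (1::real)" for z :: "real ^ 'm option"
  have P: "P z \<bullet> P w = z \<bullet> w - z $ k * w $ k" for z w
    by (simp add: P_def inner_diff_left inner_diff_right inner_axis inner_axis' algebra_simps)
  have "(P x \<bullet> P s)\<^sup>2 \<le> (P x \<bullet> P x) * (P s \<bullet> P s)"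
    by (rule Cauchy_Schwarz_ineq)
  then have "(x $ k)\<^sup>2 * (s $ k)\<^sup>2 \<le> (x \<bullet> x - (x $ k)\<^sup>2) * (s \<bullet> s - (s $ k)\<^sup>2)"
    unfolding P assms(2) by (simp add: power2_eq_square mult_ac)
  moreover have "s \<bullet> s - (s $ k)\<^sup>2 = (s $ k)\<^sup>2" using 0 k[of s] by simp
  moreover have "s \<bullet> s > 0" using assms(3) by simp
  then have "(s $ k)\<^sup>2 > 0" using 0 k[of s] by linarith
  ultimately have "(x $ k)\<^sup>2 \<le> x \<bullet> x - (x $ k)\<^sup>2"
    by simp
  then show False using assms(1) k[of x] by simp
qed

abbreviation (input) chart :: "((real ^ 'm) \<times> (real ^ 'm option) \<times> real) set" where
  "chart \<equiv> Omega \<times> UNIV \<times> (- {0})"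

lemma open_chart: "open chart"
  by (intro open_Times open_Omega open_UNIV open_Compl closed_singleton)

lemma param_domain_subset_chart: "param_domain A \<subseteq> chart"
  by (auto simp: param_domain_def)

lemma Ck_on_coordinates:
  "Ck_on k chart fst" "Ck_on k chart (\<lambda>p. fst (snd p))" "Ck_on k chart (\<lambda>p. snd (snd p))"
  "Ck_on k chart (\<lambda>p. A *v (fst (snd p) - sphere_pt (fst p)))"
  "Ck_on k chart (\<lambda>p. quad A (fst (snd p) - sphere_pt (fst p)))"
proof -
  show 1: "Ck_on k chart fst" and 2: "Ck_on k chart (\<lambda>p. fst (snd p))" "Ck_on k chart (\<lambda>p. snd (snd p))"
    by (intro Ck_on_linear[OF open_chart] bounded_linear_fst bounded_linear_compose[OF bounded_linear_fst]
        bounded_linear_compose[OF bounded_linear_snd] bounded_linear_snd)+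
  have "Ck_on k chart (\<lambda>p. sphere_pt (fst p))"
    by (rule Ck_on_compose[OF open_chart open_Omega 1 Ck_on_sphere_pt]) auto
  then have d: "Ck_on k chart (\<lambda>p. fst (snd p) - sphere_pt (fst p))"
    by (rule Ck_on_diff[OF open_chart 2(1)])
  show a: "Ck_on k chart (\<lambda>p. A *v (fst (snd p) - sphere_pt (fst p)))"
    by (rule Ck_on_bounded_linear[OF open_chart d matrix_vector_mul_bounded_linear])
  show "Ck_on k chart (\<lambda>p. quad A (fst (snd p) - sphere_pt (fst p)))"
    unfolding quad_def by (rule Ck_on_inner[OF open_chart d a])
qed

lemma Ck_on_pi_R: "Ck_on k chart (pi_R A)"
  unfolding pi_R_def case_prod_unfold
  by (intro Ck_on_Pair[OF open_chart] Ck_on_scaleR[OF open_chart] Ck_on_mult[OF open_chart] Ck_on_const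
      Ck_on_coordinates)

lemma Ck_on_pi_L: "Ck_on k chart (pi_L A)"
proof -
  have "Ck_on k chart (\<lambda>p. Bmat (fst p) *v (A *v (fst (snd p) - sphere_pt (fst p))))"
  proof (rule Ck_on_vec[OF open_chart])
    fix i
    have "Ck_on k chart (\<lambda>p. q (fst p))"
      by (rule Ck_on_compose[OF open_chart open_Omega Ck_on_coordinates(1) Ck_on_q]) auto
    then have "Ck_on k chart (\<lambda>p. (A *v (fst (snd p) - sphere_pt (fst p))) $ Some i -
        fst p $ i * (A *v (fst (snd p) - sphere_pt (fst p))) $ None / q (fst p))"
      using q_pos
      by (intro Ck_on_diff[OF open_chart] Ck_on_divide[OF open_chart] Ck_on_mult[OF open_chart]
          Ck_on_vec_nth[OF open_chart] Ck_on_coordinates) force+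
    then show "Ck_on k chart (\<lambda>p. (Bmat (fst p) *v (A *v (fst (snd p) - sphere_pt (fst p)))) $ i)"
      by (rule iffD1[OF Ck_on_cong[OF open_chart], rotated]) (auto simp: Bmat_mult)
  qed
  then show ?thesis
    unfolding pi_L_def case_prod_unfold
    by (intro Ck_on_Pair[OF open_chart] Ck_on_scaleR[OF open_chart] Ck_on_mult[OF open_chart] Ck_on_const
        Ck_on_coordinates)
qed

subsection \<open>The right projection\<close>

lemma has_derivative_pi_R:
  assumes "y \<in> Omega"
  shows "(pi_R A has_derivative (\<lambda>(dy, dx, ds).
      (dx, (2 * ds) *\<^sub>R (A *v (x - sphere_pt y)) + (2 * s) *\<^sub>R (A *v (dx - sphere_diff y dy))))) (at (y, x, s))"
proof -
  have y: "((\<lambda>p. fst p) has_derivative (\<lambda>d. fst d)) (at (y, x, s))"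
    and x: "((\<lambda>p. fst (snd p)) has_derivative (\<lambda>d. fst (snd d))) (at (y, x, s))"
    and s: "((\<lambda>p. 2 * snd (snd p)) has_derivative (\<lambda>d. 2 * snd (snd d))) (at (y, x, s))"
    by (auto intro!: derivative_eq_intros)
  have "(sphere_pt has_derivative sphere_diff y) (at (fst (y, x, s)))"
    using has_derivative_sphere_pt[OF assms] by simp
  from has_derivative_compose[OF y this]
  have S: "((\<lambda>p. sphere_pt (fst p)) has_derivative (\<lambda>d. sphere_diff y (fst d))) (at (y, x, s))" .
  have a: "((\<lambda>p. A *v (fst (snd p) - sphere_pt (fst p))) has_derivative
      (\<lambda>d. A *v (fst (snd d) - sphere_diff y (fst d)))) (at (y, x, s))"
    by (rule bounded_linear.has_derivative[OF matrix_vector_mul_bounded_linear has_derivative_diff[OF x S]])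
  from has_derivative_Pair[OF x has_derivative_scaleR[OF s a]]
  show ?thesis
    by (simp add: pi_R_def case_prod_unfold add.commute)
qed

lemma basis_index:
  obtains h :: "(real ^ 'm) \<times> (real ^ 'm option) \<times> real \<Rightarrow> 'm option + 'm option" where "bij_betw h Basis UNIV"
proof -
  have "DIM((real ^ 'm) \<times> (real ^ 'm option) \<times> real) = card (UNIV :: ('m option + 'm option) set)"
    by (simp add: card_UNIV_option)
  from finite_same_card_bij[OF finite_Basis _ this] show ?thesis
    using that by auto
qed

text \<open>With \<open>g = tangency p\<close>, the identity \<open>sphere_diff_head\<close> turns \<open>2 ds x\<^sub>T - 2 s d(s(y))\<close> into the image of
  \<open>2 ds x\<^sub>T' - 2 s dy\<close> under \<open>sphere_diff y\<close> plus \<open>2 g ds / q(y)\<close> times the last basis vector, where the prime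
  removes the last coordinate.  Thus the frequency coordinate is the one scaled by \<open>g\<close>.  At a zero
  of \<open>g\<close> the vector \<open>x\<^sub>T\<close> is tangent to the sphere, and \<open>(x\<^sub>T', 0, s)\<close> lies in the kernel.\<close>

lemma only_folds_pi_R: "only_folds (param_domain A) (pi_R A)"
proof -
  let ?e = "(0, 0, 1) :: (real ^ 'm) \<times> (real ^ 'm option) \<times> real"
  let ?N = "\<lambda>p (v :: (real ^ 'm) \<times> (real ^ 'm option) \<times> real). ((2 * snd (snd v)) *\<^sub>R head (fst (snd p) - sphere_pt (fst p)) - (2 * snd (snd p)) *\<^sub>R fst v, fst (snd v), snd (snd v))"
  let ?M = "\<lambda>p v. (fst (snd v), (2 * snd (snd p)) *\<^sub>R (A *v fst (snd v)) +
      A *v (sphere_diff (fst p) (fst v) + (2 * snd (snd v) / q (fst p)) *\<^sub>R axis None 1))"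
  obtain h :: "(real ^ 'm) \<times> (real ^ 'm option) \<times> real \<Rightarrow> 'm option + 'm option" where h: "bij_betw h Basis UNIV"
    using basis_index by blast
  have fold: "frechet_derivative (jac_det (pi_R A)) (at (y, x, s)) \<noteq> (\<lambda>_. 0)" "fold_at (pi_R A) (y, x, s)"
    if p: "(y, x, s) \<in> param_domain A" and zero: "jac_det (pi_R A) (y, x, s) = 0" for y x s
  proof -
    have y: "y \<in> Omega" and Q: "quad A (x - sphere_pt y) > 0" and s: "s \<noteq> 0"
      using p by (auto simp: param_domain_def)
    have fd: "frechet_derivative (pi_R A) (at (y, x, s)) = (\<lambda>(dy, dx, ds).
      (dx, (2 * ds) *\<^sub>R (A *v (x - sphere_pt y)) + (2 * s) *\<^sub>R (A *v (dx - sphere_diff y dy))))"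
      if "y \<in> Omega" for y x s
      using frechet_derivative_at[OF has_derivative_pi_R[OF that]] by simp
    have D: "frechet_derivative (pi_R A) (at p) v = ?M p (?N p v + ((tangency p - 1) * (?N p v \<bullet> ?e)) *\<^sub>R ?e)"
      if "p \<in> chart" for p v
    proof -
      obtain y x s dy dx ds where p: "p = (y, x, s)" and v: "v = (dy, dx, ds)" by (metis prod.exhaust)
      have y: "y \<in> Omega" using that p by simp
      let ?x = "x - sphere_pt y"
      have "(2 * ds) *\<^sub>R ?x = sphere_diff y ((2 * ds) *\<^sub>R head ?x) + (2 * (tangency p * ds) / q y) *\<^sub>R axis None 1"
        by (subst (1) sphere_diff_head[OF y, of ?x, symmetric])
          (simp add: linear_scale[OF linear_sphere_diff] scaleR_add_right tangency_def p mult_ac)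
      then have "(2 * ds) *\<^sub>R ?x - (2 * s) *\<^sub>R sphere_diff y dy =
          sphere_diff y ((2 * ds) *\<^sub>R head ?x - (2 * s) *\<^sub>R dy) + (2 * (tangency p * ds) / q y) *\<^sub>R axis None 1"
        by (simp add: linear_diff[OF linear_sphere_diff] linear_scale[OF linear_sphere_diff])
      then have eq: "A *v (sphere_diff y ((2 * ds) *\<^sub>R head ?x - (2 * s) *\<^sub>R dy) + (2 * (tangency p * ds) / q y) *\<^sub>R axis None 1) =
          (2 * ds) *\<^sub>R (A *v ?x) - (2 * s) *\<^sub>R (A *v sphere_diff y dy)"
        by (metis linear_diff[OF A_linear] linear_scale[OF A_linear])
      have "?N p v + ((tangency p - 1) * (?N p v \<bullet> ?e)) *\<^sub>R ?e =
          ((2 * ds) *\<^sub>R head ?x - (2 * s) *\<^sub>R dy, dx, tangency p * ds)"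
        by (simp add: p v inner_prod_def algebra_simps)
      then show ?thesis
        unfolding p v fd[OF y]
        by (simp add: eq[unfolded p] linear_diff[OF A_linear] scaleR_diff_right)
    qed
    have M_lin: "linear (?M p)" if "p \<in> chart" for p
      by (rule linearI) (simp_all add: linear_add[OF A_linear] linear_scale[OF A_linear]
          linear_add[OF linear_sphere_diff] linear_scale[OF linear_sphere_diff] algebra_simps add_divide_distrib)
    have M_inj: "inj (?M p)" if "p \<in> chart" for p
    proof (subst linear_injective_0[OF M_lin[OF that]], intro allI impI)
      fix v assume 0: "?M p v = 0"
      then have dx: "fst (snd v) = 0" by (simp add: zero_prod_def)
      have "A *v (sphere_diff (fst p) (fst v) + (2 * snd (snd v) / q (fst p)) *\<^sub>R axis None 1) = A *v 0"
        using 0 dx by (simp add: zero_prod_def)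
      then have e: "sphere_diff (fst p) (fst v) + (2 * snd (snd v) / q (fst p)) *\<^sub>R axis None 1 = 0"
        unfolding A_inj .
      have "fst v $ j = 0" for j
        using arg_cong[OF e, of "\<lambda>z. z $ Some j"] by (simp add: axis_def)
      then have dy: "fst v = 0" by (simp add: vec_eq_iff)
      moreover have "snd (snd v) = 0"
        using arg_cong[OF e, of "\<lambda>z. z $ None"] dy q_pos[of "fst p"] that by (auto simp: axis_def)
      ultimately show "v = 0" using dx by (simp add: prod_eq_iff)
    qed
    have N_lin: "linear (?N p)" for p
      by (rule linearI) (simp_all add: prod_eq_iff algebra_simps)
    have N_inj: "inj (?N p)" if "p \<in> chart" for p
      using that by (subst linear_injective_0[OF N_lin]) (auto simp: zero_prod_def prod_eq_iff)
    have cont: "continuous_on chart (\<lambda>p. sphere_pt (fst p))" "continuous_on chart (\<lambda>p. q (fst p))"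
      by (auto intro!: continuous_on_compose2[OF continuous_on_sphere_pt] continuous_intros
          continuous_on_compose2[OF Ck_on_imp_continuous_on[OF Ck_on_q]])
    have q0: "\<forall>p\<in>chart. q (fst p) \<noteq> 0"
      using q_pos by force
    have M_cont: "continuous_on chart (\<lambda>p. ?M p b)" for b
    proof -
      have "continuous_on chart (\<lambda>p. sphere_diff (fst p) (fst b) $ i)" for i
        using q0 by (cases i) (auto intro!: continuous_intros cont)
      then have "continuous_on chart (\<lambda>p. sphere_diff (fst p) (fst b))"
        using continuous_on_vec_lambda[of chart "\<lambda>i p. sphere_diff (fst p) (fst b) $ i"] by simp
      then show ?thesis
        using q0 by (intro continuous_intros cont bounded_linear.continuous_on[OF matrix_vector_mul_bounded_linear]) auto
    qed
    have N_cont: "continuous_on chart (\<lambda>p. ?N p b)" for b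
    proof -
      have "continuous_on chart (\<lambda>p. head (fst (snd p) - sphere_pt (fst p)))"
        by (intro bounded_linear.continuous_on[OF linear_conv_bounded_linear[THEN iffD1, OF linear_head]]
            continuous_intros cont)
      then show ?thesis by (intro continuous_intros)
    qed
    have e: "?e \<in> Basis" by (simp add: Basis_prod_def)
    have in_chart: "(y, x, s) \<in> chart" using y s by simp
    let ?x = "x - sphere_pt y"
    let ?k = "(head ?x, 0, s) :: (real ^ 'm) \<times> (real ^ 'm option) \<times> real"
    have k0: "sphere_diff y (head ?x) = ?x" if "tangency (y, x, s) = 0"
      using sphere_diff_head[OF y, of ?x] that by (simp add: tangency_def)
    have kernel: "frechet_derivative (pi_R A) (at (y, x, s)) ?k = 0" if "tangency (y, x, s) = 0"
    proof -
      have "A *v (0 - ?x) = - (A *v ?x)"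
        by (simp only: diff_0 linear_neg[OF A_linear])
      then show ?thesis
        unfolding fd[OF y] case_prod_conv k0[OF that] by (simp only: zero_prod_def) simp
    qed
    have "?x \<noteq> 0" using Q by (auto simp: quad_def)
    then have transversal: "(\<lambda>(dy, dx, ds). sphere_diff y dy \<bullet> ?x + sphere_pt y \<bullet> dx) ?k \<noteq> 0"
      if "tangency (y, x, s) = 0"
      using k0[OF that] by simp
    show "frechet_derivative (jac_det (pi_R A)) (at (y, x, s)) \<noteq> (\<lambda>_. 0)" "fold_at (pi_R A) (y, x, s)"
      by (rule fold_criterion[OF h _ open_chart in_chart e D M_lin M_inj M_cont N_lin N_inj N_cont
            has_derivative_tangency[OF y] kernel transversal zero]; simp)+
  qed
  moreover have "smooth_on (param_domain A) (pi_R A)"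
    using Ck_on_pi_R by (intro smooth_on_mono[OF _ param_domain_subset_chart]) (simp add: smooth_on_open[OF open_chart])
  ultimately show ?thesis
    unfolding only_folds_def S1_def by (auto simp: card_UNIV_option)
qed

subsection \<open>The left projection\<close>

lemma has_derivative_pi_L:
  "p \<in> chart \<Longrightarrow> (pi_L A has_derivative frechet_derivative (pi_L A) (at p)) (at p)"
  by (rule Ck_on_has_derivative[OF Ck_on_pi_L])

text \<open>The components \<open>y\<close> and \<open>\<omega>\<close> are copied by the projection.  A vector
  that the differential maps to \<open>0\<close> thus has \<open>dy = 0\<close> and \<open>d\<omega> = 0\<close>, and on such vectors
  the differential is explicit.\<close>

lemma frechet_derivative_pi_L_components:
  assumes "p \<in> chart"
  shows "fst (fst (frechet_derivative (pi_L A) (at p) v)) = fst v"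
    and "snd (snd (frechet_derivative (pi_L A) (at p) v)) = snd (snd v)"
proof -
  have "((\<lambda>p. fst (fst (pi_L A p))) has_derivative (\<lambda>v. fst (fst (frechet_derivative (pi_L A) (at p) v)))) (at p)"
    by (intro has_derivative_fst has_derivative_pi_L assms)
  moreover have "(\<lambda>p. fst (fst (pi_L A p))) = fst" by (auto simp: pi_L_def)
  ultimately have "(fst has_derivative (\<lambda>v. fst (fst (frechet_derivative (pi_L A) (at p) v)))) (at p)" by simp
  from has_derivative_unique[OF this bounded_linear_imp_has_derivative[OF bounded_linear_fst]]
  show "fst (fst (frechet_derivative (pi_L A) (at p) v)) = fst v" by (rule fun_cong)
  have "((\<lambda>p. snd (snd (pi_L A p))) has_derivative (\<lambda>v. snd (snd (frechet_derivative (pi_L A) (at p) v)))) (at p)"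
    by (intro has_derivative_snd has_derivative_pi_L assms)
  moreover have "(\<lambda>p. snd (snd (pi_L A p))) = (\<lambda>p. snd (snd p))" by (auto simp: pi_L_def)
  ultimately have "((\<lambda>p. snd (snd p)) has_derivative (\<lambda>v. snd (snd (frechet_derivative (pi_L A) (at p) v)))) (at p)" by simp
  from has_derivative_unique[OF this bounded_linear_imp_has_derivative[OF
        bounded_linear_compose[OF bounded_linear_snd bounded_linear_snd]]]
  show "snd (snd (frechet_derivative (pi_L A) (at p) v)) = snd (snd v)" by (rule fun_cong)
qed

lemma frechet_derivative_pi_L_space:
  assumes "(y, x, s) \<in> chart"
  shows "frechet_derivative (pi_L A) (at (y, x, s)) (0, dx, 0) =
    ((0, 2 * ((A *v dx) \<bullet> (x - sphere_pt y))), ((2 * s) *\<^sub>R (Bmat y *v (A *v dx)), 0))"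
proof -
  have "((\<lambda>x. (y, x, s)) has_derivative (\<lambda>dx. (0, dx, 0))) (at x)"
    by (auto intro!: derivative_eq_intros)
  from has_derivative_compose[OF this has_derivative_pi_L[OF assms]]
  have 1: "((\<lambda>x. pi_L A (y, x, s)) has_derivative (\<lambda>dx. frechet_derivative (pi_L A) (at (y, x, s)) (0, dx, 0))) (at x)" .
  have d: "((\<lambda>x. x - sphere_pt y) has_derivative (\<lambda>dx. dx)) (at x)"
    by (auto intro!: derivative_eq_intros)
  have 2: "((\<lambda>x. pi_L A (y, x, s)) has_derivative
      (\<lambda>dx. ((0, 2 * (dx \<bullet> (A *v (x - sphere_pt y)))), ((2 * s) *\<^sub>R (Bmat y *v (A *v dx)), 0)))) (at x)"
    unfolding pi_L_def case_prod_conv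
    by (intro has_derivative_Pair has_derivative_const has_derivative_scaleR_right
        bounded_linear.has_derivative[OF matrix_vector_mul_bounded_linear]
        has_derivative_compose[OF d has_derivative_quad[OF diagonal entries]] d)
  show ?thesis
    using fun_cong[OF has_derivative_unique[OF 1 2], of dx] by (simp add: A_symmetric[OF diagonal entries])
qed

text \<open>Put \<open>z = A dx\<close> and \<open>w = slanted_head y z\<close>.  Then \<open>B z\<close> consists of the coordinates of \<open>w\<close> other than the
  last, and \<open>z \<bullet> x\<^sub>T\<close> is a linear form in them plus \<open>tangency p / q(y)\<close> times the last coordinate
  of \<open>w\<close>, which is therefore the coordinate to scale.  The kernel vector \<open>dx = A s(y)\<close> has \<open>z = s(y)\<close>, a normal vector of the sphere, which is annihilated
  by \<open>B\<close>.\<close>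

lemma only_folds_pi_L: "only_folds (param_domain A) (pi_L A)"
proof -
  let ?e = "(0, axis None 1, 0) :: (real ^ 'm) \<times> (real ^ 'm option) \<times> real"
  let ?fd = "\<lambda>p. frechet_derivative (pi_L A) (at p)"
  let ?N = "\<lambda>p (v :: (real ^ 'm) \<times> (real ^ 'm option) \<times> real).
      (fst v, slanted_head (fst p) (A *v fst (snd v)), snd (snd v))"
  let ?M = "\<lambda>p (v :: (real ^ 'm) \<times> (real ^ 'm option) \<times> real). ?fd p (fst v, 0, snd (snd v)) +
      ((0, 2 * (head (fst (snd p) - sphere_pt (fst p)) \<bullet> head (fst (snd v))) + 2 * (fst (snd v) $ None) / q (fst p)),
       ((2 * snd (snd p)) *\<^sub>R head (fst (snd v)), 0))"
  obtain h :: "(real ^ 'm) \<times> (real ^ 'm option) \<times> real \<Rightarrow> 'm option + 'm option" where h: "bij_betw h Basis UNIV"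
    using basis_index by blast
  have fd_lin: "linear (?fd p)" if "p \<in> chart" for p
    using has_derivative_linear[OF has_derivative_pi_L[OF that]] .
  have D: "?fd p v = ?M p (?N p v + ((tangency p - 1) * (?N p v \<bullet> ?e)) *\<^sub>R ?e)" if pc: "p \<in> chart" for p v
  proof -
    obtain y x s dy dx ds where p: "p = (y, x, s)" and v: "v = (dy, dx, ds)" by (metis prod.exhaust)
    have y: "y \<in> Omega" using pc p by simp
    let ?x = "x - sphere_pt y" and ?z = "A *v dx"
    define w where "w = slanted_head y ?z + ((tangency p - 1) * ?z $ None) *\<^sub>R axis None 1"
    have w: "?N p v + ((tangency p - 1) * (?N p v \<bullet> ?e)) *\<^sub>R ?e = (dy, w, ds)"
      by (simp add: p v inner_prod_def inner_axis w_def)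
    have hw: "head w = Bmat y *v ?z"
      using y by (simp add: w_def vec_eq_iff Bmat_mult axis_def mult.commute)
    have wn: "w $ None = tangency p * ?z $ None"
      by (simp add: w_def axis_def algebra_simps)
    have g: "tangency p = y \<bullet> head ?x + q y * ?x $ None"
      by (simp add: p tangency_def inner_option) (simp add: inner_vec_def)
    have hz: "head w = head ?z - (?z $ None / q y) *\<^sub>R y"
      unfolding hw using y by (simp add: vec_eq_iff Bmat_mult)
    have "?z \<bullet> ?x = head ?x \<bullet> head ?z + ?z $ None * ?x $ None"
      by (simp only: inner_option) (simp add: inner_vec_def mult.commute)
    also have "\<dots> = head ?x \<bullet> head w + w $ None / q y"
      unfolding wn g hz using q_pos[OF y]
      by (simp add: inner_diff_right inner_commute[of _ y] field_simps)
    finally have q2: "2 * (?z \<bullet> ?x) = 2 * (head ?x \<bullet> head w) + 2 * (w $ None) / q y" by simp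
    have "?fd p v = ?fd p (dy, 0, ds) + ?fd p (0, dx, 0)"
      using linear_add[OF fd_lin[OF pc], of "(dy, 0, ds)" "(0, dx, 0)"] by (simp add: v)
    also have "?fd p (0, dx, 0) = ((0, 2 * (?z \<bullet> ?x)), ((2 * s) *\<^sub>R (Bmat y *v ?z), 0))"
      using frechet_derivative_pi_L_space pc unfolding p by simp
    finally show ?thesis
      unfolding w q2 hw[symmetric] by (simp add: p)
  qed
  have M_lin: "linear (?M p)" if "p \<in> chart" for p
  proof (rule linearI)
    fix v w :: "(real ^ 'm) \<times> (real ^ 'm option) \<times> real" and r :: real
    have "?fd p (fst (v + w), 0, snd (snd (v + w))) = ?fd p (fst v, 0, snd (snd v)) + ?fd p (fst w, 0, snd (snd w))"
      by (subst linear_add[OF fd_lin[OF that], symmetric]) simp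
    then show "?M p (v + w) = ?M p v + ?M p w"
      by (simp add: linear_add[OF linear_head] inner_add_right algebra_simps add_divide_distrib)
    have "?fd p (fst (r *\<^sub>R v), 0, snd (snd (r *\<^sub>R v))) = r *\<^sub>R ?fd p (fst v, 0, snd (snd v))"
      by (subst linear_scale[OF fd_lin[OF that], symmetric]) simp
    then show "?M p (r *\<^sub>R v) = r *\<^sub>R ?M p v"
      by (simp add: linear_scale[OF linear_head] algebra_simps)
  qed
  have M_inj: "inj (?M p)" if pc: "p \<in> chart" for p
  proof (subst linear_injective_0[OF M_lin[OF pc]], intro allI impI)
    fix v assume 0: "?M p v = 0"
    note comp = frechet_derivative_pi_L_components[OF pc, of "(fst v, 0, snd (snd v))"]
    have dy: "fst v = 0" using arg_cong[OF 0, of "\<lambda>z. fst (fst z)"] comp by simp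
    have ds: "snd (snd v) = 0" using arg_cong[OF 0, of "\<lambda>z. snd (snd z)"] comp by simp
    have "?fd p (fst v, 0, snd (snd v)) = 0"
      using linear_0[OF fd_lin[OF pc]] by (simp add: dy ds zero_prod_def)
    then have *: "2 * (head (fst (snd p) - sphere_pt (fst p)) \<bullet> head (fst (snd v))) + 2 * (fst (snd v) $ None) / q (fst p) = 0"
      "(2 * snd (snd p)) *\<^sub>R head (fst (snd v)) = 0"
      using 0 by (simp_all add: zero_prod_def)
    have "snd (snd p) \<noteq> 0" "q (fst p) > 0" using pc q_pos[of "fst p"] by auto
    then have hd: "head (fst (snd v)) = 0" and "fst (snd v) $ None = 0"
      using * by auto
    moreover have "fst (snd v) $ Some j = 0" for j
      using arg_cong[OF hd, of "\<lambda>z. z $ j"] by simp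
    ultimately have "fst (snd v) = 0" by (simp add: vec_eq_option)
    with dy ds show "v = 0" by (simp add: prod_eq_iff)
  qed
  have N_lin: "linear (?N p)" for p
    by (rule linearI) (simp_all add: prod_eq_iff linear_add[OF A_linear] linear_scale[OF A_linear]
        linear_add[OF linear_slanted_head] linear_scale[OF linear_slanted_head])
  have N_inj: "inj (?N p)" for p
  proof (rule injI)
    fix v w assume "?N p v = ?N p w"
    then show "v = w"
      by (simp add: prod_eq_iff inj_eq[OF inj_slanted_head] A_inj)
  qed
  have cont: "continuous_on chart (\<lambda>p. sphere_pt (fst p))" "continuous_on chart (\<lambda>p. q (fst p))"
    by (auto intro!: continuous_on_compose2[OF continuous_on_sphere_pt] continuous_intros
        continuous_on_compose2[OF Ck_on_imp_continuous_on[OF Ck_on_q]])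
  have q0: "\<forall>p\<in>chart. q (fst p) \<noteq> 0"
    using q_pos by force
  have M_cont: "continuous_on chart (\<lambda>p. ?M p b)" for b
  proof -
    have "continuous_on chart (\<lambda>p. head (fst (snd p) - sphere_pt (fst p)))"
      by (intro bounded_linear.continuous_on[OF linear_conv_bounded_linear[THEN iffD1, OF linear_head]]
          continuous_intros cont)
    moreover have "continuous_on chart (\<lambda>p. ?fd p (fst b, 0, snd (snd b)))"
      using Ck_on_pi_L[of "Suc 0"] by simp
    ultimately show ?thesis
      using q0 by (intro continuous_intros cont)
  qed
  have N_cont: "continuous_on chart (\<lambda>p. ?N p b)" for b
  proof -
    have "continuous_on chart (\<lambda>p. slanted_head (fst p) (A *v fst (snd b)) $ i)" for i
      using q0 by (cases i) (auto intro!: continuous_intros cont)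
    then have "continuous_on chart (\<lambda>p. slanted_head (fst p) (A *v fst (snd b)))"
      using continuous_on_vec_lambda[of chart "\<lambda>i p. slanted_head (fst p) (A *v fst (snd b)) $ i"] by simp
    then show ?thesis by (intro continuous_intros)
  qed
  have e: "?e \<in> Basis" by (simp add: Basis_prod_def axis_in_Basis_iff)
  have fold: "frechet_derivative (jac_det (pi_L A)) (at (y, x, s)) \<noteq> (\<lambda>_. 0)" "fold_at (pi_L A) (y, x, s)"
    if p: "(y, x, s) \<in> param_domain A" and zero: "jac_det (pi_L A) (y, x, s) = 0" for y x s
  proof -
    have y: "y \<in> Omega" and Q: "quad A (x - sphere_pt y) > 0" and s: "s \<noteq> 0"
      using p by (auto simp: param_domain_def)
    have in_chart: "(y, x, s) \<in> chart" using y s by simp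
    let ?x = "x - sphere_pt y"
    let ?k = "(0, A *v sphere_pt y, 0) :: (real ^ 'm) \<times> (real ^ 'm option) \<times> real"
    have B0: "Bmat y *v sphere_pt y = 0"
      using q_pos[OF y] by (simp add: vec_eq_iff Bmat_mult[OF y])
    have kernel: "?fd (y, x, s) ?k = 0" if "tangency (y, x, s) = 0"
      unfolding frechet_derivative_pi_L_space[OF in_chart]
      using that by (simp add: A_involution[OF diagonal entries] B0 tangency_def zero_prod_def)
    have "quad A (sphere_pt y) \<noteq> 0" if "tangency (y, x, s) = 0"
      by (rule quad_nonzero_of_orthogonal[OF Q])
        (use that sphere_pt_unit[OF y] in \<open>auto simp: tangency_def inner_commute\<close>)
    then have transversal: "(\<lambda>(dy, dx, ds). sphere_diff y dy \<bullet> ?x + sphere_pt y \<bullet> dx) ?k \<noteq> 0"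
      if "tangency (y, x, s) = 0"
      using that by (simp add: quad_def linear_0[OF linear_sphere_diff])
    show "frechet_derivative (jac_det (pi_L A)) (at (y, x, s)) \<noteq> (\<lambda>_. 0)" "fold_at (pi_L A) (y, x, s)"
      by (rule fold_criterion[OF h _ open_chart in_chart e D M_lin M_inj M_cont N_lin N_inj N_cont
            has_derivative_tangency[OF y] kernel transversal zero]; simp)+
  qed
  moreover have "smooth_on (param_domain A) (pi_L A)"
    using Ck_on_pi_L by (intro smooth_on_mono[OF _ param_domain_subset_chart]) (simp add: smooth_on_open[OF open_chart])
  ultimately show ?thesis
    unfolding only_folds_def S1_def by (auto simp: card_UNIV_option)
qed

subsection \<open>The global parametrization\<close>

abbreviation (input) rel_param where "rel_param \<equiv> \<lambda>p. (pi_L A p, pi_R A p)"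

definition rel_coords :: "(((real ^ 'm) \<times> real) \<times> ((real ^ 'm) \<times> real)) \<times> ((real ^ 'm option) \<times> (real ^ 'm option))
    \<Rightarrow> (real ^ 'm) \<times> (real ^ 'm option) \<times> real" where
  "rel_coords z = (fst (fst (fst z)), fst (snd z), snd (snd (fst z)))"

lemma rel_coords_param: "rel_coords (rel_param p) = p"
  by (simp add: rel_coords_def pi_L_def pi_R_def case_prod_unfold)

lemma bounded_linear_rel_coords: "bounded_linear rel_coords"
  unfolding rel_coords_def[abs_def]
  by (intro bounded_linear_Pair bounded_linear_fst bounded_linear_snd bounded_linear_compose[OF bounded_linear_fst]
      bounded_linear_compose[OF bounded_linear_snd])

text \<open>Stationarity in the frequency determines \<open>t\<close>, so \<open>t > 0\<close> becomes positivity of the quadratic form.\<close>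

lemma canonical_relation_eq:
  "canonical_relation Omega_times_pos (- top_half) (psi A) = rel_param ` param_domain A"
proof (intro equalityI subsetI)
  fix z assume "z \<in> canonical_relation Omega_times_pos (- top_half) (psi A)"
  then obtain y t x s where z: "z = (((y, t), gradient (\<lambda>u. psi A ((u, x), s)) (y, t)), (x, - gradient (\<lambda>v. psi A (((y, t), v), s)) x))"
    and *: "y \<in> Omega" "t > 0" "x \<notin> top_half" "s \<noteq> 0" "gradient (\<lambda>s. psi A (((y, t), x), s)) s = 0"
    unfolding canonical_relation_def Omega_times_pos_def by auto
  have t: "t = quad A (x - sphere_pt y)"
    using *(5) by (simp add: gradient_psi_theta[OF diagonal entries])
  have "gradient (\<lambda>u. psi A ((u, x), s)) (y, t) = ((2 * s) *\<^sub>R (Bmat y *v (A *v (x - sphere_pt y))), s)"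
    by (rule gradient_psi_u[OF diagonal entries *(1)])
  moreover have "gradient (\<lambda>v. psi A (((y, t), v), s)) x = - ((2 * s) *\<^sub>R (A *v (x - sphere_pt y)))"
    using gradient_psi_x[OF diagonal entries, of "(y, t)" s x] by simp
  ultimately have "z = rel_param (y, x, s)"
    unfolding z by (simp add: pi_L_def pi_R_def t)
  moreover have "(y, x, s) \<in> param_domain A"
    using * t by (simp add: param_domain_def)
  ultimately show "z \<in> rel_param ` param_domain A" by blast
next
  fix z assume "z \<in> rel_param ` param_domain A"
  then obtain y x s where z: "z = rel_param (y, x, s)"
    and *: "y \<in> Omega" "x \<notin> top_half" "s \<noteq> 0" "quad A (x - sphere_pt y) > 0"
    unfolding param_domain_def by auto
  let ?t = "quad A (x - sphere_pt y)"
  have "gradient (\<lambda>u. psi A ((u, x), s)) (y, ?t) = ((2 * s) *\<^sub>R (Bmat y *v (A *v (x - sphere_pt y))), s)"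
    by (rule gradient_psi_u[OF diagonal entries *(1)])
  moreover have "gradient (\<lambda>v. psi A (((y, ?t), v), s)) x = - ((2 * s) *\<^sub>R (A *v (x - sphere_pt y)))"
    using gradient_psi_x[OF diagonal entries, of "(y, ?t)" s x] by simp
  ultimately have "z = (((y, ?t), gradient (\<lambda>u. psi A ((u, x), s)) (y, ?t)), (x, - gradient (\<lambda>v. psi A (((y, ?t), v), s)) x))"
    unfolding z by (simp add: pi_L_def pi_R_def)
  moreover have "gradient (\<lambda>s. psi A (((y, ?t), x), s)) s = 0"
    by (simp add: gradient_psi_theta[OF diagonal entries])
  ultimately show "z \<in> canonical_relation Omega_times_pos (- top_half) (psi A)"
    unfolding canonical_relation_def Omega_times_pos_def using * by blast
qed

text \<open>Equatorial points belong to the domain but are not interior to it; removing the whole sphere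
  leaves an open dense subset.\<close>

lemma param_domain_subset_closure_interior: "param_domain A \<subseteq> closure (interior (param_domain A))"
proof -
  let ?G = "chart \<inter> {p. quad A (fst (snd p) - sphere_pt (fst p)) > 0}"
  let ?D = "UNIV \<times> (- sphere 0 1) \<times> UNIV :: ((real ^ 'm) \<times> (real ^ 'm option) \<times> real) set"
  have "open {p :: (real ^ 'm) \<times> (real ^ 'm option) \<times> real. quad A (fst (snd p) - sphere_pt (fst p)) > 0}"
    unfolding quad_def
    by (intro open_Collect_less continuous_intros continuous_on_compose2[OF continuous_on_sphere_pt]
        bounded_linear.continuous_on[OF matrix_vector_mul_bounded_linear]) auto
  then have G: "open ?G" by (intro open_Int open_chart)
  have "closure (- sphere 0 1 :: (real ^ 'm option) set) = UNIV"
    unfolding closure_complement sphere_interior_empty by simp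
  then have "closure ?D = UNIV" by (simp add: closure_Times)
  moreover have "open ?D" by (intro open_Times open_UNIV open_Compl closed_sphere)
  have "?G \<inter> ?D \<subseteq> param_domain A"
  proof
    fix p assume p: "p \<in> ?G \<inter> ?D"
    obtain y x s where pe: "p = (y, x, s)" by (metis prod.exhaust)
    have "x \<notin> top_half"
      using p by (auto simp: pe top_half_def norm_eq_sqrt_inner sphere_pt_unit)
    then show "p \<in> param_domain A" using p by (simp add: pe param_domain_def)
  qed
  from interior_maximal[OF this open_Int[OF G \<open>open ?D\<close>]]
  have "?G \<inter> ?D \<subseteq> interior (param_domain A)" .
  then have "closure (?G \<inter> ?D) \<subseteq> closure (interior (param_domain A))"
    by (rule closure_mono)
  moreover have "?G \<inter> closure ?D \<subseteq> closure (?G \<inter> ?D)"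
    by (rule open_Int_closure_subset[OF G])
  moreover have "param_domain A \<subseteq> ?G"
    by (auto simp: param_domain_def)
  ultimately show ?thesis by auto
qed

text \<open>The relation contains \<open>y\<close>, \<open>x\<close> and \<open>\<omega>\<close> among its coordinates, so a linear map inverts the
  parametrization.\<close>

lemma global_parametrization_rel:
  "global_parametrization (param_domain A) rel_param (canonical_relation Omega_times_pos (- top_half) (psi A))"
  unfolding global_parametrization_def
proof (intro conjI ballI)
  show "param_domain A \<subseteq> closure (interior (param_domain A))"
    by (rule param_domain_subset_closure_interior)
  have C: "Ck_on k chart rel_param" for k
    by (rule Ck_on_Pair[OF open_chart Ck_on_pi_L Ck_on_pi_R])
  then show "smooth_on (param_domain A) rel_param"
    by (intro smooth_on_mono[OF _ param_domain_subset_chart]) (simp add: smooth_on_open[OF open_chart])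
  show "inj (frechet_derivative rel_param (at p))" if "p \<in> param_domain A" for p
  proof (rule inj_on_inverseI)
    have "p \<in> chart" using that param_domain_subset_chart by blast
    from bounded_linear.has_derivative[OF bounded_linear_rel_coords Ck_on_has_derivative[OF C this]]
    have "((\<lambda>p. p) has_derivative (\<lambda>v. rel_coords (frechet_derivative rel_param (at p) v))) (at p)"
      unfolding rel_coords_param .
    from has_derivative_unique[OF this has_derivative_ident]
    show "rel_coords (frechet_derivative rel_param (at p) v) = v" for v by (rule fun_cong)
  qed
  have inj: "inj_on rel_param (param_domain A)"
    by (rule inj_on_inverseI[of _ rel_coords]) (rule rel_coords_param)
  have inv: "inv_into (param_domain A) rel_param z = rel_coords z" if "z \<in> rel_param ` param_domain A" for z
    using that inv_into_f_f[OF inj] rel_coords_param by auto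
  show "homeomorphism (param_domain A) (canonical_relation Omega_times_pos (- top_half) (psi A)) rel_param
      (inv_into (param_domain A) rel_param)"
    unfolding canonical_relation_eq
  proof (rule homeomorphismI)
    show "continuous_on (param_domain A) rel_param"
      by (rule continuous_on_subset[OF Ck_on_imp_continuous_on[OF C] param_domain_subset_chart])
    have "continuous_on (rel_param ` param_domain A) rel_coords"
      by (rule bounded_linear.continuous_on[OF bounded_linear_rel_coords continuous_on_id])
    then show "continuous_on (rel_param ` param_domain A) (inv_into (param_domain A) rel_param)"
      by (rule continuous_on_eq) (simp add: inv)
    show "inv_into (param_domain A) rel_param (rel_param p) = p" if "p \<in> param_domain A" for p
      by (rule inv_into_f_f[OF inj that])
    show "rel_param (inv_into (param_domain A) rel_param z) = z" if "z \<in> rel_param ` param_domain A" for z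
      by (rule f_inv_into_f[OF that])
  qed (auto simp: inv_into_into)
qed

end

theorem theorem5p2:
  fixes A :: "real ^ ('m option) ^ ('m::finite option)"
  assumes diagonal: "\<And>i j. i \<noteq> j \<Longrightarrow> A $ i $ j = 0"
    and entries: "\<exists>k. A $ k $ k = 1 \<and> (\<forall>i. i \<noteq> k \<longrightarrow> A $ i $ i = -1)"
  shows "fourier_integral_operator Omega_times_pos (- top_half) (psi A) (radon A) \<and>
    two_sided_fold (param_domain A) (\<lambda>p. (pi_L A p, pi_R A p))
      (canonical_relation Omega_times_pos (- top_half) (psi A))"
proof
  show "fourier_integral_operator Omega_times_pos (- top_half) (psi A) (radon A)"
    by (rule fourier_integral_operator_radon[OF diagonal entries])
  show "two_sided_fold (param_domain A) (\<lambda>p. (pi_L A p, pi_R A p))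
      (canonical_relation Omega_times_pos (- top_half) (psi A))"
    unfolding two_sided_fold_def
    using global_parametrization_rel[OF diagonal entries] only_folds_pi_L[OF diagonal entries]
      only_folds_pi_R[OF diagonal entries]
    by (simp add: comp_def)
qed

end
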